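(* Let $(G,V,E)$ be a graph. For any $i\ge 0$, the $\mathrm{FI}_V$-module $H_i(\mathrm{Conf}_\bullet^{\mathrm{sink}}(G,V))$ over $\mathbb{Z}$ is finitely generated.
   Context: A graph $(G,V,E)$ is a compact connected CW complex $G$ of dimension one together with its set $V$ of 0-cells (vertices) and its set $E$ of 1-cells (edges); loops and multiple edges are allowed. $\mathrm{Conf}_n^{\mathrm{sink}}(G,V)=\{(x_1,\dots,x_n)\in G^n \mid \text{for all } i\neq j:\ x_i\neq x_j \text{ or } x_i=x_j\in V\}$, with the subspace topology from $G^n$. The category $\mathrm{FI}_V$ has finite sets as objects; a morphism $S\to T$ is a pair $(f,g)$ of an injection $f:S\hookrightarrow T$ and a map of sets $g:T\setminus f(S)\to V$. Composition is $(f,g)\circ(f',g')=(f\circ f',h)$ with $h(x)=g(x)$ if $x\notin\mathrm{im} f$ and $h(x)=g'(f^{-1}(x))$ otherwise. One may restrict to the equivalent full subcategory on the sets $[n]=\{1,\dots,n\}$, $n \geq 0$. An $\mathrm{FI}_V$-module over a commutative ring $k$ is a functor $W$ from $\mathrm{FI}_V$ to $k$-modules; write $W_n=W([n])$. It is finitely generated if there is a finite collection of elements of $\bigsqcup_n W_n$ not contained in any proper $\mathrm{FI}_V$-submodule of $W$ (equivalently every element of each $W_n$ is a $k$-linear combination of images of these elements under morphisms of $\mathrm{FI}_V$). A morphism $(f,g):[m]\to[n]$ induces a continuous map $\mathrm{Conf}_m^{\mathrm{sink}}(G,V)\to\mathrm{Conf}_n^{\mathrm{sink}}(G,V)$ sending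 $(x_1,\dots,x_m)$ to the tuple whose $j$-th coordinate is $x_{f^{-1}(j)}$ if $j\in f([m])$ and $g(j)$ otherwise. Applying $H_i(-;\mathbb{Z})$ gives the $\mathrm{FI}_V$-module $H_i(\mathrm{Conf}_\bullet^{\mathrm{sink}}(G,V))$. *)

theory Defs
  imports "HOL-Homology.Homology" "HOL-Algebra.IntRing" "HOL-Algebra.Module"
begin

section \<open>Graphs as one-dimensional CW complexes\<close>

text \<open>
  The cells are subsets of the space: the vertices are the 0-cells, and an edge \<open>e \<in> E\<close> is an
  open 1-cell.  Its characteristic map is defined on the closed 1-disc \<open>{0..1}\<close>, sends
  the endpoints to vertices (possibly the same one: a loop) and restricts to a homeomorphism from
  the open interval onto \<open>e\<close>.  Dimension one means that there is at least one 1-cell.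
\<close>

definition char_map :: "'a topology \<Rightarrow> 'a set \<Rightarrow> 'a set \<Rightarrow> (real \<Rightarrow> 'a) \<Rightarrow> bool" where
  "char_map G V e \<phi> \<longleftrightarrow>
     continuous_map (top_of_set {0..1}) G \<phi> \<and>
     \<phi> 0 \<in> V \<and> \<phi> 1 \<in> V \<and>
     homeomorphic_map (top_of_set {0<..<1}) (subtopology G e) \<phi>"

definition cells :: "'a set \<Rightarrow> 'a set set \<Rightarrow> 'a set set" where
  "cells V E = (\<lambda>v. {v}) ` V \<union> E"

text \<open>
  The last conjunct is the weak topology. Closure-finiteness is automatic in dimension one.
\<close>

definition CW_dim_one :: "'a topology \<Rightarrow> 'a set \<Rightarrow> 'a set set \<Rightarrow> bool" where
  "CW_dim_one G V E \<longleftrightarrow>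
     Hausdorff_space G \<and>
     V \<union> \<Union>E = topspace G \<and> disjnt V (\<Union>E) \<and> pairwise disjnt E \<and>
     E \<noteq> {} \<and>
     (\<forall>e\<in>E. e \<subseteq> topspace G \<and> (\<exists>\<phi>. char_map G V e \<phi>)) \<and>
     (\<forall>A\<subseteq>topspace G. closedin G A \<longleftrightarrow> (\<forall>c\<in>cells V E. closedin G (A \<inter> G closure_of c)))"

definition graph :: "'a topology \<Rightarrow> 'a set \<Rightarrow> 'a set set \<Rightarrow> bool" where
  "graph G V E \<longleftrightarrow> CW_dim_one G V E \<and> compact_space G \<and> connected_space G"


section \<open>The category \<open>FI\<^sub>V\<close>, restricted to the objects \<open>[n] = {1..n}\<close>\<close>

text \<open>
  Both components of a morphism are extensional, so that equality of morphisms is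
  equality of pairs of HOL functions.
\<close>

definition FIV_hom :: "'v set \<Rightarrow> nat \<Rightarrow> nat \<Rightarrow> ((nat \<Rightarrow> nat) \<times> (nat \<Rightarrow> 'v)) set" where
  "FIV_hom V m n = {(f, g). f \<in> {1..m} \<rightarrow>\<^sub>E {1..n} \<and> inj_on f {1..m} \<and>
                            g \<in> ({1..n} - f ` {1..m}) \<rightarrow>\<^sub>E V}"

definition FIV_id :: "nat \<Rightarrow> (nat \<Rightarrow> nat) \<times> (nat \<Rightarrow> 'v)" where
  "FIV_id n = (\<lambda>j\<in>{1..n}. j, \<lambda>j. undefined)"

text \<open>
  \<open>FIV_comp l m n (f, g) (f', g')\<close> is \<open>(f, g) \<circ> (f', g')\<close> for
  \<open>(f', g') : [l] \<rightarrow> [m]\<close> and \<open>(f, g) : [m] \<rightarrow> [n]\<close>.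
\<close>

fun FIV_comp :: "nat \<Rightarrow> nat \<Rightarrow> nat \<Rightarrow> (nat \<Rightarrow> nat) \<times> (nat \<Rightarrow> 'v) \<Rightarrow> (nat \<Rightarrow> nat) \<times> (nat \<Rightarrow> 'v)
    \<Rightarrow> (nat \<Rightarrow> nat) \<times> (nat \<Rightarrow> 'v)" where
  "FIV_comp l m n (f, g) (f', g') =
     (\<lambda>j\<in>{1..l}. f (f' j),
      \<lambda>x\<in>{1..n} - (f \<circ> f') ` {1..l}.
         if x \<notin> f ` {1..m} then g x else g' (inv_into {1..m} f x))"


section \<open>\<open>FI\<^sub>V\<close>-modules\<close>

text \<open>
  A functor from \<open>FI\<^sub>V\<close> to \<open>R\<close>-modules: \<open>W n\<close> is the value at \<open>[n]\<close>, and \<open>act m n \<phi>\<close> is the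
  map induced by \<open>\<phi> : [m] \<rightarrow> [n]\<close>.
\<close>

locale FIV_module = cring R
  for R :: "('r, 'x) ring_scheme" (structure)
  and V :: "'v set"
  and W :: "nat \<Rightarrow> ('r, 'w, 'y) module_scheme"
  and act :: "nat \<Rightarrow> nat \<Rightarrow> (nat \<Rightarrow> nat) \<times> (nat \<Rightarrow> 'v) \<Rightarrow> 'w \<Rightarrow> 'w" +
  assumes module_W: "module R (W n)"
    and act_closed: "\<lbrakk>\<phi> \<in> FIV_hom V m n; x \<in> carrier (W m)\<rbrakk> \<Longrightarrow> act m n \<phi> x \<in> carrier (W n)"
    and act_add: "\<lbrakk>\<phi> \<in> FIV_hom V m n; x \<in> carrier (W m); y \<in> carrier (W m)\<rbrakk>
      \<Longrightarrow> act m n \<phi> (x \<oplus>\<^bsub>W m\<^esub> y) = act m n \<phi> x \<oplus>\<^bsub>W n\<^esub> act m n \<phi> y"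
    and act_smult: "\<lbrakk>\<phi> \<in> FIV_hom V m n; a \<in> carrier R; x \<in> carrier (W m)\<rbrakk>
      \<Longrightarrow> act m n \<phi> (a \<odot>\<^bsub>W m\<^esub> x) = a \<odot>\<^bsub>W n\<^esub> act m n \<phi> x"
    and act_id: "x \<in> carrier (W n) \<Longrightarrow> act n n (FIV_id n) x = x"
    and act_comp: "\<lbrakk>\<psi> \<in> FIV_hom V l m; \<phi> \<in> FIV_hom V m n; x \<in> carrier (W l)\<rbrakk>
      \<Longrightarrow> act l n (FIV_comp l m n \<phi> \<psi>) x = act m n \<phi> (act l m \<psi> x)"

definition FIV_submodule ::
  "('r, 'x) ring_scheme \<Rightarrow> 'v set \<Rightarrow> (nat \<Rightarrow> ('r, 'w, 'y) module_scheme) \<Rightarrow>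
   (nat \<Rightarrow> nat \<Rightarrow> (nat \<Rightarrow> nat) \<times> (nat \<Rightarrow> 'v) \<Rightarrow> 'w \<Rightarrow> 'w) \<Rightarrow> (nat \<Rightarrow> 'w set) \<Rightarrow> bool" where
  "FIV_submodule R V W act N \<longleftrightarrow>
     (\<forall>n. submodule (N n) R (W n)) \<and>
     (\<forall>m n. \<forall>\<phi>\<in>FIV_hom V m n. \<forall>x\<in>N m. act m n \<phi> x \<in> N n)"

text \<open>A finite subset \<open>S\<close> of the disjoint union of the \<open>W n\<close> lies in no proper submodule.\<close>

definition fin_gen_FIV_module ::
  "('r, 'x) ring_scheme \<Rightarrow> 'v set \<Rightarrow> (nat \<Rightarrow> ('r, 'w, 'y) module_scheme) \<Rightarrow>
   (nat \<Rightarrow> nat \<Rightarrow> (nat \<Rightarrow> nat) \<times> (nat \<Rightarrow> 'v) \<Rightarrow> 'w \<Rightarrow> 'w) \<Rightarrow> bool" where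
  "fin_gen_FIV_module R V W act \<longleftrightarrow>
     FIV_module R V W act \<and>
     (\<exists>S. finite S \<and> S \<subseteq> (SIGMA n:UNIV. carrier (W n)) \<and>
          (\<forall>N. FIV_submodule R V W act N \<and> (\<forall>(n, x)\<in>S. x \<in> N n)
               \<longrightarrow> (\<forall>n. N n = carrier (W n))))"


section \<open>Sink configuration spaces and their homology\<close>

definition conf_sink :: "'a topology \<Rightarrow> 'a set \<Rightarrow> nat \<Rightarrow> (nat \<Rightarrow> 'a) topology" where
  "conf_sink G V n =
     subtopology (product_topology (\<lambda>_. G) {1..n})
       {x. \<forall>i\<in>{1..n}. \<forall>j\<in>{1..n}. i \<noteq> j \<longrightarrow> x i \<noteq> x j \<or> (x i = x j \<and> x j \<in> V)}"

fun conf_map :: "nat \<Rightarrow> nat \<Rightarrow> (nat \<Rightarrow> nat) \<times> (nat \<Rightarrow> 'a) \<Rightarrow> (nat \<Rightarrow> 'a) \<Rightarrow> nat \<Rightarrow> 'a" where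
  "conf_map m n (f, g) x =
     (\<lambda>j\<in>{1..n}. if j \<in> f ` {1..m} then x (inv_into {1..m} f j) else g j)"

text \<open>
  The library's homology groups are multiplicative \<open>monoid\<close> records.  This is the
  \<open>\<int>\<close>-module of an abelian group in that notation; the ring multiplication and unit of a
  \<open>module\<close> record are irrelevant to the \<open>module\<close> locale.
\<close>

definition int_module :: "('a, 'b) monoid_scheme \<Rightarrow> (int, 'a) module" where
  "int_module A = \<lparr>carrier = carrier A, monoid.mult = monoid.mult A, one = one A,
                   zero = one A, add = monoid.mult A, smult = (\<lambda>k x. x [^]\<^bsub>A\<^esub> k)\<rparr>"

definition H_conf :: "'a topology \<Rightarrow> 'a set \<Rightarrow> nat \<Rightarrow> nat \<Rightarrow> (int, (nat \<Rightarrow> 'a) chain set) module" where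
  "H_conf G V i n = int_module (homology_group (int i) (conf_sink G V n))"

definition H_conf_act :: "'a topology \<Rightarrow> 'a set \<Rightarrow> nat \<Rightarrow> nat \<Rightarrow> nat \<Rightarrow>
    (nat \<Rightarrow> nat) \<times> (nat \<Rightarrow> 'a) \<Rightarrow> (nat \<Rightarrow> 'a) chain set \<Rightarrow> (nat \<Rightarrow> 'a) chain set" where
  "H_conf_act G V i m n \<phi> =
     hom_induced (int i) (conf_sink G V m) {} (conf_sink G V n) {} (conf_map m n \<phi>)"


subsection \<open>Well-definedness\<close>

lemma topspace_conf_sink:
  "topspace (conf_sink G V n) = {x \<in> {1..n} \<rightarrow>\<^sub>E topspace G.
      \<forall>i\<in>{1..n}. \<forall>j\<in>{1..n}. i \<noteq> j \<longrightarrow> x i \<noteq> x j \<or> (x i = x j \<and> x j \<in> V)}"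
  by (auto simp: conf_sink_def)

lemma continuous_map_conf_map:
  assumes "V \<subseteq> topspace G" and \<phi>: "\<phi> \<in> FIV_hom V m n"
  shows "continuous_map (conf_sink G V m) (conf_sink G V n) (conf_map m n \<phi>)"
proof -
  obtain f g where fg: "\<phi> = (f, g)" by force
  have f: "f \<in> {1..m} \<rightarrow>\<^sub>E {1..n}" and inj: "inj_on f {1..m}"
    and g: "g \<in> ({1..n} - f ` {1..m}) \<rightarrow>\<^sub>E V"
    using \<phi> by (auto simp: fg FIV_hom_def)
  have inv: "inv_into {1..m} f j \<in> {1..m}" if "j \<in> f ` {1..m}" for j
    using that by (rule inv_into_into)
  have proj: "continuous_map (conf_sink G V m) G (\<lambda>x. x k)" if "k \<in> {1..m}" for k
    unfolding conf_sink_def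
    by (intro continuous_map_from_subtopology continuous_map_product_projection that)
  have coord: "continuous_map (conf_sink G V m) G (\<lambda>x. conf_map m n \<phi> x j)"
    if j: "j \<in> {1..n}" for j
  proof (cases "j \<in> f ` {1..m}")
    case True
    then have "(\<lambda>x. conf_map m n \<phi> x j) = (\<lambda>x. x (inv_into {1..m} f j))"
      using j by (auto simp: fg)
    then show ?thesis
      using proj inv[OF True] by simp
  next
    case False
    then have "(\<lambda>x. conf_map m n \<phi> x j) = (\<lambda>x. g j)"
      using j by (auto simp: fg)
    moreover have "g j \<in> topspace G"
      using g j False assms(1) by (auto dest!: PiE_mem)
    ultimately show ?thesis
      by simp
  qed
  have sink: "conf_map m n \<phi> x i \<noteq> conf_map m n \<phi> x j \<or>
        (conf_map m n \<phi> x i = conf_map m n \<phi> x j \<and> conf_map m n \<phi> x j \<in> V)"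
    if x: "x \<in> topspace (conf_sink G V m)" and i: "i \<in> {1..n}" and j: "j \<in> {1..n}"
      and "i \<noteq> j" for x i j
  proof (cases "i \<in> f ` {1..m} \<and> j \<in> f ` {1..m}")
    case True
    then have "inv_into {1..m} f i \<noteq> inv_into {1..m} f j"
      using \<open>i \<noteq> j\<close> by (metis f_inv_into_f)
    moreover have "\<And>k l. k \<in> {1..m} \<Longrightarrow> l \<in> {1..m} \<Longrightarrow> k \<noteq> l \<Longrightarrow> x k \<noteq> x l \<or> x l \<in> V"
      using x by (auto simp: topspace_conf_sink)
    ultimately show ?thesis
      using True i j inv by (auto simp: fg simp del: atLeastAtMost_iff)
  next
    case False
    then have "conf_map m n \<phi> x i \<in> V \<or> conf_map m n \<phi> x j \<in> V"
      using i j g by (auto simp: fg PiE_def Pi_def simp del: atLeastAtMost_iff)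
    then show ?thesis by auto
  qed
  have ext: "conf_map m n \<phi> x \<in> extensional {1..n}" for x
    by (simp add: fg)
  have "continuous_map (conf_sink G V m) (product_topology (\<lambda>_. G) {1..n}) (conf_map m n \<phi>)"
    unfolding continuous_map_componentwise using coord ext by blast
  then show ?thesis
    unfolding conf_sink_def[of G V n] continuous_map_in_subtopology
    using sink by blast
qed

lemma conf_map_id:
  assumes "x \<in> topspace (conf_sink G V n)"
  shows "conf_map n n (FIV_id n) x = x"
proof
  fix j
  have im: "(\<lambda>j\<in>{1..n}. j) ` {1..n} = {1..n}" by (auto simp: image_iff)
  have "inv_into {1..n} (\<lambda>j\<in>{1..n}. j) j = j" if "j \<in> {1..n}"
    using that by (intro inv_into_f_eq) (auto simp: inj_on_def)
  then show "conf_map n n (FIV_id n) x j = x j"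
    using assms im
    by (auto simp: FIV_id_def topspace_conf_sink PiE_def extensional_def simp del: atLeastAtMost_iff)
qed

lemma conf_map_out: "j \<notin> {1..n} \<Longrightarrow> conf_map m n (f, g) x j = undefined"
  by (simp add: restrict_def del: atLeastAtMost_iff)

lemma conf_map_new:
  "\<lbrakk>j \<in> {1..n}; j \<notin> f ` {1..m}\<rbrakk> \<Longrightarrow> conf_map m n (f, g) x j = g j"
  by (simp del: atLeastAtMost_iff)

lemma conf_map_old:
  "\<lbrakk>inj_on f {1..m}; k \<in> {1..m}; f k \<in> {1..n}\<rbrakk> \<Longrightarrow> conf_map m n (f, g) x (f k) = x k"
  by (simp del: atLeastAtMost_iff)

lemma conf_map_comp:
  assumes \<psi>: "\<psi> \<in> FIV_hom V l m" and \<phi>: "\<phi> \<in> FIV_hom V m n"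
  shows "conf_map l n (FIV_comp l m n \<phi> \<psi>) x = conf_map m n \<phi> (conf_map l m \<psi> x)"
proof
  fix j
  obtain f g f' g' where fg: "\<phi> = (f, g)" "\<psi> = (f', g')" by force
  have f: "f \<in> {1..m} \<rightarrow>\<^sub>E {1..n}" "inj_on f {1..m}"
    and f': "f' \<in> {1..l} \<rightarrow>\<^sub>E {1..m}" "inj_on f' {1..l}"
    using \<phi> \<psi> by (auto simp: fg FIV_hom_def)
  let ?h = "\<lambda>j\<in>{1..l}. f (f' j)"
  have im: "?h ` {1..l} = f ` f' ` {1..l}" by force
  have im2: "(f \<circ> f') ` {1..l} = f ` f' ` {1..l}" by force
  have sub: "f' ` {1..l} \<subseteq> {1..m}" using f' by auto
  have "inj_on (f \<circ> f') {1..l}"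
    using comp_inj_on[OF f'(2) inj_on_subset[OF f(2) sub]] .
  then have inj: "inj_on ?h {1..l}"
    by (rule inj_on_cong[THEN iffD1, rotated]) (simp only: restrict_apply' o_apply)
  consider (out) "j \<notin> {1..n}" | (new) "j \<in> {1..n}" "j \<notin> f ` {1..m}"
    | (mid) k where "j \<in> {1..n}" "k \<in> {1..m}" "j = f k" "k \<notin> f' ` {1..l}"
    | (old) k where "j \<in> {1..n}" "k \<in> {1..l}" "j = f (f' k)"
    by blast
  then show "conf_map l n (FIV_comp l m n \<phi> \<psi>) x j = conf_map m n \<phi> (conf_map l m \<psi> x) j"
  proof cases
    case out
    then show ?thesis
      by (simp only: fg FIV_comp.simps conf_map_out simp_thms)
  next
    case new
    then have "j \<notin> f ` f' ` {1..l}" using sub by blast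
    with new show ?thesis
      by (simp only: fg FIV_comp.simps conf_map_new im im2 restrict_apply' Diff_iff simp_thms if_True)
  next
    case (mid k)
    then have "j \<notin> f ` f' ` {1..l}" using sub inj_on_image_mem_iff[OF f(2)] by blast
    moreover have "inv_into {1..m} f j = k" "j \<in> f ` {1..m}" using mid f by auto
    ultimately have "conf_map l n (FIV_comp l m n \<phi> \<psi>) x j = g' k"
      using mid(1)
      by (simp only: fg FIV_comp.simps conf_map_new im im2 restrict_apply' Diff_iff simp_thms if_False)
    also have "\<dots> = conf_map m n \<phi> (conf_map l m \<psi> x) j"
      using mid f(2) by (simp only: fg conf_map_old conf_map_new simp_thms)
    finally show ?thesis .
  next
    case (old k)
    have fk: "f' k \<in> {1..m}" using old sub by blast
    have "j = ?h k" using old by (simp only: restrict_apply')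
    then have "conf_map l n (FIV_comp l m n \<phi> \<psi>) x j = x k"
      using conf_map_old[OF inj old(2)] old(1) by (simp only: fg FIV_comp.simps)
    also have "\<dots> = conf_map m n \<phi> (conf_map l m \<psi> x) j"
      using old fk f(2) f'(2) by (simp only: fg conf_map_old)
    finally show ?thesis .
  qed
qed

lemma module_int_module:
  assumes "comm_group A"
  shows "module \<Z> (int_module A)"
proof -
  interpret A: comm_group A by fact
  show ?thesis
  proof (rule moduleI)
    show "abelian_group (int_module A)"
      by (rule abelian_groupI)
        (auto simp: int_module_def A.m_ac intro: A.l_inv)
  qed (auto simp: int_module_def int_is_cring A.int_pow_mult A.int_pow_mult_distrib A.m_comm A.int_pow_pow mult.commute)
qed

lemma FIV_module_H_conf:
  assumes "V \<subseteq> topspace G"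
  shows "FIV_module \<Z> V (H_conf G V i) (H_conf_act G V i)"
proof -
  let ?C = "conf_sink G V" and ?H = "\<lambda>n. homology_group (int i) (conf_sink G V n)"
  have hom: "H_conf_act G V i m n \<phi> \<in> hom (?H m) (?H n)" for m n \<phi>
    by (simp add: H_conf_act_def hom_induced_hom)
  show ?thesis
  proof (intro FIV_module.intro FIV_module_axioms.intro int_is_cring)
    show "module \<Z> (H_conf G V i n)" for n
      unfolding H_conf_def by (intro module_int_module abelian_relative_homology_group)
  next
    fix \<phi> m n x assume "x \<in> carrier (H_conf G V i m)"
    then show "H_conf_act G V i m n \<phi> x \<in> carrier (H_conf G V i n)"
      using hom_in_carrier[OF hom] by (simp add: H_conf_def int_module_def)
  next
    fix \<phi> m n x y assume "x \<in> carrier (H_conf G V i m)" "y \<in> carrier (H_conf G V i m)"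
    then show "H_conf_act G V i m n \<phi> (x \<oplus>\<^bsub>H_conf G V i m\<^esub> y) =
        H_conf_act G V i m n \<phi> x \<oplus>\<^bsub>H_conf G V i n\<^esub> H_conf_act G V i m n \<phi> y"
      using hom_mult[OF hom] by (simp add: H_conf_def int_module_def)
  next
    fix \<phi> m n and a :: int and x assume "x \<in> carrier (H_conf G V i m)"
    then show "H_conf_act G V i m n \<phi> (a \<odot>\<^bsub>H_conf G V i m\<^esub> x) =
        a \<odot>\<^bsub>H_conf G V i n\<^esub> H_conf_act G V i m n \<phi> x"
      using hom by (simp add: H_conf_def int_module_def hom_int_pow)
  next
    fix n x assume "x \<in> carrier (H_conf G V i n)"
    then show "H_conf_act G V i n n (FIV_id n) x = x"
      unfolding H_conf_act_def
      by (intro hom_induced_id_gen) (auto simp: H_conf_def int_module_def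
          intro: continuous_map_eq[OF continuous_map_id] simp: conf_map_id)
  next
    fix \<psi> \<phi> l m n x assume *: "\<psi> \<in> FIV_hom V l m" "\<phi> \<in> FIV_hom V m n"
    have eq: "conf_map l n (FIV_comp l m n \<phi> \<psi>) = conf_map m n \<phi> \<circ> conf_map l m \<psi>"
      using conf_map_comp[OF *] by (simp add: fun_eq_iff)
    show "H_conf_act G V i l n (FIV_comp l m n \<phi> \<psi>) x =
        H_conf_act G V i m n \<phi> (H_conf_act G V i l m \<psi> x)"
      unfolding H_conf_act_def eq
      by (subst hom_induced_compose[where Y = "?C m" and T = "{}"])
        (simp_all add: continuous_map_conf_map[OF assms *(1)] continuous_map_conf_map[OF assms *(2)])
  qed
qed

end

theory Submission
  imports Defs "HOL-Analysis.Analysis" "HOL-Library.Ramsey" "HOL-Library.List_Lexorder" "HOL-Library.Sublist"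
begin

text \<open>
  The theorem holds because the sink configuration spaces are, up to homotopy, finite cubical complexes whose
  cubes are words over a finite alphabet, and because insertion of letters turns such words into a well-quasi-order.

  \<^emph>\<open>Geometry.\<close> Give each point of an open edge its depth, the distance from the ends of the edge. In a
  configuration, let \<open>m\<close> be the second largest depth on an edge; it is smaller than 1/2, since only one point can
  be at the midpoint. Stretching the interval from \<open>m\<close> to \<open>1 - m\<close> onto the whole edge pushes all points but at most one to
  the ends. Doing this on all edges deforms the configuration space into the subspace of configurations with at most
  one point on each open edge (\<open>conf_sink_homology_from_discrete\<close>). This subspace is filtered by the set of occupied
  edges, and the relative homology of each step, in which configurations occupying exactly the
  edges in \<open>D\<close> are added, is generated by the images of the homology of the cube with coordinates \<open>D\<close> modulo its boundary
  (\<open>homology_generated_by_cells\<close>). The cubes are indexed by the words of length \<open>n\<close> whose letters are vertices and edges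
  in \<open>D\<close>, each of these edges occurring once; adding a point at a vertex inserts a letter.

  \<^emph>\<open>Algebra.\<close> Call a system of abelian groups Noetherian if all its subsystems are finitely generated. By Higman's
  lemma every infinite sequence of these words contains a word together with a later one that arises from it by
  insertions, and the lexicographic order of words of equal length is preserved by insertions. An argument with leading
  coefficients, as in Hilbert's basis theorem, then shows that the relative homology of each step is a Noetherian
  system (\<open>monomial_system.noetherian\<close>, \<open>noetherian_relative\<close>). The coefficients are the homology group of a cube modulo its
  boundary; its subgroups are finitely generated, because the boundary is empty or a retract of a sphere.
  Being Noetherian passes to extensions and quotients, hence by
  the long exact sequences to the whole filtration (\<open>noetherian_strata\<close>) and to the configuration spaces
  (\<open>noetherian_conf_sink\<close>).

  Only the order-preserving morphisms that add one point are used; a module which is finitely generated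
  with respect to them is finitely generated with respect to all morphisms.
\<close>

section \<open>Noetherian systems of abelian groups\<close>

definition system :: "('i \<Rightarrow> 'h monoid) \<Rightarrow> ('i \<times> 'i \<times> 'l) set \<Rightarrow> ('i \<Rightarrow> 'i \<Rightarrow> 'l \<Rightarrow> 'h \<Rightarrow> 'h) \<Rightarrow> bool" where
  "system H M act \<longleftrightarrow>
     (\<forall>i. comm_group (H i)) \<and> (\<forall>i j l. (i, j, l) \<in> M \<longrightarrow> act i j l \<in> hom (H i) (H j))"

definition subsystem ::
  "('i \<Rightarrow> 'h monoid) \<Rightarrow> ('i \<times> 'i \<times> 'l) set \<Rightarrow> ('i \<Rightarrow> 'i \<Rightarrow> 'l \<Rightarrow> 'h \<Rightarrow> 'h) \<Rightarrow> ('i \<Rightarrow> 'h set) \<Rightarrow> bool" where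
  "subsystem H M act N \<longleftrightarrow>
     (\<forall>i. subgroup (N i) (H i)) \<and> (\<forall>i j l. (i, j, l) \<in> M \<longrightarrow> act i j l ` N i \<subseteq> N j)"

text \<open>
  The index set carries arrows \<open>(i, j, l)\<close> with a label \<open>l\<close>, acting by
  homomorphisms. Only the closure of families of subgroups under single arrows enters. This makes
  it possible to use just the arrows that preserve a chosen order, and to regard a single group as
  a system without arrows.
\<close>

definition noetherian ::
  "('i \<Rightarrow> 'h monoid) \<Rightarrow> ('i \<times> 'i \<times> 'l) set \<Rightarrow> ('i \<Rightarrow> 'i \<Rightarrow> 'l \<Rightarrow> 'h \<Rightarrow> 'h) \<Rightarrow> bool" where
  "noetherian H M act \<longleftrightarrow>
     (\<forall>N. subsystem H M act N \<longrightarrow>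
        (\<exists>S. finite S \<and> S \<subseteq> Sigma UNIV N \<and>
             (\<forall>N'. subsystem H M act N' \<and> S \<subseteq> Sigma UNIV N' \<longrightarrow> (\<forall>i. N i \<subseteq> N' i))))"

definition system_hom ::
  "('i \<Rightarrow> 'g monoid) \<Rightarrow> ('i \<Rightarrow> 'i \<Rightarrow> 'l \<Rightarrow> 'g \<Rightarrow> 'g) \<Rightarrow> ('i \<Rightarrow> 'h monoid) \<Rightarrow>
   ('i \<Rightarrow> 'i \<Rightarrow> 'l \<Rightarrow> 'h \<Rightarrow> 'h) \<Rightarrow> ('i \<times> 'i \<times> 'l) set \<Rightarrow> ('i \<Rightarrow> 'g \<Rightarrow> 'h) \<Rightarrow> bool" where
  "system_hom A a B b M f \<longleftrightarrow>
     (\<forall>i. f i \<in> hom (A i) (B i)) \<and>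
     (\<forall>i j l. (i, j, l) \<in> M \<longrightarrow> (\<forall>x\<in>carrier (A i). b i j l (f i x) = f j (a i j l x)))"

lemma systemD:
  assumes "system H M act"
  shows "comm_group (H i)" "group (H i)" "(i, j, l) \<in> M \<Longrightarrow> act i j l \<in> hom (H i) (H j)"
    "(i, j, l) \<in> M \<Longrightarrow> x \<in> carrier (H i) \<Longrightarrow> act i j l x \<in> carrier (H j)"
proof -
  show "comm_group (H i)" "group (H i)" and hom: "(i, j, l) \<in> M \<Longrightarrow> act i j l \<in> hom (H i) (H j)"
    using assms by (auto simp: system_def comm_group_def)
  show "(i, j, l) \<in> M \<Longrightarrow> x \<in> carrier (H i) \<Longrightarrow> act i j l x \<in> carrier (H j)"
    using hom_in_carrier[OF hom] .
qed

lemma subsystemI: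
  assumes "\<And>i. subgroup (N i) (H i)"
    and "\<And>i j l x. (i, j, l) \<in> M \<Longrightarrow> x \<in> N i \<Longrightarrow> act i j l x \<in> N j"
  shows "subsystem H M act N"
  unfolding subsystem_def using assms by blast

lemma subsystemD:
  assumes "subsystem H M act N"
  shows "subgroup (N i) (H i)" "(i, j, l) \<in> M \<Longrightarrow> x \<in> N i \<Longrightarrow> act i j l x \<in> N j"
    "x \<in> N i \<Longrightarrow> x \<in> carrier (H i)"
proof -
  show sub: "subgroup (N i) (H i)" and "(i, j, l) \<in> M \<Longrightarrow> x \<in> N i \<Longrightarrow> act i j l x \<in> N j"
    using assms unfolding subsystem_def by blast+
  show "x \<in> N i \<Longrightarrow> x \<in> carrier (H i)" using subgroup.subset[OF sub] by blast
qed

lemma system_homD: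
  assumes "system_hom A a B b M f"
  shows "f i \<in> hom (A i) (B i)"
    "(i, j, l) \<in> M \<Longrightarrow> x \<in> carrier (A i) \<Longrightarrow> b i j l (f i x) = f j (a i j l x)"
  using assms unfolding system_hom_def by blast+

lemma system_hom_group_hom:
  assumes "system A M a" "system B M b" "system_hom A a B b M f"
  shows "group_hom (A i) (B i) (f i)"
  using systemD(2)[OF assms(1)] systemD(2)[OF assms(2)] system_homD(1)[OF assms(3)]
  by (simp add: group_hom_def group_hom_axioms_def)

lemma subsystem_carrier:
  assumes "system H M act" shows "subsystem H M act (\<lambda>i. carrier (H i))"
  using systemD[OF assms] by (intro subsystemI group.subgroup_self) auto

lemma subsystem_Int:
  assumes "system H M act" "subsystem H M act N" "subsystem H M act N'"
  shows "subsystem H M act (\<lambda>i. N i \<inter> N' i)"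
proof (rule subsystemI)
  show "subgroup (N i \<inter> N' i) (H i)" for i
    using subsystemD(1)[OF assms(2)] subsystemD(1)[OF assms(3)] systemD(2)[OF assms(1)]
    by (metis group.subgroups_Inter_pair)
qed (use subsystemD(2)[OF assms(2)] subsystemD(2)[OF assms(3)] in auto)

lemma subsystem_preimage:
  assumes A: "system A M a" and B: "system B M b" and f: "system_hom A a B b M f"
    and N: "subsystem B M b N"
  shows "subsystem A M a (\<lambda>i. {x \<in> carrier (A i). f i x \<in> N i})"
proof -
  have "subgroup {x \<in> carrier (A i). f i x \<in> N i} (A i)" for i
  proof -
    interpret group_hom "A i" "B i" "f i" by (rule system_hom_group_hom[OF A B f])
    interpret N: subgroup "N i" "B i" by (rule subsystemD(1)[OF N])
    show ?thesis by unfold_locales auto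
  qed
  then show ?thesis
  proof (rule subsystemI)
    fix i j l x assume "(i, j, l) \<in> M" "x \<in> {x \<in> carrier (A i). f i x \<in> N i}"
    then show "a i j l x \<in> {x \<in> carrier (A j). f j x \<in> N j}"
      using systemD(4)[OF A] system_homD(2)[OF f, symmetric] subsystemD(2)[OF N] by simp
  qed
qed

lemma subsystem_image:
  assumes A: "system A M a" and B: "system B M b" and f: "system_hom A a B b M f"
    and N: "subsystem A M a N"
  shows "subsystem B M b (\<lambda>i. f i ` N i)"
proof -
  have "subgroup (f i ` N i) (B i)" for i
  proof -
    interpret group_hom "A i" "B i" "f i" by (rule system_hom_group_hom[OF A B f])
    show ?thesis by (rule subgroup_img_is_subgroup[OF subsystemD(1)[OF N]])
  qed
  then show ?thesis
  proof (rule subsystemI)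
    fix i j l y assume m: "(i, j, l) \<in> M" and "y \<in> f i ` N i"
    then obtain x where x: "x \<in> N i" "y = f i x" by blast
    then have "b i j l y = f j (a i j l x)"
      using system_homD(2)[OF f m] subsystemD(3)[OF N] by simp
    then show "b i j l y \<in> f j ` N j" using subsystemD(2)[OF N m] x by simp
  qed
qed

lemma noetherianE:
  assumes "noetherian H M act" "subsystem H M act N"
  obtains S where "finite S" "S \<subseteq> Sigma UNIV N"
    "\<forall>N' i. subsystem H M act N' \<longrightarrow> S \<subseteq> Sigma UNIV N' \<longrightarrow> N i \<subseteq> N' i"
proof -
  from assms(1)[unfolded noetherian_def, THEN spec, THEN mp, OF assms(2)]
  obtain S where S: "finite S" "S \<subseteq> Sigma UNIV N"
    and m: "\<forall>N'. subsystem H M act N' \<and> S \<subseteq> Sigma UNIV N' \<longrightarrow> (\<forall>i. N i \<subseteq> N' i)"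
    by (elim exE conjE)
  show thesis
  proof (rule that[OF S], intro allI impI)
    fix N' i assume "subsystem H M act N'" "S \<subseteq> Sigma UNIV N'"
    from m[THEN spec, THEN mp, OF conjI[OF this]] show "N i \<subseteq> N' i" by (rule spec)
  qed
qed

lemma noetherianI:
  assumes "\<And>N. subsystem H M act N \<Longrightarrow>
    \<exists>S. finite S \<and> S \<subseteq> Sigma UNIV N \<and>
        (\<forall>N' i. subsystem H M act N' \<longrightarrow> S \<subseteq> Sigma UNIV N' \<longrightarrow> N i \<subseteq> N' i)"
  shows "noetherian H M act"
  unfolding noetherian_def
proof (intro allI impI)
  fix N assume "subsystem H M act N"
  from assms[OF this] show "\<exists>S. finite S \<and> S \<subseteq> Sigma UNIV N \<and>
      (\<forall>N'. subsystem H M act N' \<and> S \<subseteq> Sigma UNIV N' \<longrightarrow> (\<forall>i. N i \<subseteq> N' i))"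
    by (elim ex_forward conj_forward) auto
qed

text \<open>
  A subsystem of the middle term is generated by generators of its preimage together with lifts of
  generators of its image.
\<close>

lemma noetherian_extension:
  assumes A: "system A M a" and B: "system B M b" and C: "system C M c"
    and f: "system_hom A a B b M f" and g: "system_hom B b C c M g"
    and exact: "\<And>i x. x \<in> carrier (B i) \<Longrightarrow> g i x = \<one>\<^bsub>C i\<^esub> \<Longrightarrow> x \<in> f i ` carrier (A i)"
    and nA: "noetherian A M a" and nC: "noetherian C M c"
  shows "noetherian B M b"
proof (rule noetherianI)
  fix N assume N: "subsystem B M b N"
  let ?pre = "\<lambda>N i. {x \<in> carrier (A i). f i x \<in> N i}"
  obtain S where S: "finite S" "S \<subseteq> Sigma UNIV (?pre N)"
    and Smin: "\<forall>N' i. subsystem A M a N' \<longrightarrow> S \<subseteq> Sigma UNIV N' \<longrightarrow> ?pre N i \<subseteq> N' i"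
    by (rule noetherianE[OF nA subsystem_preimage[OF A B f N]])
  obtain T where T: "finite T" "T \<subseteq> Sigma UNIV (\<lambda>i. g i ` N i)"
    and Tmin: "\<forall>N' i. subsystem C M c N' \<longrightarrow> T \<subseteq> Sigma UNIV N' \<longrightarrow> g i ` N i \<subseteq> N' i"
    by (rule noetherianE[OF nC subsystem_image[OF B C g N]])
  have "\<forall>t\<in>T. \<exists>y\<in>N (fst t). g (fst t) y = snd t"
    using T by fastforce
  then obtain y where y: "\<And>t. t \<in> T \<Longrightarrow> y t \<in> N (fst t) \<and> g (fst t) (y t) = snd t"
    by metis
  define U where "U = (\<lambda>(i, x). (i, f i x)) ` S \<union> (\<lambda>t. (fst t, y t)) ` T"
  show "\<exists>S. finite S \<and> S \<subseteq> Sigma UNIV N \<and>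
         (\<forall>N' i. subsystem B M b N' \<longrightarrow> S \<subseteq> Sigma UNIV N' \<longrightarrow> N i \<subseteq> N' i)"
  proof (intro exI[of _ U] conjI allI impI)
    show "finite U" using S T by (simp add: U_def)
    show "U \<subseteq> Sigma UNIV N" using S y by (auto simp: U_def)
    fix N' i assume N': "subsystem B M b N'" "U \<subseteq> Sigma UNIV N'"
    define K where "K = (\<lambda>i. N i \<inter> N' i)"
    have K: "subsystem B M b K" unfolding K_def using subsystem_Int[OF B N] N' by blast
    have UK: "U \<subseteq> Sigma UNIV K" using N' \<open>U \<subseteq> Sigma UNIV N\<close> by (auto simp: K_def)
    have "S \<subseteq> Sigma UNIV (?pre K)" using UK S by (auto simp: U_def)
    then have preK: "?pre N i \<subseteq> ?pre K i" by (rule Smin[rule_format, OF subsystem_preimage[OF A B f K]])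
    have "T \<subseteq> Sigma UNIV (\<lambda>i. g i ` K i)"
    proof
      fix t assume t: "t \<in> T"
      then have "(fst t, y t) \<in> Sigma UNIV K" using UK by (auto simp: U_def)
      then show "t \<in> Sigma UNIV (\<lambda>i. g i ` K i)" using y[OF t] by (cases t) force
    qed
    then have gK: "g i ` N i \<subseteq> g i ` K i" by (rule Tmin[rule_format, OF subsystem_image[OF B C g K]])
    interpret gi: group_hom "B i" "C i" "g i" by (rule system_hom_group_hom[OF B C g])
    interpret Ki: subgroup "K i" "B i" by (rule subsystemD(1)[OF K])
    interpret Ni: subgroup "N i" "B i" by (rule subsystemD(1)[OF N])
    show "N i \<subseteq> N' i"
    proof
      fix x assume x: "x \<in> N i"
      obtain z where z: "z \<in> K i" "g i x = g i z" using gK x by blast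
      then have zN: "z \<in> N i" by (simp add: K_def)
      define d where "d = x \<otimes>\<^bsub>B i\<^esub> inv\<^bsub>B i\<^esub> z"
      have d: "d \<in> N i" using x zN by (simp add: d_def)
      have "g i d = \<one>\<^bsub>C i\<^esub>" using x z zN by (simp add: d_def)
      from exact[OF Ni.mem_carrier[OF d] this]
      obtain w where w: "w \<in> carrier (A i)" "d = f i w" by (elim imageE)
      then have "w \<in> ?pre N i" using d by simp
      then have "d \<in> K i" using subsetD[OF preK] w(2) by simp
      then have "d \<otimes>\<^bsub>B i\<^esub> z \<in> K i" using z by simp
      then show "x \<in> N' i" using x zN by (simp add: d_def gi.G.m_assoc K_def)
    qed
  qed
qed

lemma noetherian_trivial:
  assumes "\<And>i. trivial_group (H i)" shows "noetherian H M act"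
proof (intro noetherianI exI[of _ "{}"] conjI allI impI)
  fix N N' i assume N: "subsystem H M act N" and N': "subsystem H M act N'"
  have "N i \<subseteq> {\<one>\<^bsub>H i\<^esub>}"
    using subgroup.subset[OF subsystemD(1)[OF N], of i] assms[of i] by (simp add: trivial_group_def)
  also have "\<dots> \<subseteq> N' i" using subgroup.one_closed[OF subsystemD(1)[OF N'], of i] by simp
  finally show "N i \<subseteq> N' i" .
qed auto

text \<open>
  The zero object, which makes quotients and subobjects special cases of extensions.
\<close>

definition trivial_system :: "'i \<Rightarrow> unit monoid" where
  "trivial_system i = \<lparr>carrier = {()}, monoid.mult = (\<lambda>_ _. ()), one = ()\<rparr>"

lemma trivial_system: "system trivial_system M (\<lambda>_ _ _ _. ())"
  by (auto simp: system_def trivial_system_def hom_def intro!: comm_groupI)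

lemma group_trivial_system: "group (trivial_system i)"
  using systemD(2)[OF trivial_system[of "{}"]] .

lemma noetherian_trivial_system: "noetherian trivial_system M (\<lambda>_ _ _ _. ())"
  by (rule noetherian_trivial)
     (simp add: trivial_group_def group_trivial_system, simp add: trivial_system_def)

lemma noetherian_surj:
  assumes A: "system A M a" and B: "system B M b" and f: "system_hom A a B b M f"
    and surj: "\<And>i. carrier (B i) \<subseteq> f i ` carrier (A i)" and nA: "noetherian A M a"
  shows "noetherian B M b"
proof (rule noetherian_extension[OF A B trivial_system f _ _ nA noetherian_trivial_system])
  show "system_hom B b trivial_system (\<lambda>_ _ _ _. ()) M (\<lambda>_ _. ())"
    by (auto simp: system_hom_def hom_def trivial_system_def)
  show "x \<in> f i ` carrier (A i)" if "x \<in> carrier (B i)" for i x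
    using subsetD[OF surj that] .
qed

lemma noetherian_inj:
  assumes A: "system A M a" and B: "system B M b" and f: "system_hom A a B b M f"
    and inj: "\<And>i. inj_on (f i) (carrier (A i))" and nB: "noetherian B M b"
  shows "noetherian A M a"
proof (rule noetherian_extension[OF trivial_system A B _ f _ noetherian_trivial_system nB])
  note h = system_hom_group_hom[OF A B f]
  show "system_hom trivial_system (\<lambda>_ _ _ _. ()) A a M (\<lambda>i _. \<one>\<^bsub>A i\<^esub>)"
  proof -
    have "\<one>\<^bsub>A i\<^esub> = a j i l \<one>\<^bsub>A j\<^esub>" if "(j, i, l) \<in> M" for i j l
      using hom_one[OF systemD(3)[OF A that] systemD(2)[OF A] systemD(2)[OF A]] by simp
    moreover have "(\<lambda>_. \<one>\<^bsub>A i\<^esub>) \<in> hom (trivial_system i) (A i)" for i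
      using group.is_monoid[OF systemD(2)[OF A, of i]]
      by (intro homI) (simp_all add: monoid.one_closed monoid.l_one)
    ultimately show ?thesis unfolding system_hom_def by metis
  qed
  fix i x assume x: "x \<in> carrier (A i)" "f i x = \<one>\<^bsub>B i\<^esub>"
  then have "f i x = f i \<one>\<^bsub>A i\<^esub>" using group_hom.hom_one[OF h] by simp
  then have "x = \<one>\<^bsub>A i\<^esub>" using inj[of i] x systemD(2)[OF A]
    by (metis group.is_monoid inj_onD monoid.one_closed)
  then show "x \<in> (\<lambda>_. \<one>\<^bsub>A i\<^esub>) ` carrier (trivial_system i)" by (simp add: trivial_system_def)
qed

definition noetherian_group :: "'h monoid \<Rightarrow> bool" where
  "noetherian_group A \<longleftrightarrow> comm_group A \<and>
     noetherian (\<lambda>_::unit. A) ({} :: (unit \<times> unit \<times> unit) set) (\<lambda>_ _ _ x. x)"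

lemma noetherian_groupE:
  assumes "noetherian_group A" "subgroup N A"
  obtains F where "finite F" "F \<subseteq> N" "\<forall>N'. subgroup N' A \<longrightarrow> F \<subseteq> N' \<longrightarrow> N \<subseteq> N'"
proof -
  let ?sub = "subsystem (\<lambda>_::unit. A) ({} :: (unit \<times> unit \<times> unit) set) (\<lambda>_ _ _ x. x)"
  have sub: "?sub (\<lambda>_. K)" if "subgroup K A" for K using that by (simp add: subsystem_def)
  from assms(1) obtain S where S: "finite S" "S \<subseteq> Sigma UNIV (\<lambda>_. N)"
    "\<forall>N' i. ?sub N' \<longrightarrow> S \<subseteq> Sigma UNIV N' \<longrightarrow> N \<subseteq> N' i"
    unfolding noetherian_group_def by (elim conjE noetherianE[OF _ sub[OF assms(2)]])
  show thesis
  proof (rule that)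
    show "finite (snd ` S)" "snd ` S \<subseteq> N" using S by auto
    have "N \<subseteq> N'" if "subgroup N' A" "snd ` S \<subseteq> N'" for N'
      using that(2) by (intro S(3)[rule_format, OF sub[OF that(1)]]) force
    then show "\<forall>N'. subgroup N' A \<longrightarrow> snd ` S \<subseteq> N' \<longrightarrow> N \<subseteq> N'" by blast
  qed
qed

lemma noetherian_groupI:
  assumes "comm_group A"
    and "\<And>N. subgroup N A \<Longrightarrow> \<exists>F. finite F \<and> F \<subseteq> N \<and> (\<forall>N'. subgroup N' A \<longrightarrow> F \<subseteq> N' \<longrightarrow> N \<subseteq> N')"
  shows "noetherian_group A"
  unfolding noetherian_group_def
proof (intro conjI assms(1) noetherianI)
  let ?sub = "subsystem (\<lambda>_::unit. A) ({} :: (unit \<times> unit \<times> unit) set) (\<lambda>_ _ _ x. x)"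
  fix N assume "?sub N"
  then have "subgroup (N ()) A" by (rule subsystemD)
  from assms(2)[OF this] obtain F where F: "finite F" "F \<subseteq> N ()"
    "\<And>N'. subgroup N' A \<Longrightarrow> F \<subseteq> N' \<Longrightarrow> N () \<subseteq> N'" by blast
  show "\<exists>S. finite S \<and> S \<subseteq> Sigma UNIV N \<and>
      (\<forall>N' i. ?sub N' \<longrightarrow> S \<subseteq> Sigma UNIV N' \<longrightarrow> N i \<subseteq> N' i)"
  proof (intro exI[of _ "{()} \<times> F"] conjI allI impI)
    fix N' i assume "?sub N'" "{()} \<times> F \<subseteq> Sigma UNIV N'"
    then have "subgroup (N' ()) A" "F \<subseteq> N' ()" by (auto simp: subsystem_def)
    then show "N i \<subseteq> N' i" using F(3)[of "N' ()"] by (cases i) simp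
  qed (use F in auto)
qed

lemma system_const: "comm_group A \<Longrightarrow> system (\<lambda>_. A) {} act"
  by (simp add: system_def)

lemma system_hom_const: "f \<in> hom A B \<Longrightarrow> system_hom (\<lambda>_. A) a (\<lambda>_. B) b {} (\<lambda>_. f)"
  by (simp add: system_hom_def)

lemma noetherian_group_extension:
  assumes "f \<in> hom A B" "g \<in> hom B C" "comm_group B"
    and "\<And>x. x \<in> carrier B \<Longrightarrow> g x = \<one>\<^bsub>C\<^esub> \<Longrightarrow> x \<in> f ` carrier A"
    and "noetherian_group A" "noetherian_group C"
  shows "noetherian_group B"
  unfolding noetherian_group_def
proof (intro conjI assms(3))
  have "comm_group A" "comm_group C" using assms(5,6) by (simp_all add: noetherian_group_def)
  then show "noetherian (\<lambda>_::unit. B) ({} :: (unit \<times> unit \<times> unit) set) (\<lambda>_ _ _ x. x)"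
    using assms(5,6)
    by (intro noetherian_extension[OF system_const system_const[OF assms(3)] system_const
          system_hom_const[OF assms(1)] system_hom_const[OF assms(2)] assms(4)])
       (simp_all add: noetherian_group_def)
qed

lemma noetherian_group_inj:
  assumes "f \<in> hom A B" "comm_group A" "inj_on f (carrier A)" "noetherian_group B"
  shows "noetherian_group A"
  unfolding noetherian_group_def
proof (intro conjI assms(2))
  have "comm_group B" using assms(4) by (simp add: noetherian_group_def)
  then show "noetherian (\<lambda>_::unit. A) ({} :: (unit \<times> unit \<times> unit) set) (\<lambda>_ _ _ x. x)"
    using assms(4)
    by (intro noetherian_inj[OF system_const[OF assms(2)] system_const system_hom_const[OF assms(1)] assms(3)])
       (simp_all add: noetherian_group_def)
qed

text \<open>
  A nonzero subgroup of a cyclic group is generated by the least positive power of the generator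
  that it contains.
\<close>

lemma noetherian_group_cyclic:
  fixes A :: "'a monoid" (structure)
  assumes "group A" "cyclic_group A"
  shows "noetherian_group A"
proof (rule noetherian_groupI)
  interpret group A by fact
  show "comm_group A" using cyclic_imp_abelian_group[OF assms(2)] .
  fix N assume N: "subgroup N A"
  interpret N: subgroup N A by fact
  obtain x where x: "x \<in> carrier A" "carrier A = range (\<lambda>n::int. x [^] n)"
    using assms cyclic_group by blast
  define I where "I = {n::nat. n > 0 \<and> x [^] int n \<in> N}"
  show "\<exists>F. finite F \<and> F \<subseteq> N \<and> (\<forall>N'. subgroup N' A \<longrightarrow> F \<subseteq> N' \<longrightarrow> N \<subseteq> N')"
  proof (cases "I = {}")
    case True
    have "y = \<one>" if y: "y \<in> N" for y
    proof -
      obtain n :: int where n: "y = x [^] n" using y x N.subset by blast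
      have "n = 0"
      proof (rule ccontr)
        assume "n \<noteq> 0"
        have "x [^] (- n) \<in> N" using y n x(1) int_pow_neg[OF x(1), of n] by simp
        then have "nat \<bar>n\<bar> \<in> I"
          using y n \<open>n \<noteq> 0\<close> by (cases "n > 0") (auto simp: I_def)
        with True show False by auto
      qed
      then show ?thesis using n by simp
    qed
    then have "\<forall>N'. subgroup N' A \<longrightarrow> N \<subseteq> N'" using subgroup.one_closed by blast
    then show ?thesis by (intro exI[of _ "{}"]) auto
  next
    case False
    define d where "d = (LEAST n. n \<in> I)"
    have d: "d \<in> I" using False unfolding d_def by (metis LeastI ex_in_conv)
    have dmin: "d \<le> n" if "n \<in> I" for n using that by (simp add: d_def Least_le)
    have "N \<subseteq> N'" if N': "subgroup N' A" and dN': "x [^] int d \<in> N'" for N'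
    proof
      interpret N': subgroup N' A by fact
      fix y assume y: "y \<in> N"
      obtain n :: int where n: "y = x [^] n" using y x N.subset by blast
      have yy: "y = (x [^] int d) [^] (n div int d) \<otimes> x [^] (n mod int d)"
        unfolding int_pow_pow[OF x(1)] int_pow_mult[OF x(1), symmetric] n by simp
      have "x [^] (n mod int d) = inv ((x [^] int d) [^] (n div int d)) \<otimes> y"
        using x(1) yy by (simp add: inv_solve_left m_assoc)
      also have "\<dots> \<in> N"
        using d y by (simp add: I_def group.int_pow_closed subgroup_int_pow_closed[OF N])
      finally have r: "x [^] (n mod int d) \<in> N" .
      have "n mod int d = 0"
      proof (rule ccontr)
        assume "n mod int d \<noteq> 0"
        moreover have "0 \<le> n mod int d" "n mod int d < int d" using d by (auto simp: I_def)
        ultimately have "nat (n mod int d) \<in> I" "nat (n mod int d) < d"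
          using r by (auto simp: I_def)
        with dmin show False by fastforce
      qed
      then show "y \<in> N'" using yy dN' x(1) subgroup_int_pow_closed[OF N'] by simp
    qed
    then show ?thesis using d by (intro exI[of _ "{x [^] int d}"]) (auto simp: I_def)
  qed
qed

lemma noetherian_group_stabilizes:
  fixes A :: "'a monoid" (structure) and L :: "nat \<Rightarrow> 'a set"
  assumes A: "noetherian_group A" and L: "\<And>n. subgroup (L n) A" and mono: "mono L"
  shows "\<exists>n. \<forall>m\<ge>n. L m = L n"
proof -
  interpret group A using A by (simp add: noetherian_group_def comm_group_def)
  have le: "L m \<subseteq> L n" if "m \<le> n" for m n using monoD[OF mono that] .
  have "subgroup (\<Union>n. L n) A"
  proof (rule subgroupI)
    show "(\<Union>n. L n) \<subseteq> carrier A" by (rule UN_least) (rule subgroup.subset[OF L])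
    show "(\<Union>n. L n) \<noteq> {}" using subgroup.one_closed[OF L] by auto
    show "inv a \<in> (\<Union>n. L n)" if "a \<in> (\<Union>n. L n)" for a
      using that subgroup.m_inv_closed[OF L] by auto
    show "a \<otimes> b \<in> (\<Union>n. L n)" if ab: "a \<in> (\<Union>n. L n)" "b \<in> (\<Union>n. L n)" for a b
    proof -
      obtain m n where "a \<in> L m" "b \<in> L n" using ab by auto
      then have "a \<in> L (max m n)" "b \<in> L (max m n)"
        using le[of m "max m n"] le[of n "max m n"] by auto
      then show ?thesis using subgroup.m_closed[OF L] by auto
    qed
  qed
  then obtain F where F: "finite F" "F \<subseteq> (\<Union>n. L n)"
    "\<forall>N'. subgroup N' A \<longrightarrow> F \<subseteq> N' \<longrightarrow> (\<Union>n. L n) \<subseteq> N'"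
    by (rule noetherian_groupE[OF A])
  have "\<exists>n. F \<subseteq> L n"
    using F(1,2)
  proof (induction F rule: finite_induct)
    case (insert x F)
    then obtain m n where mn: "F \<subseteq> L n" "x \<in> L m" by auto
    then have "insert x F \<subseteq> L (max m n)"
      using le[of m "max m n"] le[of n "max m n"] by auto
    then show ?case by (rule exI)
  qed auto
  then obtain n where "F \<subseteq> L n" by auto
  then have *: "(\<Union>n. L n) \<subseteq> L n" using F(3) L by simp
  have "L m = L n" if "m \<ge> n" for m using le[OF that] * by auto
  then show ?thesis by auto
qed

text \<open>
  Colour a pair of positions by whether its terms are related. An infinite homogeneous set of
  unrelated pairs would be a subsequence without a good pair.
\<close>

lemma infinite_chain_if_good_pairs:
  fixes f :: "nat \<Rightarrow> 'b" and r :: "'b \<Rightarrow> 'b \<Rightarrow> bool"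
  assumes good: "\<And>g :: nat \<Rightarrow> nat. strict_mono g \<Longrightarrow> \<exists>a b. a < b \<and> r (f (g a)) (f (g b))"
  shows "\<exists>g :: nat \<Rightarrow> nat. strict_mono g \<and> (\<forall>a b. a < b \<longrightarrow> r (f (g a)) (f (g b)))"
proof -
  let ?c = "\<lambda>X :: nat set. if r (f (Min X)) (f (Max X)) then 0 else 1 :: nat"
  have "\<exists>Y t. Y \<subseteq> UNIV \<and> infinite Y \<and> t < 2 \<and> (\<forall>x\<in>Y. \<forall>y\<in>Y. x \<noteq> y \<longrightarrow> ?c {x, y} = t)"
    by (rule Ramsey2) auto
  then obtain Y t where Y: "infinite Y" and t: "\<forall>x\<in>Y. \<forall>y\<in>Y. x \<noteq> y \<longrightarrow> ?c {x, y} = t"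
    by blast
  define g where "g = enumerate Y"
  have g: "strict_mono g" unfolding g_def by (rule strict_mono_enumerate[OF Y])
  have gY: "g a \<in> Y" for a unfolding g_def by (rule enumerate_in_set[OF Y])
  have c: "(if r (f (g a)) (f (g b)) then 0 else 1 :: nat) = t" if "a < b" for a b
  proof -
    have lt: "g a < g b" using strict_monoD[OF g that] .
    then have "Min {g a, g b} = g a" "Max {g a, g b} = g b" by simp_all
    moreover have "?c {g a, g b} = t"
      using t[THEN bspec, OF gY[of a], THEN bspec, OF gY[of b]] lt by simp
    ultimately show ?thesis by simp
  qed
  obtain a b where "a < b" "r (f (g a)) (f (g b))" using good[OF g] by blast
  with c[of a b] have "t = 0" by simp
  with c g show ?thesis by (metis zero_neq_one)
qed

section \<open>Higman's lemma\<close>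

definition bad_words :: "(nat \<Rightarrow> 'a list) \<Rightarrow> bool" where
  "bad_words f \<longleftrightarrow> (\<forall>i j. i < j \<longrightarrow> \<not> subseq (f i) (f j))"

text \<open>
  The minimal bad sequence argument of Nash-Williams: among the bad sequences choose one that is
  lexicographically minimal with respect to the lengths of its terms. Infinitely many of its terms
  start with the same letter, and removing this letter from them (and dropping the other terms
  after the first of them) gives a bad sequence that is smaller.
\<close>

lemma Higman:
  fixes f :: "nat \<Rightarrow> 'a list"
  assumes fin: "finite A" and f: "\<And>n. set (f n) \<subseteq> A"
  shows "\<exists>i j. i < j \<and> subseq (f i) (f j)"
proof (rule ccontr)
  assume "\<not> ?thesis"
  then have badf: "bad_words f" by (auto simp: bad_words_def)
  define P where "P = (\<lambda>(h :: nat \<Rightarrow> 'a list). bad_words h \<and> (\<forall>n. set (h n) \<subseteq> A))"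
  \<comment> \<open>\<open>ext us h\<close>: the bad sequence \<open>h\<close> starts with the
  terms \<open>us\<close>; \<open>pick us\<close> is a shortest possible next term.\<close>
  define ext where "ext = (\<lambda>us h. P h \<and> (\<forall>i<length us. h i = us ! i))"
  define pick where "pick = (\<lambda>us :: 'a list list. arg_min length (\<lambda>w. \<exists>h. ext (us @ [w]) h))"
  define pre where "pre = (\<lambda>n. rec_nat [] (\<lambda>_ us. us @ [pick us]) n)"
  have pre_0: "pre 0 = []" and pre_Suc: "pre (Suc n) = pre n @ [pick (pre n)]" for n
    by (simp_all add: pre_def)
  have len: "length (pre n) = n" for n by (induction n) (simp_all add: pre_0 pre_Suc)
  have ex: "\<exists>h. ext (us @ [w]) h" if "ext us h" "w = h (length us)" for us h w
    using that by (intro exI[of _ h]) (auto simp: ext_def nth_append less_Suc_eq)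
  have pick: "(\<exists>h. ext (us @ [pick us]) h) \<and> (\<forall>w h. ext (us @ [w]) h \<longrightarrow> length (pick us) \<le> length w)"
    if "ext us h" for us h
  proof -
    have ex': "\<exists>h'. ext (us @ [h (length us)]) h'" using ex[OF that refl] .
    have "\<exists>h. ext (us @ [pick us]) h"
      unfolding pick_def by (rule arg_min_natI[where P = "\<lambda>w. \<exists>h. ext (us @ [w]) h", OF ex'])
    moreover have "length (pick us) \<le> length w" if "ext (us @ [w]) h" for w h
      unfolding pick_def by (rule arg_min_nat_le[where P = "\<lambda>w. \<exists>h. ext (us @ [w]) h"]) (use that in blast)
    ultimately show ?thesis by blast
  qed
  have ext_pre: "\<exists>h. ext (pre n) h" for n
  proof (induction n)
    case 0
    show ?case using badf f by (auto simp: pre_0 ext_def P_def)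
  next
    case (Suc n)
    then show ?case using pick unfolding pre_Suc by blast
  qed
  define m where "m = (\<lambda>n. pick (pre n))"
  have nth_pre: "pre n ! i = m i" if "i < n" for n i
    using that by (induction n) (auto simp: pre_Suc nth_append len m_def less_Suc_eq)
  have mh: "\<exists>h. P h \<and> (\<forall>i<n. h i = m i)" for n
    using ext_pre[of n] nth_pre by (auto simp: ext_def len)
  have mmin: "length (m n) \<le> length (h n)" if "P h" "\<forall>i<n. h i = m i" for n h
  proof -
    have h: "ext (pre n) h" using that nth_pre by (auto simp: ext_def len)
    have "ext (pre n @ [h n]) h"
      using h by (auto simp: ext_def nth_append less_Suc_eq len)
    then show ?thesis using pick[OF h] unfolding m_def by blast
  qed
  have badm: "\<not> subseq (m i) (m j)" if "i < j" for i j
  proof -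
    obtain h where h: "P h" "\<forall>k<Suc j. h k = m k" using mh by blast
    then have "h i = m i" "h j = m j" using that by simp_all
    moreover have "\<not> subseq (h i) (h j)" using h(1) that by (simp add: P_def bad_words_def)
    ultimately show ?thesis by simp
  qed
  have mA: "set (m n) \<subseteq> A" for n
  proof -
    obtain h where "P h" "\<forall>k<Suc n. h k = m k" using mh by blast
    then show ?thesis by (metis P_def lessI)
  qed
  have ne: "m n \<noteq> []" for n using badm[of n "Suc n"] by auto
  have "range (\<lambda>n. hd (m n)) \<subseteq> A" using mA ne by (meson hd_in_set image_subsetI subsetD)
  then have "finite (range (\<lambda>n. hd (m n)))" using fin finite_subset by blast
  then obtain a where inf: "infinite {n. hd (m n) = a}"
    using inf_img_fin_domE[of "\<lambda>n. hd (m n)" "UNIV :: nat set"] by (auto simp: vimage_def)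
  define e where "e = enumerate {n. hd (m n) = a}"
  have e: "strict_mono e" unfolding e_def by (rule strict_mono_enumerate[OF inf])
  have hde: "m (e k) = a # tl (m (e k))" for k
    using enumerate_in_set[OF inf, of k] ne[of "e k"] by (cases "m (e k)") (auto simp: e_def)
  \<comment> \<open>Keep the terms before the first word with initial letter \<open>a\<close>,
  then continue with the words \<open>m (e 0), m (e 1), ...\<close> without this letter.\<close>
  define h where "h = (\<lambda>n. if n < e 0 then m n else tl (m (e (n - e 0))))"
  have tl_sub: "subseq (tl (m n)) (m n)" for n
    by (cases "m n") (auto intro: subseq_Cons')
  have tail: "\<not> subseq (tl (m (e i))) (tl (m (e j)))" if "i < j" for i j
    using badm[OF strict_monoD[OF e that]] hde[of i] hde[of j] by (metis subseq_Cons2)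
  have "bad_words h"
    unfolding bad_words_def
  proof (intro allI impI)
    fix i j :: nat assume "i < j"
    consider "j < e 0" | "i < e 0" "e 0 \<le> j" | "e 0 \<le> i" using \<open>i < j\<close> by linarith
    then show "\<not> subseq (h i) (h j)"
    proof cases
      case 1
      then show ?thesis using badm[OF \<open>i < j\<close>] \<open>i < j\<close> by (simp add: h_def)
    next
      case 2
      have "e 0 \<le> e (j - e 0)" using e by (simp add: strict_mono_less_eq)
      then have "\<not> subseq (m i) (m (e (j - e 0)))" using badm 2 by simp
      then show ?thesis using 2 tl_sub by (auto simp: h_def dest: subseq_order.trans)
    next
      case 3
      then have "i - e 0 < j - e 0" using \<open>i < j\<close> by linarith
      from tail[OF this] show ?thesis using 3 \<open>i < j\<close> by (simp add: h_def)
    qed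
  qed
  moreover have "set (h n) \<subseteq> A" for n
  proof -
    have "set (tl xs) \<subseteq> set xs" for xs :: "'a list" by (cases xs) auto
    then have "set (tl (m (e (n - e 0)))) \<subseteq> A" using mA[of "e (n - e 0)"] by (rule order_trans)
    then show ?thesis using mA[of n] by (simp add: h_def)
  qed
  ultimately have "P h" by (simp add: P_def)
  then have "length (m (e 0)) \<le> length (h (e 0))" by (rule mmin) (simp add: h_def)
  then show False using ne[of "e 0"] by (cases "m (e 0)") (simp_all add: h_def)
qed

section \<open>A Groebner basis argument\<close>

text \<open>
  A system generated by \<^emph>\<open>monomials\<close>: homomorphic images \<open>c i b\<close>
  of one Noetherian group \<open>Q\<close> of coefficients, indexed by finite ordered sets
  \<open>B i\<close> on which the arrows act strictly monotonically. There may be relations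
  between the monomials. If the arrows turn the disjoint union of the \<open>B i\<close> into a
  well-quasi-order, then the system is Noetherian, by the argument of Hilbert's basis theorem: the
  leading coefficients at \<open>b\<close> of the elements of a subsystem form a subgroup of
  \<open>Q\<close> which grows along the arrows, so that finitely many of these subgroups
  determine all of them.
\<close>

locale monomial_system =
  fixes H :: "'i \<Rightarrow> 'h monoid" and M :: "('i \<times> 'i \<times> 'l) set"
    and act :: "'i \<Rightarrow> 'i \<Rightarrow> 'l \<Rightarrow> 'h \<Rightarrow> 'h"
    and Q :: "'q monoid" and B :: "'i \<Rightarrow> 'b set" and key :: "'b \<Rightarrow> 'k :: linorder"
    and move :: "'l \<Rightarrow> 'b \<Rightarrow> 'b" and c :: "'i \<Rightarrow> 'b \<Rightarrow> 'q \<Rightarrow> 'h"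
  assumes H: "system H M act"
    and Q: "noetherian_group Q"
    and finB: "finite (B i)"
    and inj_key: "inj_on key (B i)"
    and c_hom: "b \<in> B i \<Longrightarrow> c i b \<in> hom Q (H i)"
    and gen: "carrier (H i) = generate (H i) (\<Union>b\<in>B i. c i b ` carrier Q)"
    and move: "(i, j, l) \<in> M \<Longrightarrow> b \<in> B i \<Longrightarrow> move l b \<in> B j"
    and move_mono: "(i, j, l) \<in> M \<Longrightarrow> b \<in> B i \<Longrightarrow> b' \<in> B i \<Longrightarrow> key b < key b' \<Longrightarrow> key (move l b) < key (move l b')"
    and act_c: "(i, j, l) \<in> M \<Longrightarrow> b \<in> B i \<Longrightarrow> q \<in> carrier Q \<Longrightarrow> act i j l (c i b q) = c j (move l b) q"
    and wqo: "\<And>f :: nat \<Rightarrow> 'i \<times> 'b. range f \<subseteq> Sigma UNIV B \<Longrightarrow>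
       \<exists>m n. m < n \<and> (f m, f n) \<in> {((i, b), (j, move l b)) | i j l b. (i, j, l) \<in> M \<and> b \<in> B i}\<^sup>*"
begin

definition reach :: "(('i \<times> 'b) \<times> 'i \<times> 'b) set" where
  "reach = {((i, b), (j, move l b)) | i j l b. (i, j, l) \<in> M \<and> b \<in> B i}\<^sup>*"

definition span_of :: "'i \<Rightarrow> 'b set \<Rightarrow> 'h set" where
  "span_of i D = generate (H i) (\<Union>b\<in>D. c i b ` carrier Q)"

definition low :: "'i \<Rightarrow> 'b \<Rightarrow> 'b set" where
  "low i b = {b' \<in> B i. key b' < key b}"

text \<open>
  The coefficients \<open>q\<close> for which \<open>c i b q\<close> is congruent to an element of
  \<open>N i\<close> modulo smaller monomials. Because of the relations, a leading coefficient
  belongs to a monomial and not to an element.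
\<close>

definition lead :: "('i \<Rightarrow> 'h set) \<Rightarrow> 'i \<Rightarrow> 'b \<Rightarrow> 'q set" where
  "lead N i b = {q \<in> carrier Q. \<exists>y\<in>span_of i (low i b). c i b q \<otimes>\<^bsub>H i\<^esub> y \<in> N i}"

lemma comm_group_H: "comm_group (H i)" by (rule systemD(1)[OF H])

lemma group_H: "group (H i)" by (rule systemD(2)[OF H])

lemma group_Q: "group Q" using Q by (simp add: noetherian_group_def comm_group_def)

lemma c_closed: "b \<in> B i \<Longrightarrow> q \<in> carrier Q \<Longrightarrow> c i b q \<in> carrier (H i)"
  using hom_in_carrier[OF c_hom] .

lemma c_group_hom: "b \<in> B i \<Longrightarrow> group_hom Q (H i) (c i b)"
  by (simp add: group_hom_def group_hom_axioms_def group_Q group_H c_hom)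

lemma subgroup_span_of: "D \<subseteq> B i \<Longrightarrow> subgroup (span_of i D) (H i)"
  unfolding span_of_def
proof (rule group.generate_is_subgroup[OF group_H])
  assume "D \<subseteq> B i"
  then show "(\<Union>b\<in>D. c i b ` carrier Q) \<subseteq> carrier (H i)"
    by (intro UN_least image_subsetI c_closed) auto
qed

lemma span_of_incl: "D \<subseteq> B i \<Longrightarrow> b \<in> D \<Longrightarrow> q \<in> carrier Q \<Longrightarrow> c i b q \<in> span_of i D"
  unfolding span_of_def by (intro generate.incl) auto

lemma span_of_least:
  assumes "subgroup K (H i)" "\<And>b q. b \<in> D \<Longrightarrow> q \<in> carrier Q \<Longrightarrow> c i b q \<in> K"
  shows "span_of i D \<subseteq> K"
  unfolding span_of_def using assms by (intro group.generate_subgroup_incl[OF group_H]) auto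

lemma low_subset: "low i b \<subseteq> B i" by (auto simp: low_def)

lemma span_of_insert:
  assumes D: "D \<subseteq> B i" and b: "b \<in> B i" and x: "x \<in> span_of i (insert b D)"
  obtains q y where "q \<in> carrier Q" "y \<in> span_of i D" "x = c i b q \<otimes>\<^bsub>H i\<^esub> y"
proof -
  interpret Hi: comm_group "H i" by (rule comm_group_H)
  interpret cb: group_hom Q "H i" "c i b" by (rule c_group_hom[OF b])
  interpret D: subgroup "span_of i D" "H i" by (rule subgroup_span_of[OF D])
  let ?K = "c i b ` carrier Q <#>\<^bsub>H i\<^esub> span_of i D"
  have "span_of i (insert b D) \<subseteq> ?K"
  proof (rule span_of_least)
    show "subgroup ?K (H i)"
      by (rule Hi.mult_subgroups[OF cb.img_is_subgroup D.subgroup_axioms])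
    fix b' q assume b': "b' \<in> insert b D" and q: "q \<in> carrier Q"
    show "c i b' q \<in> ?K"
    proof (cases "b' = b")
      case True
      have "c i b q = c i b q \<otimes>\<^bsub>H i\<^esub> \<one>\<^bsub>H i\<^esub>" using q by simp
      then show ?thesis unfolding True set_mult_def using q D.one_closed by blast
    next
      case False
      then have y: "c i b' q \<in> span_of i D" using b' q span_of_incl[OF D] by simp
      have "c i b' q = c i b \<one>\<^bsub>Q\<^esub> \<otimes>\<^bsub>H i\<^esub> c i b' q" using y by simp
      then show ?thesis unfolding set_mult_def using y cb.G.one_closed by blast
    qed
  qed
  then have "x \<in> ?K" using x by blast
  then show thesis unfolding set_mult_def using that by blast
qed

lemma lead_subgroup:
  assumes N: "subsystem H M act N" and b: "b \<in> B i"
  shows "subgroup (lead N i b) Q"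
proof -
  interpret Hi: comm_group "H i" by (rule comm_group_H)
  interpret cb: group_hom Q "H i" "c i b" by (rule c_group_hom[OF b])
  interpret D: subgroup "span_of i (low i b)" "H i" by (rule subgroup_span_of[OF low_subset])
  interpret N: subgroup "N i" "H i" by (rule subsystemD(1)[OF N])
  show ?thesis
  proof (rule cb.G.subgroupI)
    show "lead N i b \<subseteq> carrier Q" by (auto simp: lead_def)
    have "\<one>\<^bsub>Q\<^esub> \<in> lead N i b"
      unfolding lead_def by (intro CollectI conjI bexI[of _ "\<one>\<^bsub>H i\<^esub>"]) auto
    then show "lead N i b \<noteq> {}" by blast
  next
    fix q assume "q \<in> lead N i b"
    then obtain y where q: "q \<in> carrier Q" and y: "y \<in> span_of i (low i b)" "c i b q \<otimes>\<^bsub>H i\<^esub> y \<in> N i"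
      unfolding lead_def by blast
    have "c i b (inv\<^bsub>Q\<^esub> q) \<otimes>\<^bsub>H i\<^esub> inv\<^bsub>H i\<^esub> y = inv\<^bsub>H i\<^esub> (c i b q \<otimes>\<^bsub>H i\<^esub> y)"
      using q y by (simp add: Hi.inv_mult)
    also have "\<dots> \<in> N i" using y by simp
    finally show "inv\<^bsub>Q\<^esub> q \<in> lead N i b"
      unfolding lead_def using q y by blast
  next
    fix q q' assume "q \<in> lead N i b" "q' \<in> lead N i b"
    then obtain y y' where q: "q \<in> carrier Q" "q' \<in> carrier Q"
      and y: "y \<in> span_of i (low i b)" "c i b q \<otimes>\<^bsub>H i\<^esub> y \<in> N i"
        "y' \<in> span_of i (low i b)" "c i b q' \<otimes>\<^bsub>H i\<^esub> y' \<in> N i"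
      unfolding lead_def by blast
    have "c i b (q \<otimes>\<^bsub>Q\<^esub> q') \<otimes>\<^bsub>H i\<^esub> (y \<otimes>\<^bsub>H i\<^esub> y')
        = (c i b q \<otimes>\<^bsub>H i\<^esub> y) \<otimes>\<^bsub>H i\<^esub> (c i b q' \<otimes>\<^bsub>H i\<^esub> y')"
      using q D.mem_carrier[OF y(1)] D.mem_carrier[OF y(3)] by (simp add: Hi.m_ac)
    also have "\<dots> \<in> N i" using y by simp
    finally show "q \<otimes>\<^bsub>Q\<^esub> q' \<in> lead N i b"
      unfolding lead_def using q y by blast
  qed
qed

lemma act_span_of:
  assumes m: "(i, j, l) \<in> M" and D: "D \<subseteq> B i" and x: "x \<in> span_of i D"
  shows "act i j l x \<in> span_of j (move l ` D)"
proof -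
  interpret a: group_hom "H i" "H j" "act i j l"
    by (simp add: group_hom_def group_hom_axioms_def group_H systemD(3)[OF H m])
  have D': "move l ` D \<subseteq> B j" using move[OF m] D by blast
  interpret D: subgroup "span_of j (move l ` D)" "H j" by (rule subgroup_span_of[OF D'])
  have "subgroup {x \<in> carrier (H i). act i j l x \<in> span_of j (move l ` D)} (H i)"
    by unfold_locales auto
  then have "span_of i D \<subseteq> {x \<in> carrier (H i). act i j l x \<in> span_of j (move l ` D)}"
  proof (rule span_of_least)
    fix b q assume "b \<in> D" "q \<in> carrier Q"
    then show "c i b q \<in> {x \<in> carrier (H i). act i j l x \<in> span_of j (move l ` D)}"
      using D D' c_closed act_c[OF m] span_of_incl[OF D'] by (simp add: subset_iff)
  qed
  then show ?thesis using x by blast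
qed

text \<open>
  An arrow maps smaller monomials to smaller monomials, so it preserves leading coefficients.
\<close>

lemma lead_move:
  assumes N: "subsystem H M act N" and m: "(i, j, l) \<in> M" and b: "b \<in> B i"
  shows "lead N i b \<subseteq> lead N j (move l b)"
proof
  fix q assume "q \<in> lead N i b"
  then obtain y where q: "q \<in> carrier Q" and y: "y \<in> span_of i (low i b)" "c i b q \<otimes>\<^bsub>H i\<^esub> y \<in> N i"
    unfolding lead_def by blast
  interpret a: group_hom "H i" "H j" "act i j l"
    by (simp add: group_hom_def group_hom_axioms_def group_H systemD(3)[OF H m])
  have yc: "y \<in> carrier (H i)" using y(1) subgroup.subset[OF subgroup_span_of[OF low_subset]] by blast
  have "move l ` low i b \<subseteq> low j (move l b)"
    using move[OF m] move_mono[OF m _ b] by (auto simp: low_def)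
  then have "span_of j (move l ` low i b) \<subseteq> span_of j (low j (move l b))"
    by (intro span_of_least subgroup_span_of low_subset span_of_incl) auto
  then have "act i j l y \<in> span_of j (low j (move l b))" using act_span_of[OF m low_subset y(1)] by blast
  moreover have "act i j l (c i b q \<otimes>\<^bsub>H i\<^esub> y) = c j (move l b) q \<otimes>\<^bsub>H j\<^esub> act i j l y"
    using c_closed[OF b q] yc act_c[OF m b q] by simp
  then have "c j (move l b) q \<otimes>\<^bsub>H j\<^esub> act i j l y \<in> N j" using subsystemD(2)[OF N m y(2)] by simp
  ultimately show "q \<in> lead N j (move l b)" unfolding lead_def using q by blast
qed

lemma lead_reach:
  assumes N: "subsystem H M act N" and r: "(s, t) \<in> reach"
  shows "lead N (fst s) (snd s) \<subseteq> lead N (fst t) (snd t)"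
  using r unfolding reach_def
proof (induction rule: rtrancl_induct)
  case (step t u)
  then obtain i j l b where "t = (i, b)" "u = (j, move l b)" "(i, j, l) \<in> M" "b \<in> B i" by auto
  then show ?case using step.IH lead_move[OF N] by fastforce
qed auto

text \<open>
  Long division: an element of \<open>N i\<close> is changed by an element of \<open>K i\<close>
  with the same leading coefficient, which leaves an element of \<open>N i\<close> that involves
  smaller monomials only.
\<close>

lemma subset_if_lead_subset:
  assumes N: "subsystem H M act N" and K: "subsystem H M act K" and KN: "K i \<subseteq> N i"
    and lead: "\<And>b. b \<in> B i \<Longrightarrow> lead N i b \<subseteq> lead K i b"
  shows "N i \<subseteq> K i"
proof -
  interpret Hi: comm_group "H i" by (rule comm_group_H)
  interpret N: subgroup "N i" "H i" by (rule subsystemD(1)[OF N])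
  interpret K: subgroup "K i" "H i" by (rule subsystemD(1)[OF K])
  have "x \<in> K i" if "x \<in> N i" "x \<in> span_of i D" "D \<subseteq> B i" "\<And>b b'. b \<in> D \<Longrightarrow> b' \<in> B i \<Longrightarrow> key b' < key b \<Longrightarrow> b' \<in> D"
    for D x
    using finite_subset[OF that(3) finB] that
  proof (induction "card D" arbitrary: D x)
    case 0
    then have "span_of i D \<subseteq> {\<one>\<^bsub>H i\<^esub>}" by (intro span_of_least Hi.triv_subgroup) auto
    then have "x = \<one>\<^bsub>H i\<^esub>" using 0 by blast
    then show ?case by simp
  next
    case (Suc n)
    note fin = Suc.prems(1) and down = Suc.prems(5)
    have "D \<noteq> {}" using Suc.hyps(2) by auto
    then have "Max (key ` D) \<in> key ` D" using fin by simp
    then obtain b where b: "b \<in> D" and mx: "key b = Max (key ` D)" by auto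
    have bB: "b \<in> B i" using b Suc.prems(4) by auto
    \<comment> \<open>As \<open>D\<close> is closed downwards, all monomials below its largest one
    remain.\<close>
    have low: "low i b = D - {b}"
    proof
      show "low i b \<subseteq> D - {b}" using down[OF b] by (auto simp: low_def)
      show "D - {b} \<subseteq> low i b"
      proof
        fix b' assume b': "b' \<in> D - {b}"
        then have "b' \<in> B i" using Suc.prems(4) by auto
        moreover have "key b' \<le> key b" using b' fin by (simp add: mx)
        moreover have "key b' \<noteq> key b" using inj_onD[OF inj_key[of i]] b' bB \<open>b' \<in> B i\<close> by auto
        ultimately show "b' \<in> low i b" by (simp add: low_def)
      qed
    qed
    have ins: "insert b (D - {b}) = D" using b by auto
    have "x \<in> span_of i (insert b (D - {b}))" using Suc.prems(3) ins by simp
    then obtain q y where q: "q \<in> carrier Q" and y: "y \<in> span_of i (D - {b})" and x: "x = c i b q \<otimes>\<^bsub>H i\<^esub> y"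
      by (rule span_of_insert[rotated 2]) (use Suc.prems(4) bB in auto)
    have "q \<in> lead N i b" unfolding lead_def low using q y x Suc.prems(2) by auto
    then have "q \<in> lead K i b" using lead[OF bB] by auto
    then obtain y' where y': "y' \<in> span_of i (D - {b})" "c i b q \<otimes>\<^bsub>H i\<^esub> y' \<in> K i"
      unfolding lead_def low by auto
    interpret D: subgroup "span_of i (D - {b})" "H i"
      using Suc.prems(4) by (intro subgroup_span_of) auto
    define z where "z = c i b q \<otimes>\<^bsub>H i\<^esub> y'"
    have zK: "z \<in> K i" using y' by (simp add: z_def)
    then have zN: "z \<in> N i" using KN by auto
    have xz: "x \<otimes>\<^bsub>H i\<^esub> inv\<^bsub>H i\<^esub> z = y \<otimes>\<^bsub>H i\<^esub> inv\<^bsub>H i\<^esub> y'"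
    proof -
      have cy: "c i b q \<in> carrier (H i)" "y \<in> carrier (H i)" "y' \<in> carrier (H i)"
        using c_closed[OF bB q] y y'(1) by auto
      have "x \<otimes>\<^bsub>H i\<^esub> inv\<^bsub>H i\<^esub> z
          = (c i b q \<otimes>\<^bsub>H i\<^esub> inv\<^bsub>H i\<^esub> c i b q) \<otimes>\<^bsub>H i\<^esub> (y \<otimes>\<^bsub>H i\<^esub> inv\<^bsub>H i\<^esub> y')"
        unfolding x z_def Hi.inv_mult[OF cy(1,3)] using cy Hi.inv_closed by (simp only: Hi.m_ac Hi.m_closed)
      then show ?thesis using cy by simp
    qed
    have "x \<otimes>\<^bsub>H i\<^esub> inv\<^bsub>H i\<^esub> z \<in> K i"
    proof (rule Suc.hyps(1))
      show "n = card (D - {b})" using Suc.hyps(2) b fin by simp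
      show "x \<otimes>\<^bsub>H i\<^esub> inv\<^bsub>H i\<^esub> z \<in> N i" using Suc.prems(2) zN by simp
      show "x \<otimes>\<^bsub>H i\<^esub> inv\<^bsub>H i\<^esub> z \<in> span_of i (D - {b})" unfolding xz using y y' by simp
      show "b2 \<in> D - {b}" if "b1 \<in> D - {b}" "b2 \<in> B i" "key b2 < key b1" for b1 b2
        using that unfolding low[symmetric] low_def by auto
    qed (use fin Suc.prems(4) in auto)
    then have "x \<otimes>\<^bsub>H i\<^esub> inv\<^bsub>H i\<^esub> z \<otimes>\<^bsub>H i\<^esub> z \<in> K i" using zK by (rule K.m_closed)
    moreover have "x \<otimes>\<^bsub>H i\<^esub> inv\<^bsub>H i\<^esub> z \<otimes>\<^bsub>H i\<^esub> z = x"
      using Suc.prems(2) zN by (simp add: Hi.m_assoc)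
    ultimately show ?case by simp
  qed
  note * = this
  show ?thesis
  proof
    fix x assume x: "x \<in> N i"
    then have "x \<in> span_of i (B i)" using gen N.subset by (auto simp: span_of_def)
    with x show "x \<in> K i" by (rule *[of x "B i"]) simp_all
  qed
qed

text \<open>
  Otherwise there is an infinite sequence of monomials none of which inherits its leading
  coefficients from an earlier one. It has a subsequence that increases along the arrows, and
  there the leading coefficients form an ascending chain of subgroups of \<open>Q\<close>, which
  becomes constant.
\<close>

lemma finitely_many_leads:
  assumes N: "subsystem H M act N"
  shows "\<exists>T. finite T \<and> T \<subseteq> Sigma UNIV B \<and>
    (\<forall>s\<in>Sigma UNIV B. \<exists>t\<in>T. (t, s) \<in> reach \<and> lead N (fst s) (snd s) = lead N (fst t) (snd t))"
proof (rule ccontr)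
  let ?ok = "\<lambda>T s. \<exists>t\<in>T. (t, s) \<in> reach \<and> lead N (fst s) (snd s) = lead N (fst t) (snd t)"
  assume none: "\<not> ?thesis"
  define pick where "pick = (\<lambda>T. SOME s. s \<in> Sigma UNIV B \<and> \<not> ?ok T s)"
  have pick: "pick T \<in> Sigma UNIV B \<and> \<not> ?ok T (pick T)" if "finite T" "T \<subseteq> Sigma UNIV B" for T
  proof -
    have "\<exists>s. s \<in> Sigma UNIV B \<and> \<not> ?ok T s" 
    proof (rule ccontr)
      assume "\<not> ?thesis"
      then have "\<forall>s\<in>Sigma UNIV B. ?ok T s" by simp
      with that have "finite T \<and> T \<subseteq> Sigma UNIV B \<and> (\<forall>s\<in>Sigma UNIV B. ?ok T s)" by (intro conjI)
      then have "\<exists>T. finite T \<and> T \<subseteq> Sigma UNIV B \<and> (\<forall>s\<in>Sigma UNIV B. ?ok T s)" by (rule exI)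
      from none this show False by (rule notE)
    qed
    then show ?thesis unfolding pick_def by (rule someI_ex)
  qed
  define Ts where "Ts = rec_nat {} (\<lambda>_ T. insert (pick T) T)"
  have Ts: "Ts 0 = {}" "Ts (Suc n) = insert (pick (Ts n)) (Ts n)" for n by (simp_all add: Ts_def)
  have Tsok: "finite (Ts n) \<and> Ts n \<subseteq> Sigma UNIV B" for n
  proof (induction n)
    case (Suc n)
    then show ?case using pick[of "Ts n"] by (auto simp: Ts(2))
  qed (simp add: Ts(1))
  define f where "f n = pick (Ts n)" for n
  have fB: "f n \<in> Sigma UNIV B" and f_bad: "\<not> ?ok (Ts n) (f n)" for n
    using pick[of "Ts n"] Tsok[of n] unfolding f_def by simp_all
  have fT: "f m \<in> Ts n" if "m < n" for m n
    using that by (induction n) (auto simp: Ts(2) f_def less_Suc_eq)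
  have "\<exists>g :: nat \<Rightarrow> nat. strict_mono g \<and> (\<forall>a b. a < b \<longrightarrow> (f (g a), f (g b)) \<in> reach)"
  proof (rule infinite_chain_if_good_pairs)
    fix g :: "nat \<Rightarrow> nat"
    have "range (\<lambda>n. f (g n)) \<subseteq> Sigma UNIV B" using fB by (rule image_subsetI)
    from wqo[OF this] show "\<exists>a b. a < b \<and> (f (g a), f (g b)) \<in> reach" unfolding reach_def .
  qed
  then obtain g :: "nat \<Rightarrow> nat" where g: "strict_mono g"
    and chain: "\<And>a b. a < b \<Longrightarrow> (f (g a), f (g b)) \<in> reach" by blast
  let ?L = "\<lambda>n. lead N (fst (f (g n))) (snd (f (g n)))"
  have "mono ?L"
  proof (rule monoI)
    fix m n :: nat assume "m \<le> n"
    then show "?L m \<subseteq> ?L n" using lead_reach[OF N chain, of m n] by (cases "m = n") auto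
  qed
  moreover have "subgroup (?L n) Q" for n
    using fB[of "g n"] by (intro lead_subgroup[OF N]) auto
  ultimately obtain n where n: "\<forall>m\<ge>n. ?L m = ?L n"
    using noetherian_group_stabilizes[OF Q, of ?L] by blast
  have "g n < g (Suc n)" using g by (simp add: strict_mono_Suc_iff)
  then have "f (g n) \<in> Ts (g (Suc n))" by (rule fT)
  moreover have "(f (g n), f (g (Suc n))) \<in> reach" by (rule chain) simp
  moreover have "?L (Suc n) = ?L n" by (rule n[THEN spec, THEN mp]) simp
  ultimately have "?ok (Ts (g (Suc n))) (f (g (Suc n)))" by (intro bexI[of _ "f (g n)"] conjI)
  with f_bad show False by blast
qed

theorem noetherian: "noetherian H M act"
proof (rule noetherianI)
  fix N assume N: "subsystem H M act N"
  obtain T where T: "finite T" "T \<subseteq> Sigma UNIV B"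
    and Tl: "\<forall>s\<in>Sigma UNIV B. \<exists>t\<in>T. (t, s) \<in> reach \<and> lead N (fst s) (snd s) = lead N (fst t) (snd t)"
    using finitely_many_leads[OF N] by blast
  have "\<exists>F. finite F \<and> F \<subseteq> lead N (fst t) (snd t) \<and>
      (\<forall>N'. subgroup N' Q \<longrightarrow> F \<subseteq> N' \<longrightarrow> lead N (fst t) (snd t) \<subseteq> N')" if "t \<in> T" for t
  proof -
    have "subgroup (lead N (fst t) (snd t)) Q" using T that by (intro lead_subgroup[OF N]) auto
    from noetherian_groupE[OF Q this] show ?thesis by metis
  qed
  then obtain F where F: "\<And>t. t \<in> T \<Longrightarrow> finite (F t)" "\<And>t. t \<in> T \<Longrightarrow> F t \<subseteq> lead N (fst t) (snd t)"
    and Fgen: "\<And>t N'. t \<in> T \<Longrightarrow> subgroup N' Q \<Longrightarrow> F t \<subseteq> N' \<Longrightarrow> lead N (fst t) (snd t) \<subseteq> N'"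
    by metis
  have "\<exists>y. y \<in> span_of (fst t) (low (fst t) (snd t)) \<and> c (fst t) (snd t) q \<otimes>\<^bsub>H (fst t)\<^esub> y \<in> N (fst t)"
    if "t \<in> T" "q \<in> F t" for t q
    using subsetD[OF F(2)[OF that(1)] that(2)] unfolding lead_def by auto
  then obtain y where y: "\<And>t q. t \<in> T \<Longrightarrow> q \<in> F t \<Longrightarrow> y t q \<in> span_of (fst t) (low (fst t) (snd t))"
    and yN: "\<And>t q. t \<in> T \<Longrightarrow> q \<in> F t \<Longrightarrow> c (fst t) (snd t) q \<otimes>\<^bsub>H (fst t)\<^esub> y t q \<in> N (fst t)"
    by metis
  define S where "S = (\<lambda>(t, q). (fst t, c (fst t) (snd t) q \<otimes>\<^bsub>H (fst t)\<^esub> y t q)) ` Sigma T F"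
  show "\<exists>S. finite S \<and> S \<subseteq> Sigma UNIV N \<and>
      (\<forall>N' i. subsystem H M act N' \<longrightarrow> S \<subseteq> Sigma UNIV N' \<longrightarrow> N i \<subseteq> N' i)"
  proof (intro exI[of _ S] conjI allI impI)
    show "finite S" unfolding S_def using T(1) F(1) by blast
    show SN: "S \<subseteq> Sigma UNIV N" unfolding S_def using yN by auto
    fix N' i assume N': "subsystem H M act N'" "S \<subseteq> Sigma UNIV N'"
    \<comment> \<open>\<open>K\<close> contains elements of \<open>N\<close> that realize all
    leading coefficients of \<open>N\<close>.\<close>
    define K where "K = (\<lambda>i. N i \<inter> N' i)"
    have K: "subsystem H M act K" unfolding K_def by (rule subsystem_Int[OF H N N'(1)])
    have SK: "S \<subseteq> Sigma UNIV K" using N'(2) SN by (auto simp: K_def)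
    have "lead N i b \<subseteq> lead K i b" if b: "b \<in> B i" for b
    proof -
      obtain t where t: "t \<in> T" "(t, (i, b)) \<in> reach" "lead N i b = lead N (fst t) (snd t)"
        using Tl b by fastforce
      have "F t \<subseteq> lead K (fst t) (snd t)"
      proof
        fix q assume q: "q \<in> F t"
        then have "(fst t, c (fst t) (snd t) q \<otimes>\<^bsub>H (fst t)\<^esub> y t q) \<in> S"
          unfolding S_def using t(1) by force
        then have "c (fst t) (snd t) q \<otimes>\<^bsub>H (fst t)\<^esub> y t q \<in> K (fst t)" using SK by auto
        moreover have "q \<in> carrier Q" using F(2)[OF t(1)] q by (auto simp: lead_def)
        ultimately show "q \<in> lead K (fst t) (snd t)"
          unfolding lead_def using y[OF t(1) q] by blast
      qed
      then have "lead N (fst t) (snd t) \<subseteq> lead K (fst t) (snd t)"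
        using T(2) t(1) by (intro Fgen[OF t(1)] lead_subgroup[OF K]) auto
      also have "\<dots> \<subseteq> lead K i b" using lead_reach[OF K t(2)] by simp
      finally show ?thesis using t(3) by simp
    qed
    then have "N i \<subseteq> K i" by (intro subset_if_lead_subset[OF N K]) (auto simp: K_def)
    then show "N i \<subseteq> N' i" by (auto simp: K_def)
  qed
qed

end

section \<open>The topology of a finite graph\<close>

text \<open>
  Affine on \<open>{m..1-m}\<close>, which it stretches onto the unit interval, and constant on
  both sides of it. So a point stays inside the open interval exactly if its distance from the
  ends exceeds \<open>m\<close>.
\<close>

definition expand :: "real \<Rightarrow> real \<Rightarrow> real" where
  "expand m t = max 0 (min 1 ((t - m) / (1 - 2 * m)))"

definition ends_depth :: "real \<Rightarrow> real" where
  "ends_depth t = min t (1 - t)"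

lemma expand_0: "0 \<le> t \<Longrightarrow> t \<le> 1 \<Longrightarrow> expand 0 t = t"
  by (simp add: expand_def)

lemma expand_range: "0 \<le> expand m t" "expand m t \<le> 1"
  by (auto simp: expand_def)

lemma expand_ends: "0 \<le> m \<Longrightarrow> m < 1/2 \<Longrightarrow> expand m 0 = 0" "0 \<le> m \<Longrightarrow> m < 1/2 \<Longrightarrow> expand m 1 = 1"
  by (auto simp: expand_def divide_simps)

lemma expand_inner_iff:
  assumes "0 \<le> m" "m < 1/2"
  shows "0 < expand m t \<and> expand m t < 1 \<longleftrightarrow> m < ends_depth t"
  using assms by (auto simp: expand_def ends_depth_def divide_simps max_def min_def split: if_splits)

lemma expand_inj:
  assumes "0 \<le> m" "m < 1/2" "expand m s = expand m t" "0 < expand m t" "expand m t < 1"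
  shows "s = t"
proof -
  have "(s - m) / (1 - 2 * m) = (t - m) / (1 - 2 * m)"
    using assms(3-5) by (auto simp: expand_def max_def min_def split: if_splits)
  then show ?thesis using assms by (simp add: divide_simps)
qed

text \<open>
  The characteristic maps are chosen once and for all, since they provide the coordinates on the
  edges.
\<close>

locale finite_graph =
  fixes G :: "'a topology" and V :: "'a set" and E :: "'a set set" and \<phi> :: "'a set \<Rightarrow> real \<Rightarrow> 'a"
  assumes Hausdorff: "Hausdorff_space G"
    and finite_V: "finite V" and finite_E: "finite E"
    and cover: "V \<union> \<Union>E = topspace G"
    and disj_VE: "disjnt V (\<Union>E)" and disj_E: "pairwise disjnt E"
    and char: "e \<in> E \<Longrightarrow> char_map G V e (\<phi> e)"
begin

lemma V_sub: "V \<subseteq> topspace G" using cover by auto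

lemma E_sub: "e \<in> E \<Longrightarrow> e \<subseteq> topspace G" using cover by auto

lemma not_V: "e \<in> E \<Longrightarrow> x \<in> e \<Longrightarrow> x \<notin> V"
  using disj_VE by (auto simp: disjnt_def)

lemma E_unique: "e \<in> E \<Longrightarrow> e' \<in> E \<Longrightarrow> x \<in> e \<Longrightarrow> x \<in> e' \<Longrightarrow> e = e'"
  using disj_E by (auto simp: pairwise_def disjnt_def)

lemma point_cases:
  assumes "x \<in> topspace G" obtains "x \<in> V" | e where "e \<in> E" "x \<in> e"
  using assms cover by auto

lemma phi_cont: "e \<in> E \<Longrightarrow> continuous_map (top_of_set {0..1}) G (\<phi> e)"
  and phi_ends: "e \<in> E \<Longrightarrow> \<phi> e 0 \<in> V" "e \<in> E \<Longrightarrow> \<phi> e 1 \<in> V"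
  and phi_homeo: "e \<in> E \<Longrightarrow> homeomorphic_map (top_of_set {0<..<1}) (subtopology G e) (\<phi> e)"
  using char by (auto simp: char_map_def)

lemma phi_image: "e \<in> E \<Longrightarrow> \<phi> e ` {0<..<1} = e"
  using homeomorphic_imp_surjective_map[OF phi_homeo, of e] E_sub[of e] by auto

lemma phi_inj: "e \<in> E \<Longrightarrow> inj_on (\<phi> e) {0<..<1}"
  using homeomorphic_imp_injective_map[OF phi_homeo, of e] by simp

lemma phi_closed_range: "e \<in> E \<Longrightarrow> t \<in> {0..1} \<Longrightarrow> \<phi> e t \<in> topspace G"
  using continuous_map_image_subset_topspace[OF phi_cont[of e]] by (auto simp: image_subset_iff)

lemma phi_mem: "e \<in> E \<Longrightarrow> 0 < t \<Longrightarrow> t < 1 \<Longrightarrow> \<phi> e t \<in> e"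
  using phi_image[of e] by auto

lemma phi_V: "e \<in> E \<Longrightarrow> t \<in> {0..1} \<Longrightarrow> \<not> (0 < t \<and> t < 1) \<Longrightarrow> \<phi> e t \<in> V"
  using phi_ends[of e] by (cases "t = 0") (auto simp: less_le)

definition coord :: "'a set \<Rightarrow> 'a \<Rightarrow> real" where
  "coord e = inv_into {0<..<1} (\<phi> e)"

lemma coord_range: "e \<in> E \<Longrightarrow> x \<in> e \<Longrightarrow> 0 < coord e x \<and> coord e x < 1"
  using inv_into_into[of x "\<phi> e" "{0<..<1}"] phi_image[of e] by (simp add: coord_def)

lemma phi_coord: "e \<in> E \<Longrightarrow> x \<in> e \<Longrightarrow> \<phi> e (coord e x) = x"
  using f_inv_into_f[of x "\<phi> e" "{0<..<1}"] phi_image[of e] by (simp add: coord_def)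

lemma coord_phi: "e \<in> E \<Longrightarrow> 0 < t \<Longrightarrow> t < 1 \<Longrightarrow> coord e (\<phi> e t) = t"
  using inv_into_f_f[OF phi_inj] by (simp add: coord_def)

lemma coord_cont:
  assumes e: "e \<in> E" shows "continuous_map (subtopology G e) (top_of_set {0<..<1}) (coord e)"
proof -
  obtain g where g: "homeomorphic_maps (top_of_set {0<..<1}) (subtopology G e) (\<phi> e) g"
    using phi_homeo[OF e] unfolding homeomorphic_map_maps by blast
  then have cg: "continuous_map (subtopology G e) (top_of_set {0<..<1}) g"
    by (simp add: homeomorphic_maps_def)
  then show ?thesis
  proof (rule continuous_map_eq)
    fix x assume "x \<in> topspace (subtopology G e)"
    then have x: "x \<in> e" "x \<in> topspace (subtopology G e)" by auto
    then have "g x \<in> {0<..<1}"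
      using subsetD[OF continuous_map_image_subset_topspace[OF cg] imageI[OF x(2)]] by simp
    moreover have "\<phi> e (g x) = x" using g x by (auto simp: homeomorphic_maps_def)
    ultimately show "g x = coord e x" using coord_phi[OF e, of "g x"] by auto
  qed
qed

text \<open>
  The graph is a quotient of a finite disjoint union of closed intervals and points, and it
  remains so after taking the product with any space \<open>Z\<close>: the characteristic maps are
  proper, so their products with the identity of \<open>Z\<close> are closed maps.
\<close>

lemma continuous_map_glue:
  assumes F: "\<And>e. e \<in> E \<Longrightarrow> continuous_map (prod_topology Z (top_of_set {0..1})) Y (\<lambda>(z, t). F (z, \<phi> e t))"
    and FV: "\<And>v. v \<in> V \<Longrightarrow> continuous_map Z Y (\<lambda>z. F (z, v))"
  shows "continuous_map (prod_topology Z G) Y F"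
  unfolding continuous_map_closedin
proof (intro conjI allI impI ballI)
  have FE: "F (z, x) \<in> topspace Y" if "z \<in> topspace Z" "x \<in> topspace G" for z x
    using that(2)
  proof (cases rule: point_cases)
    case 1
    then show ?thesis using continuous_map_image_subset_topspace[OF FV[OF 1]] that(1) by auto
  next
    case (2 e)
    have "(z, coord e x) \<in> topspace (prod_topology Z (top_of_set {0..1}))"
      using that(1) coord_range[OF 2] by simp
    then show ?thesis
      using continuous_map_image_subset_topspace[OF F[OF 2(1)]] phi_coord[OF 2] by fastforce
  qed
  then show "F \<in> topspace (prod_topology Z G) \<rightarrow> topspace Y" by auto
  fix C assume C: "closedin Y C"
  let ?I = "top_of_set {0..1::real}"
  let ?P = "\<lambda>e. {p \<in> topspace (prod_topology Z ?I). (case p of (z, t) \<Rightarrow> F (z, \<phi> e t)) \<in> C}"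
  let ?q = "\<lambda>e. \<lambda>(z, t). (z, \<phi> e t)"
  let ?D = "\<lambda>v. {z \<in> topspace Z. F (z, v) \<in> C} \<times> {v}"
  have eq: "{p \<in> topspace (prod_topology Z G). F p \<in> C} = (\<Union>e\<in>E. ?q e ` ?P e) \<union> (\<Union>v\<in>V. ?D v)"
    (is "?l = ?r")
  proof
    show "?l \<subseteq> ?r"
    proof
      fix p assume p: "p \<in> ?l"
      obtain z x where zx: "p = (z, x)" by force
      then have z: "z \<in> topspace Z" and x: "x \<in> topspace G" and C: "F (z, x) \<in> C" using p by auto
      from x show "p \<in> ?r"
      proof (cases rule: point_cases)
        case 1
        then show ?thesis using z C zx by auto
      next
        case (2 e)
        have "(z, coord e x) \<in> ?P e" using z coord_range[OF 2] phi_coord[OF 2] C by simp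
        moreover have "p = ?q e (z, coord e x)" using phi_coord[OF 2] zx by simp
        ultimately show ?thesis using 2(1) by blast
      qed
    qed
    show "?r \<subseteq> ?l" using phi_closed_range V_sub by auto
  qed
  have "closedin (prod_topology Z G) (?q e ` ?P e)" if e: "e \<in> E" for e
  proof -
    have "proper_map ?I G (\<phi> e)"
      using phi_cont[OF e] Hausdorff
      by (intro continuous_imp_proper_map) (auto simp: compact_space_subtopology Hausdorff_imp_kc_space)
    then have "proper_map (prod_topology Z ?I) (prod_topology Z G) (\<lambda>(z, t). (id z, \<phi> e t))"
      unfolding proper_map_prod by (simp only: proper_map_id simp_thms)
    then have "closed_map (prod_topology Z ?I) (prod_topology Z G) (?q e)"
      by (simp add: proper_map_def)
    moreover have "closedin (prod_topology Z ?I) (?P e)"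
      using closedin_continuous_map_preimage[OF F[OF e] C] by simp
    ultimately show ?thesis by (simp add: closed_map_def)
  qed
  moreover have "closedin (prod_topology Z G) (?D v)" if v: "v \<in> V" for v
  proof -
    have "closedin Z {z \<in> topspace Z. F (z, v) \<in> C}"
      by (rule closedin_continuous_map_preimage[OF FV[OF v] C])
    moreover have "closedin G {v}" using Hausdorff V_sub v by (simp add: closedin_Hausdorff_singleton subset_iff)
    ultimately show ?thesis by (simp add: closedin_prod_Times_iff)
  qed
  ultimately show "closedin (prod_topology Z G) {p \<in> topspace (prod_topology Z G). F p \<in> C}"
    unfolding eq using finite_V finite_E by (intro closedin_Un closedin_Union) auto
qed

text \<open>
  The distance of a point from the ends of the edge \<open>e\<close>, measured in the coordinate
  of \<open>e\<close>, and zero off \<open>e\<close>. Unlike the coordinate itself it is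
  continuous on the whole graph.
\<close>

definition depth :: "'a set \<Rightarrow> 'a \<Rightarrow> real" where
  "depth e x = (if x \<in> e then ends_depth (coord e x) else 0)"

lemma depth_phi:
  assumes "e \<in> E" "e' \<in> E" "t \<in> {0..1}"
  shows "depth e (\<phi> e' t) = (if e' = e then ends_depth t else 0)"
proof (cases "0 < t \<and> t < 1")
  case True
  then have "\<phi> e' t \<in> e \<longleftrightarrow> e' = e" using phi_mem[OF assms(2)] E_unique assms(1,2) by blast
  then show ?thesis using True coord_phi[OF assms(1)] by (auto simp: depth_def)
next
  case False
  then have "\<phi> e' t \<notin> e" using phi_V[OF assms(2,3)] not_V[OF assms(1)] by blast
  moreover have "ends_depth t = 0" using False assms(3) by (auto simp: ends_depth_def)
  ultimately show ?thesis by (simp add: depth_def)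
qed

lemma depth_cont:
  assumes e: "e \<in> E" shows "continuous_map G euclideanreal (depth e)"
proof -
  let ?Z = "discrete_topology {()}"
  let ?I = "top_of_set {0..1::real}"
  have "continuous_map (prod_topology ?Z G) euclideanreal (\<lambda>(z, x). depth e x)"
  proof (rule continuous_map_glue)
    fix e' assume e': "e' \<in> E"
    have "continuous_map ?I euclideanreal (\<lambda>t. if e' = e then ends_depth t else 0)"
      by (auto simp: ends_depth_def intro!: continuous_intros)
    then have "continuous_map (prod_topology ?Z ?I) euclideanreal (\<lambda>p. if e' = e then ends_depth (snd p) else 0)"
      by (rule continuous_map_compose[OF continuous_map_snd, unfolded o_def])
    then show "continuous_map (prod_topology ?Z ?I) euclideanreal
        (\<lambda>(z, t). case (z, \<phi> e' t) of (z, x) \<Rightarrow> depth e x)"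
    proof (rule continuous_map_eq)
      fix p assume "p \<in> topspace (prod_topology ?Z ?I)"
      then show "(if e' = e then ends_depth (snd p) else 0) =
          (case p of (z, t) \<Rightarrow> case (z, \<phi> e' t) of (z, x) \<Rightarrow> depth e x)"
        using depth_phi[OF e e'] by (cases p) simp
    qed
  qed simp
  moreover have "continuous_map G (prod_topology ?Z G) (\<lambda>x. ((), x))"
    by (simp add: continuous_map_pairedI)
  moreover have "(\<lambda>(z, x). depth e x) \<circ> (\<lambda>x. ((), x)) = depth e" by auto
  ultimately show ?thesis using continuous_map_compose by metis
qed

lemma depth_pos_iff: "e \<in> E \<Longrightarrow> 0 < depth e x \<longleftrightarrow> x \<in> e"
  using coord_range[of e x] by (auto simp: depth_def ends_depth_def)

lemma depth_le_half: "depth e x \<le> 1/2"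
  by (auto simp: depth_def ends_depth_def min_def)

text \<open>
  Only the midpoint of an edge has the maximal depth.
\<close>

lemma depth_half_unique:
  assumes "e \<in> E" "depth e x = 1/2" "depth e y = 1/2" shows "x = y"
proof -
  have xe: "x \<in> e" "y \<in> e" using assms depth_pos_iff[OF assms(1)] by force+
  have "coord e x = 1/2" "coord e y = 1/2"
    using assms xe by (auto simp: depth_def ends_depth_def min_def split: if_splits)
  then show ?thesis using phi_coord[OF assms(1)] xe by metis
qed

lemma openin_E: "e \<in> E \<Longrightarrow> openin G e"
proof -
  assume e: "e \<in> E"
  have "openin G {x \<in> topspace G. depth e x \<in> {0<..}}"
    by (rule openin_continuous_map_preimage[OF depth_cont[OF e]]) simp
  moreover have "{x \<in> topspace G. depth e x \<in> {0<..}} = e"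
    using depth_pos_iff[OF e] E_sub[OF e] by auto
  ultimately show ?thesis by simp
qed

text \<open>
  Expand each open edge \<open>e\<close> as prescribed by \<open>m e\<close>, collapsing its two
  outer parts to the end vertices.
\<close>

definition push :: "('a set \<Rightarrow> real) \<Rightarrow> 'a \<Rightarrow> 'a" where
  "push m x = (if x \<in> \<Union>E then let e = THE e. e \<in> E \<and> x \<in> e in \<phi> e (expand (m e) (coord e x)) else x)"

lemma push_edge:
  assumes "e \<in> E" "x \<in> e" shows "push m x = \<phi> e (expand (m e) (coord e x))"
proof -
  have "(THE e. e \<in> E \<and> x \<in> e) = e" 
  proof (rule the_equality)
    show "e' = e" if "e' \<in> E \<and> x \<in> e'" for e'
      using that assms by (intro E_unique[of e' e x]) simp_all
  qed (use assms in simp)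
  then show ?thesis using assms by (auto simp: push_def)
qed

lemma push_V: "x \<in> V \<Longrightarrow> push m x = x"
  using not_V by (auto simp: push_def)

lemma push_phi:
  assumes "e \<in> E" "t \<in> {0..1}" "0 \<le> m e" "m e < 1/2"
  shows "push m (\<phi> e t) = \<phi> e (expand (m e) t)"
proof (cases "0 < t \<and> t < 1")
  case True
  then show ?thesis using push_edge[OF assms(1) phi_mem[OF assms(1)]] coord_phi[OF assms(1)] by simp
next
  case False
  then have "expand (m e) t = t" using expand_ends[OF assms(3,4)] assms(2) by (cases "t = 0") auto
  then show ?thesis using push_V phi_V[OF assms(1,2) False] by simp
qed

lemma push_0:
  assumes x: "x \<in> topspace G" and m: "\<And>e. e \<in> E \<Longrightarrow> m e = 0"
  shows "push m x = x"
  using x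
proof (cases rule: point_cases)
  case (2 e)
  have "expand 0 (coord e x) = coord e x" using coord_range[OF 2] by (intro expand_0) auto
  then show ?thesis using push_edge[OF 2, of m] phi_coord[OF 2] m[OF 2(1)] by simp
qed (simp add: push_V)

lemma push_topspace:
  assumes x: "x \<in> topspace G" shows "push m x \<in> topspace G"
  using x
proof (cases rule: point_cases)
  case (2 e)
  show ?thesis using push_edge[OF 2, of m] phi_closed_range[OF 2(1)] expand_range by simp
qed (use V_sub x in \<open>simp add: push_V\<close>)

lemma push_mem_edge_iff:
  assumes e: "e \<in> E" and x: "x \<in> topspace G" and m: "0 \<le> m e" "m e < 1/2"
  shows "push m x \<in> e \<longleftrightarrow> m e < depth e x"
  using x
proof (cases rule: point_cases)
  case 1
  then show ?thesis using push_V not_V[OF e] m(1) by (auto simp: depth_def)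
next
  case (2 e')
  have r: "expand (m e') (coord e' x) \<in> {0..1}" using expand_range by simp
  show ?thesis
  proof (cases "e' = e")
    case True
    have "push m x \<in> e \<longleftrightarrow> 0 < expand (m e) (coord e x) \<and> expand (m e) (coord e x) < 1"
      using push_edge[OF 2] True phi_V[OF 2(1) r] phi_mem[OF e] not_V[OF e] by auto
    then show ?thesis using expand_inner_iff[OF m] 2 True by (simp add: depth_def)
  next
    case False
    then have "x \<notin> e" using 2 e E_unique by blast
    moreover have "push m x \<notin> e"
    proof (cases "0 < expand (m e') (coord e' x) \<and> expand (m e') (coord e' x) < 1")
      case True
      then have "push m x \<in> e'" using push_edge[OF 2, of m] phi_mem[OF 2(1)] by simp
      then show ?thesis using E_unique[OF e 2(1), of "push m x"] False by blast
    next
      case False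
      then have "push m x \<in> V" using push_edge[OF 2, of m] phi_V[OF 2(1) r] by simp
      then show ?thesis using not_V[OF e] by blast
    qed
    ultimately show ?thesis using m(1) by (simp add: depth_def)
  qed
qed

lemma push_in_edge_imp:
  assumes e: "e \<in> E" and x: "x \<in> topspace G" and p: "push m x \<in> e"
  shows "x \<in> e"
  using x
proof (cases rule: point_cases)
  case 1
  then show ?thesis using push_V not_V[OF e] p by auto
next
  case (2 e')
  have r: "expand (m e') (coord e' x) \<in> {0..1}" using expand_range by simp
  show ?thesis
  proof (cases "e' = e")
    case False
    then have "push m x \<notin> e"
    proof (cases "0 < expand (m e') (coord e' x) \<and> expand (m e') (coord e' x) < 1")
      case True
      then have "push m x \<in> e'" using push_edge[OF 2, of m] phi_mem[OF 2(1)] by simp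
      then show ?thesis using E_unique[OF e 2(1), of "push m x"] False by blast
    next
      case False
      then have "push m x \<in> V" using push_edge[OF 2, of m] phi_V[OF 2(1) r] by simp
      then show ?thesis using not_V[OF e] by blast
    qed
    then show ?thesis using p by blast
  qed (use 2 in simp)
qed

text \<open>
  Points that meet under a push have reached a vertex, so a push never produces a forbidden
  collision.
\<close>

lemma push_inj:
  assumes x: "x \<in> topspace G" and y: "y \<in> topspace G" and m: "\<And>e. e \<in> E \<Longrightarrow> 0 \<le> m e \<and> m e < 1/2"
    and eq: "push m x = push m y" and nV: "push m x \<notin> V"
  shows "x = y"
proof -
  obtain e where e: "e \<in> E" "push m x \<in> e"
    using push_topspace[OF x] nV by (cases rule: point_cases) auto
  then have xe: "x \<in> e" and ye: "y \<in> e"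
    using push_in_edge_imp[OF e(1) x e(2)] push_in_edge_imp[OF e(1) y] e(2) eq by simp_all
  have "0 < expand (m e) (coord e z) \<and> expand (m e) (coord e z) < 1" if "z \<in> e" "push m z \<in> e" for z
  proof (rule ccontr)
    assume "\<not> ?thesis"
    then have "\<phi> e (expand (m e) (coord e z)) \<in> V" using expand_range by (intro phi_V[OF e(1)]) auto
    then show False using push_edge[OF e(1) that(1)] that(2) not_V[OF e(1)] by auto
  qed
  then have *: "0 < expand (m e) (coord e x) \<and> expand (m e) (coord e x) < 1"
    "0 < expand (m e) (coord e y) \<and> expand (m e) (coord e y) < 1"
    using xe ye e(2) eq by auto
  then have "expand (m e) (coord e x) = expand (m e) (coord e y)"
    using eq push_edge[OF e(1) xe] push_edge[OF e(1) ye] coord_phi[OF e(1)] by metis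
  from expand_inj[OF _ _ this] m[OF e(1)] * have c: "coord e x = coord e y" by simp
  have "x = \<phi> e (coord e x)" by (rule phi_coord[OF e(1) xe, symmetric])
  also have "\<dots> = y" unfolding c by (rule phi_coord[OF e(1) ye])
  finally show ?thesis .
qed

lemma push_cont:
  assumes m: "\<And>e. e \<in> E \<Longrightarrow> continuous_map Z euclideanreal (\<lambda>z. m z e)"
    and range: "\<And>e z. e \<in> E \<Longrightarrow> z \<in> topspace Z \<Longrightarrow> 0 \<le> m z e \<and> m z e < 1/2"
  shows "continuous_map (prod_topology Z G) G (\<lambda>(z, x). push (m z) x)"
proof (rule continuous_map_glue)
  let ?I = "top_of_set {0..1::real}"
  fix e assume e: "e \<in> E"
  have mf: "continuous_map (prod_topology Z ?I) euclideanreal (\<lambda>p. m (fst p) e)"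
    using continuous_map_compose[OF continuous_map_fst m[OF e]] by (simp add: o_def)
  have sn: "continuous_map (prod_topology Z ?I) euclideanreal snd"
    by (rule continuous_map_into_fulltopology[OF continuous_map_snd])
  have "continuous_map (prod_topology Z ?I) euclideanreal (\<lambda>p. expand (m (fst p) e) (snd p))"
    unfolding expand_def using range[OF e]
    by (intro continuous_map_real_max continuous_map_real_min continuous_map_real_divide
        continuous_map_diff continuous_map_real_mult mf sn) fastforce+
  then have "continuous_map (prod_topology Z ?I) ?I (\<lambda>p. expand (m (fst p) e) (snd p))"
    using expand_range by (auto simp: continuous_map_in_subtopology)
  then have "continuous_map (prod_topology Z ?I) G (\<lambda>p. \<phi> e (expand (m (fst p) e) (snd p)))"
    using continuous_map_compose[OF _ phi_cont[OF e]] by (fastforce simp: o_def)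
  then show "continuous_map (prod_topology Z ?I) G (\<lambda>(z, t). case (z, \<phi> e t) of (z, x) \<Rightarrow> push (m z) x)"
  proof (rule continuous_map_eq)
    fix p assume "p \<in> topspace (prod_topology Z ?I)"
    then show "\<phi> e (expand (m (fst p) e) (snd p)) = (case p of (z, t) \<Rightarrow> case (z, \<phi> e t) of (z, x) \<Rightarrow> push (m z) x)"
      using push_phi[OF e] range[OF e] by (cases p) auto
  qed
next
  fix v assume v: "v \<in> V"
  then show "continuous_map Z G (\<lambda>z. case (z, v) of (z, x) \<Rightarrow> push (m z) x)"
    using V_sub by (auto simp: push_V)
qed

end

lemma finite_if_subsets_closed:
  assumes "compact_space G" "P \<subseteq> topspace G" "\<And>A. A \<subseteq> P \<Longrightarrow> closedin G A"
  shows "finite P"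
proof -
  have "openin (subtopology G P) A" if "A \<subseteq> P" for A
  proof -
    have "closedin (subtopology G P) (P - A)" using assms that by (intro closedin_subset_topspace) auto
    then have "openin (subtopology G P) (topspace (subtopology G P) - (P - A))" by blast
    moreover have "topspace (subtopology G P) - (P - A) = A" using that assms(2) by auto
    ultimately show ?thesis by simp
  qed
  then have "discrete_topology P = subtopology G P"
    unfolding discrete_topology_unique using assms(2) by auto
  moreover have "compactin G P" using assms by (intro closedin_compact_space) auto
  then have "compact_space (subtopology G P)" using compactin_subspace by blast
  ultimately show ?thesis by (metis compact_space_discrete_topology)
qed

text \<open>
  In the weak topology a set which meets every open edge in a finite set is closed, since the
  closure of an edge adds at most two vertices. So all sets of vertices and all sets of midpoints
  of edges are closed; in a compact space this forces the sets of vertices and of edges to be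
  finite.
\<close>

lemma finite_graph_exists:
  assumes "graph G V E"
  obtains \<phi> where "finite_graph G V E \<phi>"
proof -
  have CW: "CW_dim_one G V E" and cpt: "compact_space G" using assms by (auto simp: graph_def)
  have H: "Hausdorff_space G" and cover: "V \<union> \<Union>E = topspace G" and dVE: "disjnt V (\<Union>E)"
    and dE: "pairwise disjnt E" and char: "\<forall>e\<in>E. \<exists>\<phi>. char_map G V e \<phi>"
    and weak: "\<forall>A\<subseteq>topspace G. closedin G A \<longleftrightarrow> (\<forall>c\<in>cells V E. closedin G (A \<inter> G closure_of c))"
    using CW by (auto simp: CW_dim_one_def)
  obtain \<phi> where \<phi>: "\<And>e. e \<in> E \<Longrightarrow> char_map G V e (\<phi> e)" using char by metis
  have img: "\<phi> e ` {0<..<1} = e" if "e \<in> E" for e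
  proof -
    have "homeomorphic_map (top_of_set {0<..<1}) (subtopology G e) (\<phi> e)"
      using \<phi>[OF that] by (simp add: char_map_def)
    from homeomorphic_imp_surjective_map[OF this] show ?thesis
      using cover that by auto
  qed
  have closure: "G closure_of e \<subseteq> insert (\<phi> e 0) (insert (\<phi> e 1) e)" if e: "e \<in> E" for e
  proof (rule closure_of_minimal)
    have c: "continuous_map (top_of_set {0..1}) G (\<phi> e)" using \<phi>[OF e] by (simp add: char_map_def)
    have "compactin (top_of_set {0..1::real}) {0..1}" by (simp add: compactin_subtopology)
    then have "compactin G (\<phi> e ` {0..1})" using c by (rule image_compactin)
    then have "closedin G (\<phi> e ` {0..1})" by (rule compactin_imp_closedin[OF H])
    moreover have "{0..1::real} = insert 0 (insert 1 {0<..<1})" by auto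
    then have "\<phi> e ` {0..1} = insert (\<phi> e 0) (insert (\<phi> e 1) e)" using img[OF e] by (simp add: image_insert)
    ultimately show "closedin G (insert (\<phi> e 0) (insert (\<phi> e 1) e))" by simp
  qed auto
  have closed: "closedin G A"
    if A: "A \<subseteq> topspace G" and fin: "\<And>e. e \<in> E \<Longrightarrow> finite (A \<inter> e)" for A
  proof -
    have "closedin G (A \<inter> G closure_of c)" if c: "c \<in> cells V E" for c
    proof -
      have "finite (A \<inter> G closure_of c)"
      proof (cases "c \<in> E")
        case True
        then have "A \<inter> G closure_of c \<subseteq> insert (\<phi> c 0) (insert (\<phi> c 1) (A \<inter> c))" using closure by blast
        then show ?thesis using fin[OF True] by (meson finite.insertI finite_subset)
      next
        case False
        then obtain v where v: "v \<in> V" "c = {v}" using c by (auto simp: cells_def)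
        then have "v \<in> topspace G" using cover by blast
          then have "closedin G c" using H v by (simp add: closedin_Hausdorff_singleton)
        then have "G closure_of c = {v}" unfolding closure_of_eq[symmetric] v(2) .
        then show ?thesis by simp
      qed
      then show ?thesis using H A by (intro closedin_Hausdorff_finite) auto
    qed
    then show ?thesis using weak A by blast
  qed
  have "finite V"
  proof (rule finite_if_subsets_closed[OF cpt])
    show "V \<subseteq> topspace G" using cover by auto
    fix A assume A: "A \<subseteq> V"
    have "A \<inter> e = {}" if "e \<in> E" for e using A dVE that by (auto simp: disjnt_def)
    then show "closedin G A" using A cover by (intro closed) auto
  qed
  have mid: "\<phi> e (1/2) \<in> e" if "e \<in> E" for e
  proof -
    have "\<phi> e (1/2) \<in> \<phi> e ` {0<..<1}" by (rule imageI) simp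
    then show ?thesis using img[OF that] by simp
  qed
  have uniq: "e = e'" if "e \<in> E" "e' \<in> E" "x \<in> e" "x \<in> e'" for e e' x
    using dE that by (auto simp: pairwise_def disjnt_def)
  have "finite ((\<lambda>e. \<phi> e (1/2)) ` E)"
  proof (rule finite_if_subsets_closed[OF cpt])
    show "(\<lambda>e. \<phi> e (1/2)) ` E \<subseteq> topspace G" using mid cover by blast
    fix A assume A: "A \<subseteq> (\<lambda>e. \<phi> e (1/2)) ` E"
    show "closedin G A"
    proof (rule closed)
      show "A \<subseteq> topspace G" using A mid cover by blast
      fix e assume e: "e \<in> E"
      have "A \<inter> e \<subseteq> {\<phi> e (1/2)}"
      proof
        fix x assume x: "x \<in> A \<inter> e"
        then obtain e' where "e' \<in> E" "x = \<phi> e' (1/2)" using A by auto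
        then show "x \<in> {\<phi> e (1/2)}" using uniq[OF e, of e' x] x mid by auto
      qed
      then show "finite (A \<inter> e)" using finite_subset by blast
    qed
  qed
  moreover have "inj_on (\<lambda>e. \<phi> e (1/2)) E"
    using mid uniq by (intro inj_onI) metis
  ultimately have "finite E" using finite_imageD by blast
  then have "finite_graph G V E \<phi>"
    using H \<open>finite V\<close> cover dVE dE \<phi> by unfold_locales auto
  then show thesis by (rule that)
qed

section \<open>Relative homology of a disjoint union of open sets\<close>

lemma generate_hom_image:
  assumes "group A" "group B" "f \<in> hom A B" "S \<subseteq> carrier A" "x \<in> generate A S"
  shows "f x \<in> generate B (f ` S)"
proof -
  interpret group_hom A B f using assms(1-3) by (simp add: group_hom_def group_hom_axioms_def)
  show ?thesis using generate_img[OF assms(4)] assms(5) by blast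
qed

text \<open>
  In the exact sequence of the triple \<open>W \<subseteq> C \<union> W \<subseteq> X\<close> both
  outer terms are excisive: the relative homology of \<open>C \<union> W\<close> modulo
  \<open>W\<close> comes from \<open>C\<close>, and that of \<open>X\<close> modulo \<open>C
  \<union> W\<close> comes from \<open>C'\<close>.
\<close>

lemma relative_homology_clopen_split:
  assumes C: "openin X C" "openin X C'" "disjnt C C'" "C \<union> C' = topspace X" and W: "W \<subseteq> topspace X"
    and z: "z \<in> carrier (relative_homology_group p X W)"
  obtains a b where
    "a \<in> hom_induced p (subtopology X C) (C \<inter> W) X W id ` carrier (relative_homology_group p (subtopology X C) (C \<inter> W))"
    "b \<in> hom_induced p (subtopology X C') (C' \<inter> W) X W id ` carrier (relative_homology_group p (subtopology X C') (C' \<inter> W))"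
    "z = a \<otimes>\<^bsub>relative_homology_group p X W\<^esub> b"
proof -
  let ?H = "\<lambda>X W. relative_homology_group p X W"
  let ?S = "C \<union> W"
  have XC: "topspace X - C = C'" using C by (auto simp: disjnt_def)
  have XC': "topspace X - C' = C" using C by (auto simp: disjnt_def)
  have clC: "closedin X C" "closedin X C'"
    using C(1,2) XC XC' openin_subset by (metis closedin_def double_diff order_refl)+
  have e1: "hom_induced p (subtopology X (topspace X - C)) (?S - C) (subtopology X (topspace X)) ?S id
      \<in> iso (?H (subtopology X (topspace X - C)) (?S - C)) (?H (subtopology X (topspace X)) ?S)"
  proof (rule homology_excision_axiom)
    have "C \<subseteq> X interior_of ?S" using C(1) by (intro interior_of_maximal) auto
    then show "X closure_of C \<subseteq> X interior_of ?S" using clC by (simp add: closure_of_closedin)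
    show "?S \<subseteq> topspace X" using C W by auto
  qed
  have SC: "?S - C = C' \<inter> W" using C W by (auto simp: disjnt_def)
  have e1': "hom_induced p (subtopology X C') (C' \<inter> W) X ?S id ` carrier (?H (subtopology X C') (C' \<inter> W)) = carrier (?H X ?S)"
    using e1 by (simp add: XC SC iso_iff)
  let ?Y = "subtopology X ?S"
  have e2: "hom_induced p (subtopology ?Y (?S - (C' \<inter> W))) (W - (C' \<inter> W)) (subtopology ?Y ?S) W id
      \<in> iso (?H (subtopology ?Y (?S - (C' \<inter> W))) (W - (C' \<inter> W))) (?H (subtopology ?Y ?S) W)"
  proof (rule homology_excision_axiom)
    have eq: "C' \<inter> W = ?S \<inter> C'" using C W by (auto simp: disjnt_def)
    have cl: "closedin ?Y (C' \<inter> W)" unfolding eq using clC(2) by (intro closedin_subtopology_Int_closed)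
    have "openin ?Y (C' \<inter> W)" unfolding eq using C(2) by (intro openin_subtopology_Int2)
    then have "C' \<inter> W \<subseteq> ?Y interior_of W" by (intro interior_of_maximal) auto
    then show "?Y closure_of (C' \<inter> W) \<subseteq> ?Y interior_of W" using cl by (simp add: closure_of_closedin)
  qed auto
  have s1: "?S - (C' \<inter> W) = C" "W - (C' \<inter> W) = C \<inter> W" using C W by (auto simp: disjnt_def)
  have s2: "subtopology ?Y C = subtopology X C" "subtopology ?Y ?S = ?Y"
    by (simp_all add: subtopology_subtopology Int_absorb1)
  have e2': "hom_induced p (subtopology X C) (C \<inter> W) ?Y W id ` carrier (?H (subtopology X C) (C \<inter> W)) = carrier (?H ?Y W)"
    using e2 by (simp add: s1 s2 iso_iff)
  have ex: "hom_induced p ?Y W X W id ` carrier (?H ?Y W)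
      = kernel (?H X W) (?H X ?S) (hom_induced p X W X ?S id)"
    using homology_exactness_triple_3[of W ?S p X] by simp
  interpret j: group_hom "?H X W" "?H X ?S" "hom_induced p X W X ?S id"
    by (simp add: group_hom_def group_hom_axioms_def hom_induced_hom)
  have "hom_induced p X W X ?S id z \<in> carrier (?H X ?S)" using z by simp
  then obtain u where u: "hom_induced p X W X ?S id z = hom_induced p (subtopology X C') (C' \<inter> W) X ?S id u"
    "u \<in> carrier (?H (subtopology X C') (C' \<inter> W))"
    unfolding e1'[symmetric] by (rule imageE)
  define b where "b = hom_induced p (subtopology X C') (C' \<inter> W) X W id u"
  have bc: "b \<in> carrier (?H X W)" by (simp add: b_def hom_induced_carrier)
  have "hom_induced p X W X ?S id b = hom_induced p (subtopology X C') (C' \<inter> W) X ?S (id \<circ> id) u"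
    unfolding b_def by (rule hom_induced_compose') auto
  then have jb: "hom_induced p X W X ?S id b = hom_induced p X W X ?S id z" using u by simp
  define a where "a = z \<otimes>\<^bsub>?H X W\<^esub> inv\<^bsub>?H X W\<^esub> b"
  have "a \<in> kernel (?H X W) (?H X ?S) (hom_induced p X W X ?S id)"
    using z bc jb by (simp add: kernel_def a_def)
  then obtain y where y: "a = hom_induced p ?Y W X W id y" "y \<in> carrier (?H ?Y W)"
    unfolding ex[symmetric] by (rule imageE)
  from y(2) obtain x where x: "y = hom_induced p (subtopology X C) (C \<inter> W) ?Y W id x"
    "x \<in> carrier (?H (subtopology X C) (C \<inter> W))"
    unfolding e2'[symmetric] by (rule imageE)
  have "a = hom_induced p (subtopology X C) (C \<inter> W) X W (id \<circ> id) x"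
    unfolding y(1) x(1)
  proof (rule hom_induced_compose')
    show "continuous_map (subtopology X C) ?Y id"
      by (auto simp: continuous_map_in_subtopology)
  qed auto
  then have a: "a = hom_induced p (subtopology X C) (C \<inter> W) X W id x" by simp
  have "z = a \<otimes>\<^bsub>?H X W\<^esub> b" using z bc by (simp add: a_def j.G.m_assoc)
  with a x(2) u(2) show thesis by (intro that) (auto simp: b_def)
qed

lemma relative_homology_generated_by_open_pieces:
  assumes "finite I" "\<And>i. i \<in> I \<Longrightarrow> openin X (C i)" "\<And>i j. i \<in> I \<Longrightarrow> j \<in> I \<Longrightarrow> i \<noteq> j \<Longrightarrow> disjnt (C i) (C j)"
    "(\<Union>i\<in>I. C i) = topspace X" "W \<subseteq> topspace X"
  shows "carrier (relative_homology_group p X W) \<subseteq> generate (relative_homology_group p X W)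
    (\<Union>i\<in>I. hom_induced p (subtopology X (C i)) (C i \<inter> W) X W id
       ` carrier (relative_homology_group p (subtopology X (C i)) (C i \<inter> W)))"
  using assms
proof (induction I arbitrary: X W rule: finite_induct)
  case empty
  then have "trivial_group (relative_homology_group p X W)"
    by (intro trivial_relative_homology_group_empty) auto
  then show ?case by (auto simp: trivial_group_def generate.one)
next
  case (insert k I)
  let ?H = "\<lambda>X W. relative_homology_group p X W"
  let ?D = "\<Union>i\<in>I. C i"
  let ?gen = "\<lambda>i. hom_induced p (subtopology X (C i)) (C i \<inter> W) X W id ` carrier (?H (subtopology X (C i)) (C i \<inter> W))"
  let ?Y = "subtopology X ?D"
  have o: "openin X (C k)" "openin X ?D" using insert.prems(1) by auto
  have d: "disjnt (C k) ?D" using insert.hyps(2) insert.prems(2) by (auto simp: disjnt_def)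
  have un: "C k \<union> ?D = topspace X" using insert.prems(3) by auto
  have IH: "carrier (?H ?Y (?D \<inter> W)) \<subseteq> generate (?H ?Y (?D \<inter> W))
    (\<Union>i\<in>I. hom_induced p (subtopology ?Y (C i)) (C i \<inter> (?D \<inter> W)) ?Y (?D \<inter> W) id
       ` carrier (?H (subtopology ?Y (C i)) (C i \<inter> (?D \<inter> W))))"
  proof (rule insert.IH)
    show "openin ?Y (C i)" if "i \<in> I" for i
      using that insert.prems(1) by (auto simp: openin_open_subtopology o(2))
    show "disjnt (C i) (C j)" if "i \<in> I" "j \<in> I" "i \<noteq> j" for i j
      using that insert.prems(2) by blast
    show "\<Union> (C ` I) = topspace ?Y" using openin_subset[OF o(2)] by auto
    show "?D \<inter> W \<subseteq> topspace ?Y" using insert.prems(4) by auto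
  qed
  show ?case
  proof
    fix z assume "z \<in> carrier (?H X W)"
    from relative_homology_clopen_split[OF o d un insert.prems(4) this]
    obtain a b where a: "a \<in> ?gen k"
      and b: "b \<in> hom_induced p ?Y (?D \<inter> W) X W id ` carrier (?H ?Y (?D \<inter> W))"
      and z: "z = a \<otimes>\<^bsub>?H X W\<^esub> b" by metis
    have ag: "a \<in> generate (?H X W) (\<Union>i\<in>insert k I. ?gen i)"
      using a by (intro generate.incl) blast
    from b obtain u where u: "u \<in> carrier (?H ?Y (?D \<inter> W))" "b = hom_induced p ?Y (?D \<inter> W) X W id u" by blast
    let ?f = "hom_induced p ?Y (?D \<inter> W) X W id"
    let ?g = "\<lambda>i. hom_induced p (subtopology ?Y (C i)) (C i \<inter> (?D \<inter> W)) ?Y (?D \<inter> W) id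
       ` carrier (?H (subtopology ?Y (C i)) (C i \<inter> (?D \<inter> W)))"
    have b1: "b \<in> generate (?H X W) (?f ` (\<Union>i\<in>I. ?g i))"
      unfolding u(2)
    proof (rule generate_hom_image)
      show "u \<in> generate (?H ?Y (?D \<inter> W)) (\<Union>i\<in>I. ?g i)" using IH u(1) by blast
    qed (auto simp: hom_induced_hom hom_induced_carrier)
    have b2: "?f ` ?g i \<subseteq> ?gen i" if i: "i \<in> I" for i
    proof -
      have s: "subtopology ?Y (C i) = subtopology X (C i)" "C i \<inter> (?D \<inter> W) = C i \<inter> W"
        using i by (auto simp: subtopology_subtopology intro: arg_cong[where f = "subtopology X"])
      have "?f (hom_induced p (subtopology X (C i)) (C i \<inter> W) ?Y (?D \<inter> W) id x)
          = hom_induced p (subtopology X (C i)) (C i \<inter> W) X W (id \<circ> id) x" for x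
      proof (rule hom_induced_compose')
        show "continuous_map (subtopology X (C i)) ?Y id"
          using i by (auto simp: continuous_map_in_subtopology)
        show "id \<in> C i \<inter> W \<rightarrow> ?D \<inter> W" using i by auto
      qed auto
      then show ?thesis unfolding s by auto
    qed
    have "?f ` (\<Union>i\<in>I. ?g i) \<subseteq> (\<Union>i\<in>insert k I. ?gen i)"
      unfolding image_UN by (rule UN_mono[OF subset_insertI b2])
    from subsetD[OF group.mono_generate[OF group_relative_homology_group this] b1]
    have bg: "b \<in> generate (?H X W) (\<Union>i\<in>insert k I. ?gen i)" .
    show "z \<in> generate (?H X W) (\<Union>i\<in>insert k I. ?gen i)"
      unfolding z using ag bg by (rule generate.eng)
  qed
qed

section \<open>Homology of spheres and of cubes modulo their boundary\<close>

lemma noetherian_homology_point: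
  assumes "topspace X = {a}" shows "noetherian_group (homology_group p X)"
proof (rule noetherian_group_cyclic)
  show "cyclic_group (homology_group p X)"
  proof (cases "p = 0")
    case True
    then have "homology_group p X \<cong> integer_group" using homology_coefficients[OF assms] by simp
    then show ?thesis by (simp add: isomorphic_group_cyclicity)
  next
    case False
    then show ?thesis using homology_dimension_axiom[OF assms] trivial_imp_cyclic_group by blast
  qed
qed simp

lemma noetherian_homology_nsphere: "noetherian_group (homology_group p (nsphere n))"
proof (rule noetherian_group_extension)
  let ?h = "hom_induced p (nsphere n) {} (discrete_topology {()}) {} (\<lambda>x. ())"
  show "?h \<in> hom (homology_group p (nsphere n)) (homology_group p (discrete_topology {()}))"
    by (simp add: hom_induced_hom)
  show "id \<in> hom (reduced_homology_group p (nsphere n)) (homology_group p (nsphere n))"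
  proof (rule homI)
    fix x y assume "x \<in> carrier (reduced_homology_group p (nsphere n))"
    then show "id x \<in> carrier (homology_group p (nsphere n))"
      using subsetD[OF carrier_reduced_homology_group_subset] by simp
    show "id (x \<otimes>\<^bsub>reduced_homology_group p (nsphere n)\<^esub> y) = id x \<otimes>\<^bsub>homology_group p (nsphere n)\<^esub> id y"
      by (simp add: reduced_homology_group_def)
  qed
  show "noetherian_group (reduced_homology_group p (nsphere n))"
    by (intro noetherian_group_cyclic cyclic_reduced_homology_group_nsphere) simp
  show "noetherian_group (homology_group p (discrete_topology {()}))"
    by (rule noetherian_homology_point) simp
  show "x \<in> id ` carrier (reduced_homology_group p (nsphere n))"
    if "x \<in> carrier (homology_group p (nsphere n))" "?h x = \<one>\<^bsub>homology_group p (discrete_topology {()})\<^esub>" for x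
    using that by (simp add: carrier_reduced_homology_group kernel_def)
qed simp

text \<open>
  A map with a left inverse up to homotopy is injective on homology.
\<close>

lemma noetherian_homology_section:
  assumes f: "continuous_map X Y f" and g: "continuous_map Y X g"
    and gf: "homotopic_with (\<lambda>_. True) X X (g \<circ> f) id" and Y: "noetherian_group (homology_group p Y)"
  shows "noetherian_group (homology_group p X)"
proof (rule noetherian_group_inj[OF _ _ _ Y])
  show "hom_induced p X {} Y {} f \<in> hom (homology_group p X) (homology_group p Y)"
    by (simp add: hom_induced_hom)
  show "inj_on (hom_induced p X {} Y {} f) (carrier (homology_group p X))"
  proof (rule inj_on_inverseI[where g = "hom_induced p Y {} X {} g"])
    fix x assume "x \<in> carrier (homology_group p X)"
    moreover have "hom_induced p Y {} X {} g (hom_induced p X {} Y {} f x) = hom_induced p X {} X {} (g \<circ> f) x"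
      by (rule hom_induced_compose') (use f g in auto)
    ultimately show "hom_induced p Y {} X {} g (hom_induced p X {} Y {} f x) = x"
      by (simp add: homology_homotopy_empty[OF gf] hom_induced_id)
  qed
qed simp

lemma continuous_map_Max_insert_0:
  assumes "finite I" "\<And>i. i \<in> I \<Longrightarrow> continuous_map X euclideanreal (f i)"
  shows "continuous_map X euclideanreal (\<lambda>x. Max (insert 0 ((\<lambda>i. f i x) ` I)))"
  using assms
proof (induction I rule: finite_induct)
  case (insert k I)
  have "Max (insert 0 ((\<lambda>i. f i x) ` insert k I)) = max (f k x) (Max (insert 0 ((\<lambda>i. f i x) ` I)))" for x
    using insert.hyps(1) by (simp add: insert_commute[of 0])
  then show ?case using insert by (simp add: continuous_map_real_max)
qed simp

definition cube :: "'d set \<Rightarrow> ('d \<Rightarrow> real) topology" where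
  "cube D = product_topology (\<lambda>_. top_of_set {0..1}) D"

definition cube_boundary :: "'d set \<Rightarrow> ('d \<Rightarrow> real) set" where
  "cube_boundary D = {t \<in> topspace (cube D). \<exists>d\<in>D. t d = 0 \<or> t d = 1}"

lemma topspace_cube: "topspace (cube D) = D \<rightarrow>\<^sub>E {0..1}" by (simp add: cube_def)

lemma cube_projection: "d \<in> D \<Longrightarrow> continuous_map (cube D) euclideanreal (\<lambda>t. t d)"
proof -
  assume "d \<in> D"
  then have "continuous_map (cube D) (top_of_set {0..1}) (\<lambda>t. t d)"
    unfolding cube_def by (rule continuous_map_product_projection)
  then show ?thesis by (rule continuous_map_into_fulltopology)
qed

lemma continuous_map_into_cube:
  assumes "\<And>d. d \<in> D \<Longrightarrow> continuous_map X euclideanreal (\<lambda>x. f x d)"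
    and "\<And>x. x \<in> topspace X \<Longrightarrow> f x \<in> topspace (cube D)"
  shows "continuous_map X (cube D) f"
  unfolding cube_def continuous_map_componentwise
  using assms by (auto simp: topspace_cube continuous_map_in_subtopology PiE_def Pi_def)

lemma noetherian_homology_cube: "noetherian_group (homology_group p (cube D))"
proof (rule noetherian_homology_section)
  \<comment> \<open>Contract the cube to the vertex with all coordinates 0 by scaling.\<close>
  let ?z = "\<lambda>d. if d \<in> D then 0 else undefined :: real"
  let ?h = "\<lambda>(s, t). \<lambda>d. if d \<in> D then s * t d else undefined :: real"
  show "continuous_map (cube D) (discrete_topology {()}) (\<lambda>_. ())" by simp
  show "continuous_map (discrete_topology {()}) (cube D) (\<lambda>_. ?z)"
    by (simp add: topspace_cube PiE_def extensional_def)
  have "continuous_map (prod_topology (top_of_set {0..1}) (cube D)) (cube D) ?h"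
  proof (rule continuous_map_into_cube)
    fix d assume d: "d \<in> D"
    have 1: "continuous_map (prod_topology (top_of_set {0..1}) (cube D)) euclideanreal fst"
      by (rule continuous_map_into_fulltopology[OF continuous_map_fst])
    have 2: "continuous_map (prod_topology (top_of_set {0..1}) (cube D)) euclideanreal (\<lambda>p. snd p d)"
      using continuous_map_compose[OF continuous_map_snd cube_projection[OF d]] by (simp add: o_def)
    show "continuous_map (prod_topology (top_of_set {0..1}) (cube D)) euclideanreal (\<lambda>p. ?h p d)"
      using continuous_map_real_mult[OF 1 2] d by (simp add: case_prod_beta)
  next
    fix p :: "real \<times> ('a \<Rightarrow> real)"
    assume "p \<in> topspace (prod_topology (top_of_set {0..1}) (cube D))"
    then show "?h p \<in> topspace (cube D)"
      by (auto simp: topspace_cube PiE_def Pi_def extensional_def mult_le_one)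
  qed
  then show "homotopic_with (\<lambda>_. True) (cube D) (cube D) ((\<lambda>_. ?z) \<circ> (\<lambda>_. ())) id"
    by (subst homotopic_with)
       (auto intro!: exI[of _ ?h] simp: topspace_cube PiE_def extensional_def fun_eq_iff)
  show "noetherian_group (homology_group p (discrete_topology {()}))"
    by (rule noetherian_homology_point) simp
qed

text \<open>
  Radial projection from the centre of the cube: the boundary of the cube is a retract of the
  sphere whose dimension is one less than that of the cube (with \<open>\<beta>\<close> numbering
  the coordinates); a point has empty boundary.
\<close>

lemma noetherian_homology_cube_boundary:
  assumes D: "finite D"
  shows "noetherian_group (homology_group p (subtopology (cube D) (cube_boundary D)))"
proof (cases "D = {}")
  case True
  then have "topspace (subtopology (cube D) (cube_boundary D)) = {}" by (auto simp: cube_boundary_def)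
  then show ?thesis
    by (intro noetherian_group_cyclic trivial_imp_cyclic_group trivial_homology_group_empty) simp_all
next
  case False
  obtain m where m: "card D = Suc m" using False D by (metis card_0_eq not0_implies_Suc)
  obtain \<beta> where \<beta>: "bij_betw \<beta> {..<Suc m} D" using ex_bij_betw_nat_finite[OF D] m by (auto simp: atLeast0LessThan)
  define \<gamma> where "\<gamma> = inv_into {..<Suc m} \<beta>"
  have \<gamma>: "\<gamma> d \<le> m" "\<beta> (\<gamma> d) = d" if "d \<in> D" for d
    using \<beta> that bij_betw_inv_into_right[OF \<beta>] bij_betw_apply[OF bij_betw_inv_into[OF \<beta>]]
    by (auto simp: \<gamma>_def less_Suc_eq_le)
  have \<beta>D: "\<beta> i \<in> D" if "i \<le> m" for i using \<beta> that by (auto simp: bij_betw_def)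
  have \<gamma>\<beta>: "\<gamma> (\<beta> i) = i" if "i \<le> m" for i
    using bij_betw_inv_into_left[OF \<beta>] that by (simp add: \<gamma>_def less_Suc_eq_le)
  let ?X = "subtopology (cube D) (cube_boundary D)"
  have proj: "continuous_map ?X euclideanreal (\<lambda>t. t d)" if "d \<in> D" for d
    by (rule continuous_map_from_subtopology[OF cube_projection[OF that]])
  \<comment> \<open>\<open>a\<close> normalizes to Euclidean length one, and \<open>b\<close>
  normalizes to maximum norm one, in the coordinates centred at the centre of the cube.\<close>
  define N where "N = (\<lambda>t :: 'a \<Rightarrow> real. sqrt (\<Sum>i\<le>m. (2 * t (\<beta> i) - 1)\<^sup>2))"
  define a where "a = (\<lambda>t i. if i \<le> m then (2 * t (\<beta> i) - 1) / N t else 0)"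
  define M where "M = (\<lambda>y :: nat \<Rightarrow> real. Max (insert 0 ((\<lambda>i. \<bar>y i\<bar>) ` {..m})))"
  define b where "b = (\<lambda>y. \<lambda>d\<in>D. 1/2 + y (\<gamma> d) / (2 * M y))"
  have Npos: "0 < N t" if t: "t \<in> topspace ?X" for t
  proof -
    obtain d where d: "d \<in> D" "t d = 0 \<or> t d = 1" using t by (auto simp: cube_boundary_def)
    have "0 < (2 * t (\<beta> (\<gamma> d)) - 1)\<^sup>2" using d \<gamma>(2)[OF d(1)] by auto
    also have "\<dots> \<le> (\<Sum>i\<le>m. (2 * t (\<beta> i) - 1)\<^sup>2)"
      using \<gamma>(1)[OF d(1)] by (intro member_le_sum) auto
    finally show ?thesis by (simp add: N_def)
  qed
  have Mge: "\<bar>y i\<bar> \<le> M y" if "i \<le> m" for y i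
    unfolding M_def using that by (intro Max_ge) auto
  have Meq: "M y = c" if "\<And>i. i \<le> m \<Longrightarrow> \<bar>y i\<bar> \<le> c" "i0 \<le> m" "\<bar>y i0\<bar> = c" for y c i0
    unfolding M_def using that by (intro Max_eqI) (auto intro: order_trans[OF abs_ge_zero])
  have Matt: "\<exists>i\<le>m. M y = \<bar>y i\<bar>" for y
  proof -
    have "M y \<in> insert 0 ((\<lambda>i. \<bar>y i\<bar>) ` {..m})" unfolding M_def by (intro Max_in) auto
    moreover have "M y = \<bar>y 0\<bar>" if "M y = 0" using Mge[of 0 y] that by simp
    ultimately show ?thesis by auto
  qed
  have Mpos: "0 < M y" if "y \<in> topspace (nsphere m)" for y
  proof (rule ccontr)
    assume "\<not> 0 < M y"
    then have "y i = 0" if "i \<le> m" for i using Mge[OF that, of y] by auto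
    then show False using that by (simp add: nsphere)
  qed
  have contN: "continuous_map ?X euclideanreal N"
  proof -
    have c1: "continuous_map ?X euclideanreal (\<lambda>t. \<Sum>i\<le>m. (2 * t (\<beta> i) - 1)\<^sup>2)"
      using proj[OF \<beta>D] by (intro continuous_map_sum continuous_map_real_pow continuous_map_diff
          continuous_map_real_mult_left) auto
    have c2: "continuous_map euclideanreal euclideanreal sqrt"
      by (simp add: continuous_on_real_sqrt)
    show ?thesis
      using continuous_map_compose[OF c1 c2] by (simp only: N_def o_def)
  qed
  have conta: "continuous_map ?X (nsphere m) a"
    unfolding nsphere continuous_map_in_subtopology
  proof (intro conjI)
    show "continuous_map ?X (powertop_real UNIV) a"
      unfolding continuous_map_componentwise_UNIV
    proof
      fix i
      show "continuous_map ?X euclideanreal (\<lambda>t. a t i)"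
      proof (cases "i \<le> m")
        case True
        have "continuous_map ?X euclideanreal (\<lambda>t. (2 * t (\<beta> i) - 1) / N t)"
          using proj[OF \<beta>D[OF True]] Npos
          by (intro continuous_map_real_divide continuous_map_diff continuous_map_real_mult_left contN) fastforce+
        then show ?thesis using True by (simp add: a_def)
      qed (simp add: a_def)
    qed
    have "(\<Sum>i\<le>m. (a t i)\<^sup>2) = 1" if t: "t \<in> topspace ?X" for t
    proof -
      have "(\<Sum>i\<le>m. (a t i)\<^sup>2) = (\<Sum>i\<le>m. (2 * t (\<beta> i) - 1)\<^sup>2 / (N t)\<^sup>2)"
        by (intro sum.cong) (simp_all add: a_def power_divide)
      also have "\<dots> = (N t)\<^sup>2 / (N t)\<^sup>2" by (simp add: N_def sum_nonneg flip: sum_divide_distrib)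
      finally show ?thesis using Npos[OF t] by simp
    qed
    then show "a \<in> topspace ?X \<rightarrow> {x. (\<Sum>i\<le>m. (x i)\<^sup>2) = 1 \<and> (\<forall>i>m. x i = 0)}"
      by (auto simp: a_def)
  qed
  have contM: "continuous_map (nsphere m) euclideanreal M"
    unfolding M_def
    by (intro continuous_map_Max_insert_0 continuous_map_real_abs continuous_map_nsphere_projection) auto
  have bcube: "b y \<in> cube_boundary D" if y: "y \<in> topspace (nsphere m)" for y
  proof -
    have "1/2 + y (\<gamma> d) / (2 * M y) \<in> {0..1}" if d: "d \<in> D" for d
      using Mge[OF \<gamma>(1)[OF d], of y] Mpos[OF y] by (auto simp: field_simps abs_le_iff)
    then have "b y \<in> topspace (cube D)" by (auto simp: b_def topspace_cube)
    moreover obtain i where i: "i \<le> m" "M y = \<bar>y i\<bar>" using Matt by blast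
    then have "b y (\<beta> i) = 0 \<or> b y (\<beta> i) = 1"
      using \<beta>D[OF i(1)] \<gamma>\<beta>[OF i(1)] Mpos[OF y] by (cases "y i > 0") (auto simp: b_def field_simps)
    ultimately show ?thesis using \<beta>D[OF i(1)] by (auto simp: cube_boundary_def)
  qed
  have contb: "continuous_map (nsphere m) ?X b"
    unfolding continuous_map_in_subtopology
  proof (intro conjI continuous_map_into_cube)
    fix d assume d: "d \<in> D"
    have "continuous_map (nsphere m) euclideanreal (\<lambda>y. 1/2 + y (\<gamma> d) / (2 * M y))"
      using Mpos by (intro continuous_map_add continuous_map_real_divide continuous_map_real_mult_left
          contM continuous_map_nsphere_projection) force+
    then show "continuous_map (nsphere m) euclideanreal (\<lambda>y. b y d)" using d by (simp add: b_def)
  qed (use bcube in \<open>auto simp: cube_boundary_def\<close>)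
  have ba: "b (a t) = t" if t: "t \<in> topspace ?X" for t
  proof -
    obtain d0 where d0: "d0 \<in> D" "t d0 = 0 \<or> t d0 = 1" using t by (auto simp: cube_boundary_def)
    have tr: "t \<in> D \<rightarrow>\<^sub>E {0..1}" using t by (auto simp: cube_boundary_def topspace_cube)
    have "M (a t) = 1 / N t"
    proof (rule Meq)
      show "\<gamma> d0 \<le> m" using \<gamma> d0 by simp
      show "\<bar>a t (\<gamma> d0)\<bar> = 1 / N t" using \<gamma>[OF d0(1)] d0 Npos[OF t] by (auto simp: a_def)
      show "\<bar>a t i\<bar> \<le> 1 / N t" if "i \<le> m" for i
      proof -
        have "t (\<beta> i) \<in> {0..1}" using tr \<beta>D[OF that] by auto
        then have "\<bar>2 * t (\<beta> i) - 1\<bar> \<le> 1" by auto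
        then show ?thesis using that Npos[OF t] by (simp add: a_def divide_right_mono)
      qed
    qed
    then show ?thesis
      using tr \<gamma> Npos[OF t] by (auto simp: b_def a_def fun_eq_iff PiE_def extensional_def field_simps)
  qed
  have "homotopic_with (\<lambda>_. True) ?X ?X (b \<circ> a) id"
    by (rule homotopic_with_equal) (use ba continuous_map_compose[OF conta contb] in auto)
  from noetherian_homology_section[OF conta contb this noetherian_homology_nsphere] show ?thesis .
qed

text \<open>
  By the exact sequence of the pair, since the cube is contractible. This group will play the role
  of the coefficients of a cell.
\<close>

lemma noetherian_homology_cube_mod_boundary:
  assumes "finite D"
  shows "noetherian_group (relative_homology_group p (cube D) (cube_boundary D))"
proof (rule noetherian_group_extension)
  let ?X = "cube D" and ?S = "cube_boundary D"
  show "hom_induced p ?X {} ?X ?S id \<in> hom (homology_group p ?X) (relative_homology_group p ?X ?S)"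
    by (simp add: hom_induced_hom)
  show "hom_boundary p ?X ?S \<in> hom (relative_homology_group p ?X ?S) (homology_group (p - 1) (subtopology ?X ?S))"
    by (simp add: hom_boundary_hom)
  show "x \<in> hom_induced p ?X {} ?X ?S id ` carrier (homology_group p ?X)"
    if "x \<in> carrier (relative_homology_group p ?X ?S)"
      "hom_boundary p ?X ?S x = \<one>\<^bsub>homology_group (p - 1) (subtopology ?X ?S)\<^esub>" for x
  proof -
    have "hom_induced p ?X {} ?X ?S id ` carrier (homology_group p ?X)
        = kernel (relative_homology_group p ?X ?S) (homology_group (p - 1) (subtopology ?X ?S)) (hom_boundary p ?X ?S)"
      using homology_exactness_axiom_1[of p ?X ?S] by simp
    then show ?thesis using that by (simp add: kernel_def)
  qed
  show "noetherian_group (homology_group (p - 1) (subtopology ?X ?S))"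
    by (rule noetherian_homology_cube_boundary[OF assms])
qed (simp_all add: noetherian_homology_cube)

context finite_graph begin

section \<open>Deforming configurations\<close>

abbreviation ambient :: "nat \<Rightarrow> (nat \<Rightarrow> 'a) topology" where
  "ambient n \<equiv> product_topology (\<lambda>_. G) {1..n}"

abbreviation conf_space :: "nat \<Rightarrow> (nat \<Rightarrow> 'a) set \<Rightarrow> (nat \<Rightarrow> 'a) topology" where
  "conf_space n S \<equiv> subtopology (ambient n) S"

definition push_conf :: "nat \<Rightarrow> ('a set \<Rightarrow> real) \<Rightarrow> (nat \<Rightarrow> 'a) \<Rightarrow> nat \<Rightarrow> 'a" where
  "push_conf n m x = (\<lambda>j\<in>{1..n}. push m (x j))"

lemma push_conf_cont:
  assumes m: "\<And>e. e \<in> E \<Longrightarrow> continuous_map Z euclideanreal (\<lambda>z. m z e)"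
    and range: "\<And>e z. e \<in> E \<Longrightarrow> z \<in> topspace Z \<Longrightarrow> 0 \<le> m z e \<and> m z e < 1/2"
  shows "continuous_map (prod_topology Z (ambient n)) (ambient n) (\<lambda>(z, x). push_conf n (m z) x)"
  unfolding continuous_map_componentwise
proof (intro conjI ballI)
  show "(\<lambda>(z, x). push_conf n (m z) x) ` topspace (prod_topology Z (ambient n)) \<subseteq> extensional {1..n}"
    by (auto simp: push_conf_def)
  fix k assume k: "k \<in> {1..n}"
  have "continuous_map (prod_topology Z (ambient n)) G (\<lambda>p. snd p k)"
    using continuous_map_compose[OF continuous_map_snd continuous_map_product_projection[OF k]]
    by (simp add: o_def)
  then have "continuous_map (prod_topology Z (ambient n)) (prod_topology Z G) (\<lambda>p. (fst p, snd p k))"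
    by (intro continuous_map_pairedI continuous_map_fst)
  from continuous_map_compose[OF this push_cont[OF m range]]
  have "continuous_map (prod_topology Z (ambient n)) G (\<lambda>p. push (m (fst p)) (snd p k))"
    by (simp add: o_def)
  then show "continuous_map (prod_topology Z (ambient n)) G (\<lambda>p. (case p of (z, x) \<Rightarrow> push_conf n (m z) x) k)"
    using k by (simp add: push_conf_def case_prod_beta)
qed

text \<open>
  The pushes by \<open>s * m x\<close>, for \<open>s\<close> from 0 to 1, form a homotopy that
  starts at the identity.
\<close>

lemma push_conf_homotopic:
  assumes X: "X \<subseteq> topspace (ambient n)" and S: "S \<subseteq> X"
    and m: "\<And>e. e \<in> E \<Longrightarrow> continuous_map (conf_space n X) euclideanreal (\<lambda>x. m x e)"
    and range: "\<And>e x. e \<in> E \<Longrightarrow> x \<in> X \<Longrightarrow> 0 \<le> m x e \<and> m x e < 1/2"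
    and stayX: "\<And>s x. 0 \<le> s \<Longrightarrow> s \<le> 1 \<Longrightarrow> x \<in> X \<Longrightarrow> push_conf n (\<lambda>e. s * m x e) x \<in> X"
    and stayS: "\<And>s x. 0 \<le> s \<Longrightarrow> s \<le> 1 \<Longrightarrow> x \<in> S \<Longrightarrow> push_conf n (\<lambda>e. s * m x e) x \<in> S"
  shows "homotopic_with (\<lambda>h. h \<in> S \<rightarrow> S) (conf_space n X) (conf_space n X)
           (\<lambda>x. push_conf n (m x) x) id"
proof -
  let ?I = "top_of_set {0..1::real}"
  let ?X = "conf_space n X"
  let ?Z = "prod_topology ?I ?X"
  let ?h = "\<lambda>(s, x). push_conf n (\<lambda>e. s * m x e) x"
  have topX: "topspace ?X = X" using X by auto
  have "continuous_map (prod_topology ?Z (ambient n)) (ambient n) (\<lambda>(z, x). push_conf n ((\<lambda>(s, y) e. s * m y e) z) x)"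
  proof (rule push_conf_cont)
    fix e assume e: "e \<in> E"
    have 1: "continuous_map ?Z euclideanreal fst"
      by (rule continuous_map_into_fulltopology[OF continuous_map_fst])
    have 2: "continuous_map ?Z euclideanreal (\<lambda>p. m (snd p) e)"
      using continuous_map_compose[OF continuous_map_snd m[OF e]] by (simp add: o_def)
    show "continuous_map ?Z euclideanreal (\<lambda>z. (\<lambda>(s, y) e. s * m y e) z e)"
      using continuous_map_real_mult[OF 1 2] by (simp add: case_prod_beta)
    fix z assume "z \<in> topspace ?Z"
    then obtain s y where z: "z = (s, y)" "0 \<le> s" "s \<le> 1" "y \<in> X" using topX by auto
    have "s * m y e \<le> 1 * m y e" using range[OF e z(4)] z by (intro mult_right_mono) auto
    then show "0 \<le> (\<lambda>(s, y) e. s * m y e) z e \<and> (\<lambda>(s, y) e. s * m y e) z e < 1/2"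
      using range[OF e z(4)] z by auto
  qed
  moreover have "continuous_map ?Z (prod_topology ?Z (ambient n)) (\<lambda>p. (p, snd p))"
    by (intro continuous_map_pairedI continuous_map_id[unfolded id_def]
        continuous_map_into_fulltopology[OF continuous_map_snd])
  ultimately have "continuous_map ?Z (ambient n)
      ((\<lambda>(z, x). push_conf n ((\<lambda>(s, y) e. s * m y e) z) x) \<circ> (\<lambda>p. (p, snd p)))"
    by (rule continuous_map_compose[rotated])
  then have "continuous_map ?Z (ambient n) ?h" by (simp add: o_def case_prod_unfold)
  then have cont: "continuous_map ?Z ?X ?h"
    unfolding continuous_map_in_subtopology using stayX topX by auto
  have id: "push_conf n (\<lambda>e. 0 * m x e) x = x" if x: "x \<in> X" for x
  proof
    fix j
    have xP: "x \<in> {1..n} \<rightarrow>\<^sub>E topspace G" using x X by auto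
    show "push_conf n (\<lambda>e. 0 * m x e) x j = x j"
    proof (cases "j \<in> {1..n}")
      case True
      then have "push (\<lambda>e. 0 * m x e) (x j) = x j" using PiE_mem[OF xP] by (intro push_0) auto
      then show ?thesis using True by (simp add: push_conf_def)
    next
      case False
      then show ?thesis using PiE_arb[OF xP False] by (simp add: push_conf_def del: atLeastAtMost_iff)
    qed
  qed
  have "homotopic_with (\<lambda>h. h \<in> S \<rightarrow> S) ?X ?X id (\<lambda>x. push_conf n (m x) x)"
  proof (subst homotopic_with)
    show "(h \<in> S \<rightarrow> S) = (k \<in> S \<rightarrow> S)" if hk: "\<And>x. x \<in> topspace ?X \<Longrightarrow> h x = k x" for h k
    proof (rule Pi_cong)
      fix x assume "x \<in> S"
      then have "x \<in> topspace ?X" unfolding topX using S by blast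
      then show "h x = k x" by (rule hk)
    qed
    show "\<exists>h. continuous_map ?Z ?X h \<and> (\<forall>x\<in>topspace ?X. h (0, x) = id x) \<and>
        (\<forall>x\<in>topspace ?X. h (1, x) = push_conf n (m x) x) \<and> (\<forall>t\<in>{0..1}. (\<lambda>x. h (t, x)) \<in> S \<rightarrow> S)"
      using cont stayS id topX by (intro exI[of _ ?h]) auto
  qed
  then show ?thesis by (rule homotopic_with_symD)
qed

text \<open>
  At most one point on every open edge. These configurations form a cubical complex: a cube is
  given by the cells (vertices or edges) of all points, where no edge is repeated.
\<close>

definition discrete_confs :: "nat \<Rightarrow> (nat \<Rightarrow> 'a) set" where
  "discrete_confs n = {x \<in> {1..n} \<rightarrow>\<^sub>E topspace G.
     \<forall>e\<in>E. \<forall>i\<in>{1..n}. \<forall>j\<in>{1..n}. x i \<in> e \<longrightarrow> x j \<in> e \<longrightarrow> i = j}"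

definition occupied :: "nat \<Rightarrow> (nat \<Rightarrow> 'a) \<Rightarrow> 'a set set" where
  "occupied n x = {e \<in> E. \<exists>j\<in>{1..n}. x j \<in> e}"

lemma discrete_confs_top: "discrete_confs n \<subseteq> topspace (ambient n)"
  by (auto simp: discrete_confs_def)

lemma conf_sink_eq: "conf_sink G V n = conf_space n (topspace (conf_sink G V n))"
  unfolding conf_sink_def topspace_subtopology subtopology_restrict ..

lemma conf_sink_top: "topspace (conf_sink G V n) \<subseteq> topspace (ambient n)"
  by (auto simp: conf_sink_def)

lemma conf_sinkD:
  assumes "x \<in> topspace (conf_sink G V n)" "i \<in> {1..n}" "j \<in> {1..n}" "i \<noteq> j" "x i = x j"
  shows "x j \<in> V"
  using assms by (auto simp: topspace_conf_sink simp del: atLeastAtMost_iff)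

lemma conf_sinkI:
  assumes "x \<in> {1..n} \<rightarrow>\<^sub>E topspace G"
    and "\<And>i j. i \<in> {1..n} \<Longrightarrow> j \<in> {1..n} \<Longrightarrow> i \<noteq> j \<Longrightarrow> x i = x j \<Longrightarrow> x j \<in> V"
  shows "x \<in> topspace (conf_sink G V n)"
  using assms by (auto simp: topspace_conf_sink simp del: atLeastAtMost_iff)

lemma discrete_confs_conf_sink: "discrete_confs n \<subseteq> topspace (conf_sink G V n)"
proof
  fix x assume x: "x \<in> discrete_confs n"
  then have xP: "x \<in> {1..n} \<rightarrow>\<^sub>E topspace G" by (simp add: discrete_confs_def)
  show "x \<in> topspace (conf_sink G V n)"
  proof (rule conf_sinkI[OF xP])
    fix i j assume ij: "i \<in> {1..n}" "j \<in> {1..n}" "i \<noteq> j" "x i = x j"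
    have "x j \<in> topspace G" using xP ij by auto
    then show "x j \<in> V"
    proof (cases rule: point_cases)
      case (2 e)
      then have "i = j" using x ij by (auto simp: discrete_confs_def simp del: atLeastAtMost_iff)
      then show ?thesis using ij by simp
    qed
  qed
qed

lemma depth_proj_cont:
  assumes "e \<in> E" "j \<in> {1..n}"
  shows "continuous_map (ambient n) euclideanreal (\<lambda>x. depth e (x j))"
  using continuous_map_compose[OF continuous_map_product_projection[OF assms(2)] depth_cont[OF assms(1)]]
  by (simp add: o_def)

text \<open>
  The second largest depth on \<open>e\<close> among the points of a configuration.
\<close>

definition second_depth :: "nat \<Rightarrow> (nat \<Rightarrow> 'a) \<Rightarrow> 'a set \<Rightarrow> real" where
  "second_depth n x e = Max (insert 0
     ((\<lambda>p. min (depth e (x (fst p))) (depth e (x (snd p)))) ` {p \<in> {1..n} \<times> {1..n}. fst p \<noteq> snd p}))"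

lemma second_depth_cont:
  assumes e: "e \<in> E" shows "continuous_map (ambient n) euclideanreal (\<lambda>x. second_depth n x e)"
  unfolding second_depth_def
proof (rule continuous_map_Max_insert_0)
  fix p assume "p \<in> {p \<in> {1..n} \<times> {1..n}. fst p \<noteq> snd p}"
  then have "fst p \<in> {1..n}" "snd p \<in> {1..n}" by auto
  then show "continuous_map (ambient n) euclideanreal (\<lambda>x. min (depth e (x (fst p))) (depth e (x (snd p))))"
    by (intro continuous_map_real_min depth_proj_cont[OF e])
qed simp

lemma second_depth_nonneg: "0 \<le> second_depth n x e"
  unfolding second_depth_def by (rule Max_ge) auto

lemma second_depth_ge:
  assumes "i \<in> {1..n}" "j \<in> {1..n}" "i \<noteq> j"
  shows "min (depth e (x i)) (depth e (x j)) \<le> second_depth n x e"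
  unfolding second_depth_def
proof (rule Max_ge)
  show "min (depth e (x i)) (depth e (x j)) \<in> insert 0
     ((\<lambda>p. min (depth e (x (fst p))) (depth e (x (snd p)))) ` {p \<in> {1..n} \<times> {1..n}. fst p \<noteq> snd p})"
    using assms by (intro insertI2 image_eqI[of _ _ "(i, j)"]) auto
qed simp

text \<open>
  Two points of the maximal depth 1/2 on an edge would collide at its midpoint.
\<close>

lemma second_depth_less:
  assumes x: "x \<in> topspace (conf_sink G V n)" and e: "e \<in> E"
  shows "second_depth n x e < 1/2"
proof -
  have "min (depth e (x i)) (depth e (x j)) < 1/2" if ij: "i \<in> {1..n}" "j \<in> {1..n}" "i \<noteq> j" for i j
  proof (rule ccontr)
    assume "\<not> ?thesis"
    then have d: "depth e (x i) = 1/2" "depth e (x j) = 1/2"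
      using depth_le_half[of e "x i"] depth_le_half[of e "x j"] by auto
    then have "x i = x j" by (rule depth_half_unique[OF e])
    then have "x j \<in> V" by (rule conf_sinkD[OF x ij])
    moreover have "x j \<in> e" using depth_pos_iff[OF e, of "x j"] d by simp
    ultimately show False using not_V[OF e] by blast
  qed
  then show ?thesis unfolding second_depth_def by (subst Max_less_iff) auto
qed

lemma push_conf_PiE:
  assumes "x \<in> {1..n} \<rightarrow>\<^sub>E topspace G" shows "push_conf n m x \<in> {1..n} \<rightarrow>\<^sub>E topspace G"
  using assms push_topspace by (auto simp: push_conf_def simp del: atLeastAtMost_iff)

lemma push_conf_conf_sink:
  assumes x: "x \<in> topspace (conf_sink G V n)" and m: "\<And>e. e \<in> E \<Longrightarrow> 0 \<le> m e \<and> m e < 1/2"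
  shows "push_conf n m x \<in> topspace (conf_sink G V n)"
proof (rule conf_sinkI)
  have xP: "x \<in> {1..n} \<rightarrow>\<^sub>E topspace G" using x by (simp add: topspace_conf_sink)
  then show "push_conf n m x \<in> {1..n} \<rightarrow>\<^sub>E topspace G" by (rule push_conf_PiE)
  fix i j assume ij: "i \<in> {1..n}" "j \<in> {1..n}" "i \<noteq> j" "push_conf n m x i = push_conf n m x j"
  have eq: "push m (x i) = push m (x j)" using ij by (simp add: push_conf_def)
  have top: "x i \<in> topspace G" "x j \<in> topspace G" using xP ij by auto
  show "push_conf n m x j \<in> V"
  proof (rule ccontr)
    assume nV: "push_conf n m x j \<notin> V"
    then have "push m (x i) \<notin> V" using ij eq by (simp add: push_conf_def)
    from push_inj[OF top m eq this] have "x i = x j" .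
    then have "x j \<in> V" by (rule conf_sinkD[OF x ij(1-3)])
    then show False using nV push_V[of "x j"] ij by (simp add: push_conf_def)
  qed
qed

text \<open>
  Of two points on an edge one has at most the second largest depth, so it is pushed to a vertex.
\<close>

lemma push_second_depth_discrete:
  assumes x: "x \<in> topspace (conf_sink G V n)"
  shows "push_conf n (second_depth n x) x \<in> discrete_confs n"
  unfolding discrete_confs_def
proof (intro CollectI conjI ballI impI)
  have xP: "x \<in> {1..n} \<rightarrow>\<^sub>E topspace G" using x by (simp add: topspace_conf_sink)
  then show "push_conf n (second_depth n x) x \<in> {1..n} \<rightarrow>\<^sub>E topspace G" by (rule push_conf_PiE)
  fix e i j assume e: "e \<in> E" and ij: "i \<in> {1..n}" "j \<in> {1..n}"
    and pe: "push_conf n (second_depth n x) x i \<in> e" "push_conf n (second_depth n x) x j \<in> e"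
  have top: "x i \<in> topspace G" "x j \<in> topspace G" using xP ij by auto
  have "second_depth n x e < depth e (x i)" "second_depth n x e < depth e (x j)"
    using push_mem_edge_iff[OF e top(1), of "second_depth n x"]
      push_mem_edge_iff[OF e top(2), of "second_depth n x"]
      second_depth_nonneg second_depth_less[OF x e] pe ij
    by (simp_all add: push_conf_def)
  then show "i = j" using second_depth_ge[OF ij, of e x] by (cases "i = j") auto
qed

text \<open>
  The push by the second largest depth is homotopic to the identity and has discrete
  configurations as values, so every homology class is carried by these.
\<close>

lemma conf_sink_homology_from_discrete:
  "carrier (homology_group p (conf_sink G V n)) \<subseteq>
     hom_induced p (conf_space n (discrete_confs n)) {} (conf_sink G V n) {} id
       ` carrier (homology_group p (conf_space n (discrete_confs n)))"
proof
  let ?C = "conf_sink G V n" and ?D = "conf_space n (discrete_confs n)"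
  let ?r = "\<lambda>x. push_conf n (second_depth n x) x"
  have "homotopic_with (\<lambda>h. h \<in> {} \<rightarrow> {}) (conf_space n (topspace ?C)) (conf_space n (topspace ?C)) ?r id"
  proof (rule push_conf_homotopic[OF conf_sink_top])
    show "continuous_map (conf_space n (topspace ?C)) euclideanreal (\<lambda>x. second_depth n x e)" if "e \<in> E" for e
      by (rule continuous_map_from_subtopology[OF second_depth_cont[OF that]])
    show "0 \<le> second_depth n x e \<and> second_depth n x e < 1/2" if "e \<in> E" "x \<in> topspace ?C" for e x
      using second_depth_nonneg second_depth_less that by simp
    fix s :: real and x assume s: "0 \<le> s" "s \<le> 1" and x: "x \<in> topspace ?C"
    show "push_conf n (\<lambda>e. s * second_depth n x e) x \<in> topspace ?C"
    proof (rule push_conf_conf_sink[OF x])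
      fix e assume e: "e \<in> E"
      have "s * second_depth n x e \<le> 1 * second_depth n x e"
        using s second_depth_nonneg by (intro mult_right_mono) auto
      then show "0 \<le> s * second_depth n x e \<and> s * second_depth n x e < 1/2"
        using s second_depth_nonneg[of n x e] second_depth_less[OF x e] by auto
    qed
  qed auto
  then have hom: "homotopic_with (\<lambda>h. h \<in> {} \<rightarrow> {}) ?C ?C ?r id"
    by (simp only: conf_sink_eq[symmetric])
  then have rC: "continuous_map ?C ?C ?r" by (rule homotopic_with_imp_continuous_maps[THEN conjunct1])
  have rP: "continuous_map ?C (ambient n) ?r"
    using rC[unfolded conf_sink_def] unfolding conf_sink_def by (rule continuous_map_into_fulltopology)
  have rD: "continuous_map ?C ?D ?r"
    unfolding continuous_map_in_subtopology using rP push_second_depth_discrete by blast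
  have "continuous_map ?D (conf_space n (topspace ?C)) id"
    unfolding continuous_map_in_subtopology using subsetD[OF discrete_confs_conf_sink] by simp
  then have iC: "continuous_map ?D ?C id" by (simp only: conf_sink_eq[symmetric])
  fix z assume z: "z \<in> carrier (homology_group p ?C)"
  have "z = hom_induced p ?C {} ?C {} id z" using z by (simp add: hom_induced_id)
  also have "\<dots> = hom_induced p ?C {} ?C {} ?r z" by (simp add: homology_homotopy_axiom[OF hom])
  also have "\<dots> = hom_induced p ?C {} ?C {} (id \<circ> ?r) z" by simp
  also have "\<dots> = hom_induced p ?D {} ?C {} id (hom_induced p ?C {} ?D {} ?r z)"
    by (rule hom_induced_compose'[symmetric]) (use rD iC in auto)
  finally show "z \<in> hom_induced p ?D {} ?C {} id ` carrier (homology_group p ?D)"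
    using hom_induced_carrier by blast
qed

section \<open>Inserting a point at a vertex\<close>

text \<open>
  The new point is placed at the vertex \<open>v\<close> and gets the number \<open>Suc k\<close>;
  the points up to \<open>k\<close> keep their numbers.
\<close>

definition insert_point :: "nat \<Rightarrow> nat \<Rightarrow> 'a \<Rightarrow> (nat \<Rightarrow> 'a) \<Rightarrow> nat \<Rightarrow> 'a" where
  "insert_point n k v x = (\<lambda>j\<in>{1..Suc n}. if j \<le> k then x j else if j = Suc k then v else x (j - 1))"

text \<open>
  The morphism \<open>[n] \<rightarrow> [n + 1]\<close> of the category that induces this map: an
  increasing injection which misses \<open>Suc k\<close> only.
\<close>

definition insert_hom :: "nat \<Rightarrow> nat \<Rightarrow> 'a \<Rightarrow> (nat \<Rightarrow> nat) \<times> (nat \<Rightarrow> 'a)" where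
  "insert_hom n k v = (\<lambda>j\<in>{1..n}. if j \<le> k then j else Suc j, \<lambda>j\<in>{Suc k}. v)"

lemma insert_hom_image:
  assumes "k \<le> n"
  shows "(\<lambda>j\<in>{1..n}. if j \<le> k then j else Suc j) ` {1..n} = {1..Suc n} - {Suc k}"
proof
  show "{1..Suc n} - {Suc k} \<subseteq> (\<lambda>j\<in>{1..n}. if j \<le> k then j else Suc j) ` {1..n}"
  proof
    fix j assume "j \<in> {1..Suc n} - {Suc k}"
    then show "j \<in> (\<lambda>j\<in>{1..n}. if j \<le> k then j else Suc j) ` {1..n}"
      using assms by (intro image_eqI[of _ _ "if j \<le> k then j else j - 1"]) auto
  qed
qed (use assms in auto)

lemma insert_hom_inj: "inj_on (\<lambda>j\<in>{1..n}. if j \<le> k then j else Suc j) {1..n}"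
  by (auto simp: inj_on_def split: if_splits)

lemma insert_hom_FIV:
  assumes "k \<le> n" "v \<in> V" shows "insert_hom n k v \<in> FIV_hom V n (Suc n)"
proof -
  have "{1..Suc n} - ({1..Suc n} - {Suc k}) = {Suc k}" using assms by auto
  moreover have "(\<lambda>j\<in>{1..n}. if j \<le> k then j else Suc j) \<in> {1..n} \<rightarrow>\<^sub>E {1..Suc n}" by auto
  moreover have "(\<lambda>j\<in>{Suc k}. v) \<in> {Suc k} \<rightarrow>\<^sub>E V" using assms(2) by auto
  ultimately show ?thesis
    unfolding FIV_hom_def insert_hom_def mem_Collect_eq case_prod_conv insert_hom_image[OF assms(1)]
    using insert_hom_inj[of k n] by simp
qed

lemma conf_map_insert_hom:
  assumes "k \<le> n" shows "conf_map n (Suc n) (insert_hom n k v) x = insert_point n k v x"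
proof
  fix j
  let ?f = "\<lambda>j\<in>{1..n}. if j \<le> k then j else Suc j"
  consider "j \<notin> {1..Suc n}" | "j = Suc k" | "j \<in> {1..Suc n}" "j \<noteq> Suc k" by blast
  then show "conf_map n (Suc n) (insert_hom n k v) x j = insert_point n k v x j"
  proof cases
    case 1
    then show ?thesis unfolding insert_hom_def conf_map_out[OF 1] by (simp add: insert_point_def del: atLeastAtMost_iff)
  next
    case 2
    then have "j \<in> {1..Suc n}" "j \<notin> ?f ` {1..n}" using insert_hom_image[OF assms] assms by auto
    then show ?thesis unfolding insert_hom_def conf_map_new[OF \<open>j \<in> {1..Suc n}\<close> \<open>j \<notin> ?f ` {1..n}\<close>]
      using 2 by (simp add: insert_point_def)
  next
    case 3
    define i where "i = (if j \<le> k then j else j - 1)"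
    have i: "i \<in> {1..n}" "j = ?f i" using 3 assms by (auto simp: i_def)
    have "?f i \<in> {1..Suc n}" using i(2) 3(1) by simp
    from conf_map_old[OF insert_hom_inj i(1) this, of "\<lambda>j\<in>{Suc k}. v" x]
    have "conf_map n (Suc n) (insert_hom n k v) x j = x i"
      unfolding insert_hom_def i(2)[symmetric] .
    then show ?thesis using 3 by (simp add: insert_point_def i_def)
  qed
qed

lemma insert_point_cont:
  assumes "k \<le> n" "v \<in> V" shows "continuous_map (ambient n) (ambient (Suc n)) (insert_point n k v)"
  unfolding continuous_map_componentwise
proof (intro conjI ballI)
  show "insert_point n k v ` topspace (ambient n) \<subseteq> extensional {1..Suc n}"
    by (auto simp: insert_point_def)
  fix j assume j: "j \<in> {1..Suc n}"
  consider "j \<le> k" | "j = Suc k" | "Suc k < j" by linarith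
  then show "continuous_map (ambient n) G (\<lambda>x. insert_point n k v x j)"
  proof cases
    case 1
    then have "j \<in> {1..n}" using j assms by auto
    from continuous_map_product_projection[OF this, of "\<lambda>_. G"] show ?thesis using 1 j by (simp add: insert_point_def)
  next
    case 2
    then show ?thesis using j assms V_sub by (auto simp: insert_point_def)
  next
    case 3
    then have "j - 1 \<in> {1..n}" using j by auto
    from continuous_map_product_projection[OF this, of "\<lambda>_. G"] show ?thesis using 3 j by (simp add: insert_point_def)
  qed
qed

lemma insert_point_mem_edge:
  assumes "e \<in> E" "v \<in> V" "j \<in> {1..Suc n}"
  shows "insert_point n k v x j \<in> e \<longleftrightarrow> j \<noteq> Suc k \<and> x (if j \<le> k then j else j - 1) \<in> e"
  using assms not_V[OF assms(1), of v] by (auto simp: insert_point_def)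

lemma insert_point_discrete:
  assumes x: "x \<in> discrete_confs n" and k: "k \<le> n" and v: "v \<in> V"
  shows "insert_point n k v x \<in> discrete_confs (Suc n)"
  unfolding discrete_confs_def
proof (intro CollectI conjI ballI impI)
  have "x \<in> topspace (ambient n)" using x discrete_confs_top by blast
  then show "insert_point n k v x \<in> {1..Suc n} \<rightarrow>\<^sub>E topspace G"
    using continuous_map_image_subset_topspace[OF insert_point_cont[OF k v]] by auto
  fix e i j assume e: "e \<in> E" and ij: "i \<in> {1..Suc n}" "j \<in> {1..Suc n}"
    and m: "insert_point n k v x i \<in> e" "insert_point n k v x j \<in> e"
  let ?g = "\<lambda>j. if j \<le> k then j else j - 1"
  have "i \<noteq> Suc k" "j \<noteq> Suc k" and xe: "x (?g i) \<in> e" "x (?g j) \<in> e"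
    using m insert_point_mem_edge[OF e v] ij by blast+
  moreover have "?g i \<in> {1..n}" "?g j \<in> {1..n}" using calculation(1,2) ij k by auto
  then have "?g i = ?g j" using x e xe unfolding discrete_confs_def by blast
  ultimately show "i = j" by (auto split: if_splits)
qed

lemma occupied_insert_point:
  assumes k: "k \<le> n" and v: "v \<in> V"
  shows "occupied (Suc n) (insert_point n k v x) = occupied n x"
proof
  show "occupied (Suc n) (insert_point n k v x) \<subseteq> occupied n x"
  proof
    fix e assume "e \<in> occupied (Suc n) (insert_point n k v x)"
    then obtain j where e: "e \<in> E" and j: "j \<in> {1..Suc n}" "insert_point n k v x j \<in> e"
      unfolding occupied_def by blast
    then have "j \<noteq> Suc k" "x (if j \<le> k then j else j - 1) \<in> e"
      using insert_point_mem_edge[OF e v j(1)] by blast+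
    moreover have "(if j \<le> k then j else j - 1) \<in> {1..n}" using calculation(1) j k by auto
    ultimately show "e \<in> occupied n x" unfolding occupied_def using e by blast
  qed
  show "occupied n x \<subseteq> occupied (Suc n) (insert_point n k v x)"
  proof
    fix e assume "e \<in> occupied n x"
    then obtain j where e: "e \<in> E" and j: "j \<in> {1..n}" "x j \<in> e"
      unfolding occupied_def by blast
    define i where "i = (if j \<le> k then j else Suc j)"
    have i: "i \<in> {1..Suc n}" "i \<noteq> Suc k" "(if i \<le> k then i else i - 1) = j" using j by (auto simp: i_def)
    then have "insert_point n k v x i \<in> e" using insert_point_mem_edge[OF e v i(1)] j(2) by simp
    then show "e \<in> occupied (Suc n) (insert_point n k v x)" unfolding occupied_def using e i(1) by blast
  qed
qed

lemma insert_point_conf_sink: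
  assumes "x \<in> topspace (conf_sink G V n)" "k \<le> n" "v \<in> V"
  shows "insert_point n k v x \<in> topspace (conf_sink G V (Suc n))"
  using continuous_map_image_subset_topspace[OF continuous_map_conf_map[OF V_sub insert_hom_FIV[OF assms(2,3)]]]
    conf_map_insert_hom[OF assms(2)] assms(1) by (auto simp: image_subset_iff)

section \<open>Homology systems\<close>

definition insertions :: "(nat \<times> nat \<times> nat \<times> 'a) set" where
  "insertions = {(n, Suc n, k, v) | n k v. k \<le> n \<and> v \<in> V}"

definition stable :: "(nat \<Rightarrow> (nat \<Rightarrow> 'a) set) \<Rightarrow> bool" where
  "stable S \<longleftrightarrow> (\<forall>n. S n \<subseteq> topspace (ambient n)) \<and>
     (\<forall>n k v x. k \<le> n \<longrightarrow> v \<in> V \<longrightarrow> x \<in> S n \<longrightarrow> insert_point n k v x \<in> S (Suc n))"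

definition homology_system :: "int \<Rightarrow> (nat \<Rightarrow> (nat \<Rightarrow> 'a) set) \<Rightarrow> (nat \<Rightarrow> (nat \<Rightarrow> 'a) set) \<Rightarrow> nat \<Rightarrow> (nat \<Rightarrow> 'a) chain set monoid" where
  "homology_system p X A n = relative_homology_group p (conf_space n (X n)) (A n)"

definition insertion_action :: "int \<Rightarrow> (nat \<Rightarrow> (nat \<Rightarrow> 'a) set) \<Rightarrow> (nat \<Rightarrow> (nat \<Rightarrow> 'a) set) \<Rightarrow> nat \<Rightarrow> nat \<Rightarrow> nat \<times> 'a
    \<Rightarrow> (nat \<Rightarrow> 'a) chain set \<Rightarrow> (nat \<Rightarrow> 'a) chain set" where
  "insertion_action p X A m n l = hom_induced p (conf_space m (X m)) (A m) (conf_space n (X n)) (A n)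
     (insert_point m (fst l) (snd l))"

lemma insertionsE:
  assumes "(i, j, l) \<in> insertions"
  obtains k v where "j = Suc i" "l = (k, v)" "k \<le> i" "v \<in> V"
  using assms unfolding insertions_def by auto

lemma stable_empty: "stable (\<lambda>_. {})" by (simp add: stable_def)

lemma stable_conf_sink: "stable (\<lambda>n. topspace (conf_sink G V n))"
  unfolding stable_def using conf_sink_top insert_point_conf_sink by blast

lemma stable_cont:
  assumes "stable S" "k \<le> n" "v \<in> V"
  shows "continuous_map (conf_space n (S n)) (conf_space (Suc n) (S (Suc n))) (insert_point n k v)"
  unfolding continuous_map_in_subtopology
  using continuous_map_from_subtopology[OF insert_point_cont[OF assms(2,3)]] assms
  by (auto simp: stable_def)

lemma stable_funcset:
  assumes "stable S" "k \<le> n" "v \<in> V" shows "insert_point n k v \<in> S n \<rightarrow> S (Suc n)"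
  using assms by (auto simp: stable_def)

lemma system_homology_system: "system (homology_system p X A) insertions (insertion_action p X A)"
  by (simp add: system_def homology_system_def insertion_action_def hom_induced_hom)

lemma system_hom_inclusion:
  assumes X: "stable X" and A: "stable A" and Y: "stable Y" and B: "stable B"
    and XY: "\<And>n. X n \<subseteq> Y n" and AB: "\<And>n. A n \<subseteq> B n"
  shows "system_hom (homology_system p X A) (insertion_action p X A) (homology_system p Y B) (insertion_action p Y B) insertions
    (\<lambda>n. hom_induced p (conf_space n (X n)) (A n) (conf_space n (Y n)) (B n) id)"
  unfolding system_hom_def
proof (intro conjI allI impI ballI)
  show "hom_induced p (conf_space n (X n)) (A n) (conf_space n (Y n)) (B n) id \<in> hom (homology_system p X A n) (homology_system p Y B n)" for n
    by (simp add: homology_system_def hom_induced_hom)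
  have inc: "continuous_map (conf_space n (X n)) (conf_space n (Y n)) id" for n
    unfolding continuous_map_in_subtopology using subsetD[OF XY] by simp
  have inc': "id \<in> A n \<rightarrow> B n" for n using subsetD[OF AB] by simp
  fix i j l x assume "(i, j, l) \<in> insertions"
  then obtain k v where l: "j = Suc i" "l = (k, v)" "k \<le> i" "v \<in> V" by (rule insertionsE)
  have "insertion_action p Y B i j l (hom_induced p (conf_space i (X i)) (A i) (conf_space i (Y i)) (B i) id x)
      = hom_induced p (conf_space i (X i)) (A i) (conf_space j (Y j)) (B j) (insert_point i k v \<circ> id) x"
    unfolding insertion_action_def l(1,2) fst_conv snd_conv
    by (rule hom_induced_compose'[OF inc inc' stable_cont[OF Y l(3,4)] stable_funcset[OF B l(3,4)]])
  moreover have "hom_induced p (conf_space j (X j)) (A j) (conf_space j (Y j)) (B j) id (insertion_action p X A i j l x)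
      = hom_induced p (conf_space i (X i)) (A i) (conf_space j (Y j)) (B j) (id \<circ> insert_point i k v) x"
    unfolding insertion_action_def l(1,2) fst_conv snd_conv
    by (rule hom_induced_compose'[OF stable_cont[OF X l(3,4)] stable_funcset[OF A l(3,4)] inc inc'])
  ultimately show "insertion_action p Y B i j l (hom_induced p (conf_space i (X i)) (A i) (conf_space i (Y i)) (B i) id x)
      = hom_induced p (conf_space j (X j)) (A j) (conf_space j (Y j)) (B j) id (insertion_action p X A i j l x)" by simp
qed

lemma noetherian_homology_extension:
  assumes X: "stable X" and A: "stable A" and AX: "\<And>n. A n \<subseteq> X n"
    and nA: "noetherian (homology_system p A (\<lambda>_. {})) insertions (insertion_action p A (\<lambda>_. {}))"
    and nXA: "noetherian (homology_system p X A) insertions (insertion_action p X A)"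
  shows "noetherian (homology_system p X (\<lambda>_. {})) insertions (insertion_action p X (\<lambda>_. {}))"
proof (rule noetherian_extension[OF system_homology_system system_homology_system system_homology_system
      system_hom_inclusion[OF A stable_empty X stable_empty AX]
      system_hom_inclusion[OF X stable_empty X A order_refl] _ nA nXA])
  fix n x assume x: "x \<in> carrier (homology_system p X (\<lambda>_. {}) n)"
    and 1: "hom_induced p (conf_space n (X n)) {} (conf_space n (X n)) (A n) id x = \<one>\<^bsub>homology_system p X A n\<^esub>"
  have s: "subtopology (conf_space n (X n)) (A n) = conf_space n (A n)"
    using AX[of n] by (simp add: subtopology_subtopology Int_absorb1)
  have "hom_induced p (conf_space n (A n)) {} (conf_space n (X n)) {} id ` carrier (homology_group p (conf_space n (A n)))
      = kernel (homology_group p (conf_space n (X n))) (relative_homology_group p (conf_space n (X n)) (A n))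
          (hom_induced p (conf_space n (X n)) {} (conf_space n (X n)) (A n) id)"
    using homology_exactness_axiom_3[of p "conf_space n (X n)" "A n"] unfolding s by simp
  then show "x \<in> hom_induced p (conf_space n (A n)) {} (conf_space n (X n)) {} id ` carrier (homology_system p A (\<lambda>_. {}) n)"
    using x 1 by (simp add: homology_system_def kernel_def)
qed auto

text \<open>
  Inserting a point at a vertex does not change the set of occupied edges, so any set of sets of
  edges cuts out a stable family of subspaces.
\<close>

definition strata :: "'a set set set \<Rightarrow> nat \<Rightarrow> (nat \<Rightarrow> 'a) set" where
  "strata \<F> n = {x \<in> discrete_confs n. occupied n x \<in> \<F>}"

lemma stable_strata: "stable (strata \<F>)"
  unfolding stable_def strata_def
  using discrete_confs_top insert_point_discrete occupied_insert_point by auto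

end

section \<open>Words\<close>

definition insert_letter :: "nat \<Rightarrow> 'b \<Rightarrow> 'b list \<Rightarrow> 'b list" where
  "insert_letter k a w = take k w @ a # drop k w"

lemma length_insert_letter: "k \<le> length w \<Longrightarrow> length (insert_letter k a w) = Suc (length w)"
  by (simp add: insert_letter_def)

lemma set_insert_letter: "set (insert_letter k a w) = insert a (set w)"
proof -
  have "set w = set (take k w) \<union> set (drop k w)" by (metis append_take_drop_id set_append)
  then show ?thesis by (simp add: insert_letter_def)
qed

lemma count_insert_letter: "count_list (insert_letter k a w) b = count_list w b + (if a = b then 1 else 0)"
proof -
  have "count_list w b = count_list (take k w) b + count_list (drop k w) b"
    by (metis append_take_drop_id count_list_append)
  then show ?thesis by (simp add: insert_letter_def)
qed

lemma nth_insert_letter: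
  assumes "k \<le> length w" "i \<le> length w"
  shows "insert_letter k a w ! i = (if i < k then w ! i else if i = k then a else w ! (i - 1))"
  using assms by (auto simp: insert_letter_def nth_append min_def nth_Cons')

lemma map_insert_letter: "map f (insert_letter k a w) = insert_letter k (f a) (map f w)"
  by (simp add: insert_letter_def take_map drop_map)

lemma insert_letter_Cons: "insert_letter (Suc k) a (b # w) = b # insert_letter k a w"
  by (simp add: insert_letter_def)

lemma insert_letter_less:
  fixes u w :: "nat list"
  assumes "length u = length w" "u < w"
  shows "insert_letter k a u < insert_letter k a w"
  using assms
proof (induction k arbitrary: u w)
  case 0
  then show ?case by (simp add: insert_letter_def)
next
  case (Suc k)
  then show ?case by (cases u; cases w) (auto simp: insert_letter_Cons)
qed

lemma count_list_one_iff: "count_list w a = 1 \<longleftrightarrow> (\<exists>!i. i < length w \<and> w ! i = a)"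
proof -
  have "count_list w a = card {i. i < length w \<and> w ! i = a}"
    by (simp add: count_list_eq_length_filter length_filter_conv_card eq_commute)
  also have "\<dots> = 1 \<longleftrightarrow> (\<exists>!i. i < length w \<and> w ! i = a)"
  proof -
    have "(\<exists>x. {i. P i} = {x}) \<longleftrightarrow> (\<exists>!i. P i)" for P :: "nat \<Rightarrow> bool"
      unfolding Ex1_def set_eq_iff mem_Collect_eq singleton_iff by metis
    then show ?thesis unfolding One_nat_def card_1_singleton_iff .
  qed
  finally show ?thesis .
qed

lemma subseq_count_le: "subseq u w \<Longrightarrow> count_list u a \<le> count_list w a"
  by (induction rule: list_emb.induct) auto

text \<open>
  If the letters outside \<open>A\<close> occur equally often in both words, then the letters
  missing from the subsequence all lie in \<open>A\<close>, and they can be inserted one after the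
  other.
\<close>

lemma insertions_of_subseq:
  assumes "subseq u w" "\<And>a. a \<notin> A \<Longrightarrow> count_list u a = count_list w a"
  shows "(u, w) \<in> {(x, insert_letter k a x) | k a x. k \<le> length x \<and> a \<in> A}\<^sup>*"
    (is "_ \<in> ?R\<^sup>*")
  using assms
proof (induction w arbitrary: u rule: list.induct)
  case Nil
  then have "u = []" using subseq_count_le[of u "[]"] by (cases u) (auto dest: list_emb_length)
  then show ?case by simp
next
  case (Cons b w)
  have cong: "(b # x, b # y) \<in> ?R\<^sup>*" if "(x, y) \<in> ?R\<^sup>*" for x y
    using that
  proof (induction rule: rtrancl_induct)
    case (step y z)
    then obtain k a where "z = insert_letter k a y" "k \<le> length y" "a \<in> A" by blast
    then have "(b # y, b # z) \<in> ?R"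
      unfolding mem_Collect_eq
      by (intro exI[of _ "Suc k"] exI[of _ a] exI[of _ "b # y"]) (simp add: insert_letter_Cons)
    then show ?case using step.IH by (rule rtrancl_into_rtrancl[rotated])
  qed simp
  show ?case
  proof (cases "\<exists>u'. u = b # u'")
    case True
    then obtain u' where u: "u = b # u'" by blast
    have "(u', w) \<in> ?R\<^sup>*"
    proof (rule Cons.IH)
      show "subseq u' w" using Cons.prems(1) u by simp
      show "count_list u' a = count_list w a" if "a \<notin> A" for a
        using Cons.prems(2)[OF that] u by (auto split: if_splits)
    qed
    then show ?thesis unfolding u by (rule cong)
  next
    case False
    then have sub: "subseq u w" using Cons.prems(1) by (cases u) (auto split: if_splits)
    have bA: "b \<in> A"
    proof (rule ccontr)
      assume "b \<notin> A"
      from Cons.prems(2)[OF this] subseq_count_le[OF sub, of b] show False by simp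
    qed
    have "(u, w) \<in> ?R\<^sup>*"
    proof (rule Cons.IH[OF sub])
      show "count_list u a = count_list w a" if "a \<notin> A" for a
        using Cons.prems(2)[OF that] that bA by (auto split: if_splits)
    qed
    moreover have "(w, b # w) \<in> ?R"
      unfolding mem_Collect_eq
      by (intro exI[of _ 0] exI[of _ b] exI[of _ w]) (simp add: bA insert_letter_def)
    ultimately show ?thesis by (rule rtrancl_into_rtrancl)
  qed
qed

section \<open>Attaching the cells with a given set of occupied edges\<close>

context finite_graph begin

lemma push_conf_discrete:
  assumes x: "x \<in> discrete_confs n" shows "push_conf n m x \<in> discrete_confs n"
  unfolding discrete_confs_def
proof (intro CollectI conjI ballI impI)
  have xP: "x \<in> {1..n} \<rightarrow>\<^sub>E topspace G" using x by (simp add: discrete_confs_def)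
  then show "push_conf n m x \<in> {1..n} \<rightarrow>\<^sub>E topspace G" by (rule push_conf_PiE)
  fix e i j assume e: "e \<in> E" and ij: "i \<in> {1..n}" "j \<in> {1..n}"
    and pe: "push_conf n m x i \<in> e" "push_conf n m x j \<in> e"
  have "x i \<in> e" "x j \<in> e"
    using push_in_edge_imp[OF e PiE_mem[OF xP ij(1)], of m] push_in_edge_imp[OF e PiE_mem[OF xP ij(2)], of m] pe ij
    by (simp_all add: push_conf_def)
  then show "i = j" using x e ij unfolding discrete_confs_def by blast
qed

lemma occupied_push_conf:
  assumes x: "x \<in> discrete_confs n" shows "occupied n (push_conf n m x) \<subseteq> occupied n x"
proof
  have xP: "x \<in> {1..n} \<rightarrow>\<^sub>E topspace G" using x by (simp add: discrete_confs_def)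
  fix e assume "e \<in> occupied n (push_conf n m x)"
  then obtain j where e: "e \<in> E" and j: "j \<in> {1..n}" "push_conf n m x j \<in> e"
    unfolding occupied_def by blast
  then have "x j \<in> e" using push_in_edge_imp[OF e PiE_mem[OF xP j(1)], of m] by (simp add: push_conf_def)
  then show "e \<in> occupied n x" unfolding occupied_def using e j(1) by blast
qed

lemma push_conf_strata:
  assumes "\<And>A B. A \<in> \<F> \<Longrightarrow> B \<subseteq> A \<Longrightarrow> B \<in> \<F>" "x \<in> strata \<F> n"
  shows "push_conf n m x \<in> strata \<F> n"
proof -
  have x: "x \<in> discrete_confs n" "occupied n x \<in> \<F>" using assms(2) by (simp_all add: strata_def)
  show ?thesis
    unfolding strata_def using push_conf_discrete[OF x(1)] assms(1)[OF x(2) occupied_push_conf[OF x(1)]] by simp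
qed

text \<open>
  The depth of the point on \<open>e\<close>, if there is one; it vanishes exactly if
  \<open>e\<close> is not occupied.
\<close>

definition edge_depth :: "nat \<Rightarrow> 'a set \<Rightarrow> (nat \<Rightarrow> 'a) \<Rightarrow> real" where
  "edge_depth n e x = Max (insert 0 ((\<lambda>j. depth e (x j)) ` {1..n}))"

lemma edge_depth_cont: "e \<in> E \<Longrightarrow> continuous_map (ambient n) euclideanreal (edge_depth n e)"
  unfolding edge_depth_def[abs_def] by (intro continuous_map_Max_insert_0 depth_proj_cont) auto

lemma edge_depth_less_iff: "0 < c \<Longrightarrow> edge_depth n e x < c \<longleftrightarrow> (\<forall>j\<in>{1..n}. depth e (x j) < c)"
  unfolding edge_depth_def by (subst Max_less_iff) auto

lemma edge_depth_le_0_iff: "e \<in> E \<Longrightarrow> edge_depth n e x \<le> 0 \<longleftrightarrow> e \<notin> occupied n x"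
  unfolding edge_depth_def occupied_def using depth_pos_iff[of e]
  by (subst Max_le_iff) (auto simp: not_less[symmetric])

end

text \<open>
  One step of the filtration of the discrete configurations by sets of occupied edges: the
  families \<open>\<F>\<close> and \<open>insert D \<F>\<close> are closed downwards, so both cut
  out closed subcomplexes, and their difference consists of the configurations that occupy exactly
  the edges in \<open>D\<close>. It is a disjoint union of open cubes of dimension \<open>card
  D\<close>.
\<close>

locale cell_step = finite_graph G V E \<phi>
  for G :: "'a topology" and V E \<phi> +
  fixes \<F> :: "'a set set set" and D :: "'a set set"
  assumes D_sub: "D \<subseteq> E" and D_new: "D \<notin> \<F>"
    and down: "A \<in> \<F> \<Longrightarrow> B \<subseteq> A \<Longrightarrow> B \<in> \<F>" and proper: "B \<subset> D \<Longrightarrow> B \<in> \<F>"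
begin

lemma finite_D: "finite D" by (rule finite_subset[OF D_sub finite_E])

abbreviation old :: "nat \<Rightarrow> (nat \<Rightarrow> 'a) set" where "old \<equiv> strata \<F>"

abbreviation new :: "nat \<Rightarrow> (nat \<Rightarrow> 'a) set" where "new \<equiv> strata (insert D \<F>)"

lemma old_subset_new: "old n \<subseteq> new n" by (auto simp: strata_def)

lemma down_insert: "A \<in> insert D \<F> \<Longrightarrow> B \<subseteq> A \<Longrightarrow> B \<in> insert D \<F>"
  using down proper by blast

lemma new_top: "new n \<subseteq> topspace (ambient n)" using discrete_confs_top by (auto simp: strata_def)

lemma new_minus_old: "x \<in> new n - old n \<longleftrightarrow> x \<in> discrete_confs n \<and> occupied n x = D"
  using D_new by (auto simp: strata_def)

lemma old_iff:
  assumes x: "x \<in> new n" shows "x \<in> old n \<longleftrightarrow> (\<exists>e\<in>D. e \<notin> occupied n x)"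
proof
  assume "x \<in> old n"
  then have "occupied n x \<in> \<F>" by (simp add: strata_def)
  then have "\<not> D \<subseteq> occupied n x" using down D_new by blast
  then show "\<exists>e\<in>D. e \<notin> occupied n x" by blast
next
  assume "\<exists>e\<in>D. e \<notin> occupied n x"
  then have "occupied n x \<noteq> D" by blast
  then show "x \<in> old n" using x by (simp add: strata_def)
qed

definition letters :: "('a + 'a set) set" where "letters = Inl ` V \<union> Inr ` D"

text \<open>
  A cube is described by the word of the cells that contain the first, second, ... point. As each
  edge of \<open>D\<close> occurs exactly once, it can serve as the name of the coordinate of the
  point that moves on it; therefore inserting points at vertices does not affect the coordinates
  of a cube.
\<close>

definition words :: "nat \<Rightarrow> ('a + 'a set) list set" where
  "words n = {w. length w = n \<and> set w \<subseteq> letters \<and> (\<forall>e\<in>D. count_list w (Inr e) = 1)}"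

lemma finite_letters: "finite letters" using finite_V finite_D by (simp add: letters_def)

lemma finite_words: "finite (words n)"
proof (rule finite_subset)
  show "words n \<subseteq> {w. set w \<subseteq> letters \<and> length w = n}" by (auto simp: words_def)
qed (rule finite_lists_length_eq[OF finite_letters])

lemma letter_cases:
  assumes "w \<in> words n" "j \<in> {1..n}"
  obtains v where "v \<in> V" "w ! (j - 1) = Inl v" | e where "e \<in> D" "w ! (j - 1) = Inr e"
proof -
  have "j - 1 < length w" using assms by (auto simp: words_def)
  then have "w ! (j - 1) \<in> set w" by (rule nth_mem)
  then have "w ! (j - 1) \<in> letters" using assms(1) by (auto simp: words_def)
  then show thesis using that by (auto simp: letters_def)
qed

lemma word_position:
  assumes w: "w \<in> words n" and e: "e \<in> D"
  shows "\<exists>!j. j \<in> {1..n} \<and> w ! (j - 1) = Inr e"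
proof -
  have "\<exists>!i. i < n \<and> w ! i = Inr e" using w e count_list_one_iff[of w "Inr e"] by (auto simp: words_def)
  then obtain i where i: "i < n" "w ! i = Inr e" and u: "\<And>i'. i' < n \<Longrightarrow> w ! i' = Inr e \<Longrightarrow> i' = i" by blast
  show ?thesis
  proof (rule ex1I[of _ "Suc i"])
    show "Suc i \<in> {1..n} \<and> w ! (Suc i - 1) = Inr e" using i by simp
    fix j assume j: "j \<in> {1..n} \<and> w ! (j - 1) = Inr e"
    then have "j - 1 = i" by (intro u) auto
    then show "j = Suc i" using j by auto
  qed
qed

definition position :: "nat \<Rightarrow> ('a + 'a set) list \<Rightarrow> 'a set \<Rightarrow> nat" where
  "position n w e = (THE j. j \<in> {1..n} \<and> w ! (j - 1) = Inr e)"

lemma position: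
  assumes "w \<in> words n" "e \<in> D"
  shows "position n w e \<in> {1..n}" "w ! (position n w e - 1) = Inr e"
  using theI'[OF word_position[OF assms]] unfolding position_def by blast+

lemma position_unique:
  assumes "w \<in> words n" "e \<in> D" "j \<in> {1..n}" "w ! (j - 1) = Inr e" shows "position n w e = j"
  unfolding position_def by (rule the1_equality[OF word_position[OF assms(1,2)]]) (use assms in simp)

text \<open>
  The points of a configuration are numbered from 1, so the letter of the point \<open>j\<close>
  has the list index \<open>j - 1\<close>.
\<close>

definition cell_map :: "('a + 'a set) list \<Rightarrow> ('a set \<Rightarrow> real) \<Rightarrow> nat \<Rightarrow> 'a" where
  "cell_map w t = (\<lambda>j\<in>{1..length w}. case w ! (j - 1) of Inl v \<Rightarrow> v | Inr e \<Rightarrow> \<phi> e (t e))"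

lemma cell_map_nth:
  assumes "w \<in> words n" "j \<in> {1..n}"
  shows "cell_map w t j = (case w ! (j - 1) of Inl v \<Rightarrow> v | Inr e \<Rightarrow> \<phi> e (t e))"
  using assms by (simp add: cell_map_def words_def)

lemma cell_map_cont:
  assumes w: "w \<in> words n" shows "continuous_map (cube D) (ambient n) (cell_map w)"
  unfolding continuous_map_componentwise
proof (intro conjI ballI)
  show "cell_map w ` topspace (cube D) \<subseteq> extensional {1..n}"
    using w by (auto simp: cell_map_def words_def)
  fix j assume j: "j \<in> {1..n}"
  show "continuous_map (cube D) G (\<lambda>t. cell_map w t j)"
    using w j
  proof (cases rule: letter_cases)
    case (1 v)
    then show ?thesis using V_sub by (auto simp: cell_map_nth[OF w j])
  next
    case (2 e)
    then have e: "e \<in> E" using D_sub by blast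
    have "continuous_map (cube D) (top_of_set {0..1}) (\<lambda>t. t e)"
      unfolding cube_def by (rule continuous_map_product_projection[OF 2(1)])
    from continuous_map_compose[OF this phi_cont[OF e]] show ?thesis
      by (simp add: cell_map_nth[OF w j] 2(2)[simplified] o_def)
  qed
qed

lemma cell_map_mem_edge:
  assumes w: "w \<in> words n" and j: "j \<in> {1..n}" and t: "t \<in> topspace (cube D)" and e: "e \<in> E"
  shows "cell_map w t j \<in> e \<longleftrightarrow> w ! (j - 1) = Inr e \<and> 0 < t e \<and> t e < 1"
  using w j
proof (cases rule: letter_cases)
  case (1 v)
  then show ?thesis using not_V[OF e, of v] by (auto simp: cell_map_nth[OF w j])
next
  case (2 e')
  have e': "e' \<in> E" using 2(1) D_sub by blast
  have r: "t e' \<in> {0..1}" using t 2(1) unfolding topspace_cube by (rule PiE_mem)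
  have val: "cell_map w t j = \<phi> e' (t e')" by (simp add: cell_map_nth[OF w j] 2(2)[simplified])
  show ?thesis
  proof (cases "0 < t e' \<and> t e' < 1")
    case True
    then have m: "\<phi> e' (t e') \<in> e'" using phi_mem[OF e'] by blast
    show ?thesis
    proof (cases "e = e'")
      case False
      then have "\<phi> e' (t e') \<notin> e" using E_unique[OF e e' _ m] by blast
      then show ?thesis using val 2(2) False by simp
    qed (use True m val 2(2) in simp)
  next
    case False
    then have "\<phi> e' (t e') \<notin> e" using phi_V[OF e' r] not_V[OF e] by blast
    then show ?thesis using val 2(2) False by auto
  qed
qed

lemma cell_map_discrete:
  assumes w: "w \<in> words n" and t: "t \<in> topspace (cube D)"
  shows "cell_map w t \<in> discrete_confs n"
  unfolding discrete_confs_def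
proof (intro CollectI conjI ballI impI)
  show "cell_map w t \<in> {1..n} \<rightarrow>\<^sub>E topspace G"
    using subsetD[OF continuous_map_image_subset_topspace[OF cell_map_cont[OF w]] imageI[OF t]] by simp
  fix e i j assume e: "e \<in> E" and ij: "i \<in> {1..n}" "j \<in> {1..n}"
    and m: "cell_map w t i \<in> e" "cell_map w t j \<in> e"
  then have ww: "w ! (i - 1) = Inr e" "w ! (j - 1) = Inr e" using cell_map_mem_edge[OF w _ t e] by blast+
  have "e \<in> D" using w ij(1) by (cases rule: letter_cases) (use ww in auto)
  then show "i = j" using position_unique[OF w _ ij(1) ww(1)] position_unique[OF w _ ij(2) ww(2)] by simp
qed

lemma occupied_cell_map:
  assumes w: "w \<in> words n" and t: "t \<in> topspace (cube D)"
  shows "occupied n (cell_map w t) = {e \<in> D. 0 < t e \<and> t e < 1}"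
proof
  show "occupied n (cell_map w t) \<subseteq> {e \<in> D. 0 < t e \<and> t e < 1}"
  proof
    fix e assume "e \<in> occupied n (cell_map w t)"
    then obtain j where e: "e \<in> E" and j: "j \<in> {1..n}" "cell_map w t j \<in> e" unfolding occupied_def by blast
    then have m: "w ! (j - 1) = Inr e" "0 < t e \<and> t e < 1" using cell_map_mem_edge[OF w j(1) t e] by blast+
    have "e \<in> D" using w j(1) by (cases rule: letter_cases) (use m in auto)
    then show "e \<in> {e \<in> D. 0 < t e \<and> t e < 1}" using m by simp
  qed
  show "{e \<in> D. 0 < t e \<and> t e < 1} \<subseteq> occupied n (cell_map w t)"
  proof
    fix e assume e: "e \<in> {e \<in> D. 0 < t e \<and> t e < 1}"
    then have eD: "e \<in> D" and eE: "e \<in> E" using D_sub by auto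
    have "cell_map w t (position n w e) \<in> e"
      using cell_map_mem_edge[OF w position(1)[OF w eD] t eE] position(2)[OF w eD] e by simp
    then show "e \<in> occupied n (cell_map w t)"
      unfolding occupied_def using eE position(1)[OF w eD] by blast
  qed
qed

lemma cell_map_new:
  assumes w: "w \<in> words n" and t: "t \<in> topspace (cube D)" shows "cell_map w t \<in> new n"
proof -
  have "occupied n (cell_map w t) \<in> insert D \<F>"
    by (rule down_insert[of D]) (auto simp: occupied_cell_map[OF assms])
  then show ?thesis using cell_map_discrete[OF assms] by (simp add: strata_def)
qed

lemma cell_map_boundary:
  assumes w: "w \<in> words n" and t: "t \<in> cube_boundary D" shows "cell_map w t \<in> old n"
proof -
  have t': "t \<in> topspace (cube D)" using t by (simp add: cube_boundary_def)
  obtain e where "e \<in> D" "t e = 0 \<or> t e = 1" using t by (auto simp: cube_boundary_def)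
  then have "e \<in> D" "e \<notin> occupied n (cell_map w t)" by (auto simp: occupied_cell_map[OF w t'])
  then show ?thesis using old_iff[OF cell_map_new[OF w t']] by blast
qed

lemma cell_map_cont_new:
  assumes w: "w \<in> words n" shows "continuous_map (cube D) (conf_space n (new n)) (cell_map w)"
  unfolding continuous_map_in_subtopology using cell_map_cont[OF w] cell_map_new[OF w] by blast

lemma insert_letter_words:
  assumes w: "w \<in> words n" and k: "k \<le> n" and v: "v \<in> V"
  shows "insert_letter k (Inl v) w \<in> words (Suc n)"
proof -
  have "length w = n" using w by (simp add: words_def)
  then show ?thesis
    using w k v by (simp add: words_def length_insert_letter set_insert_letter count_insert_letter letters_def)
qed

lemma insert_point_cell_map:
  assumes w: "w \<in> words n" and k: "k \<le> n" and v: "v \<in> V"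
  shows "insert_point n k v (cell_map w t) = cell_map (insert_letter k (Inl v) w) t"
proof
  fix j
  have len: "length w = n" using w by (simp add: words_def)
  show "insert_point n k v (cell_map w t) j = cell_map (insert_letter k (Inl v) w) t j"
  proof (cases "j \<in> {1..Suc n}")
    case True
    have c: "cell_map (insert_letter k (Inl v) w) t j
        = (case insert_letter k (Inl v) w ! (j - 1) of Inl v \<Rightarrow> v | Inr e \<Rightarrow> \<phi> e (t e))"
      by (rule cell_map_nth[OF insert_letter_words[OF assms] True])
    have nth: "insert_letter k (Inl v) w ! (j - 1)
        = (if j - 1 < k then w ! (j - 1) else if j - 1 = k then Inl v else w ! (j - 1 - 1))"
      by (rule nth_insert_letter) (use len k True in auto)
    consider "j \<le> k" | "j = Suc k" | "Suc k < j" by linarith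
    then show ?thesis
    proof cases
      case 1
      then have "j \<in> {1..n}" "j - 1 < k" using True k by auto
      then show ?thesis unfolding c nth using 1 True
        by (simp add: insert_point_def cell_map_nth[OF w \<open>j \<in> {1..n}\<close>])
    next
      case 2
      then show ?thesis unfolding c nth using True by (simp add: insert_point_def)
    next
      case 3
      then have "j - 1 \<in> {1..n}" "\<not> j - 1 < k" "j - 1 \<noteq> k" using True k by auto
      then show ?thesis unfolding c nth using 3 True
        by (simp add: insert_point_def cell_map_nth[OF w \<open>j - 1 \<in> {1..n}\<close>, simplified])
    qed
  next
    case False
    then show ?thesis
      using len k by (simp add: insert_point_def cell_map_def length_insert_letter del: atLeastAtMost_iff)
  qed
qed

definition letter_cell :: "'a + 'a set \<Rightarrow> 'a set" where
  "letter_cell a = (case a of Inl v \<Rightarrow> {v} | Inr e \<Rightarrow> e)"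

definition open_cell :: "nat \<Rightarrow> ('a + 'a set) list \<Rightarrow> (nat \<Rightarrow> 'a) set" where
  "open_cell n w = {x \<in> new n. \<forall>j\<in>{1..n}. x j \<in> letter_cell (w ! (j - 1))}"

lemma letter_cell_unique:
  assumes "a \<in> letters" "b \<in> letters" "x \<in> letter_cell a" "x \<in> letter_cell b" shows "a = b"
proof (cases a)
  case (Inl v)
  then have v: "x = v" "v \<in> V" using assms(1,3) by (auto simp: letters_def letter_cell_def)
  show ?thesis
  proof (cases b)
    case b: (Inl u)
    then show ?thesis using v assms(4) Inl by (simp add: letter_cell_def)
  next
    case (Inr e)
    then have "e \<in> E" "x \<in> e" using assms(2,4) D_sub by (auto simp: letters_def letter_cell_def)
    then show ?thesis using not_V[of e x] v by blast
  qed
next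
  case (Inr e)
  then have e: "e \<in> E" "x \<in> e" using assms(1,3) D_sub by (auto simp: letters_def letter_cell_def)
  show ?thesis
  proof (cases b)
    case (Inl u)
    then have "x \<in> V" using assms(2,4) by (auto simp: letters_def letter_cell_def)
    then show ?thesis using not_V[OF e] by blast
  next
    case b: (Inr e')
    then have "e' \<in> E" "x \<in> e'" using assms(2,4) D_sub by (auto simp: letters_def letter_cell_def)
    then have "e = e'" using E_unique[OF e(1) _ e(2)] by blast
    then show ?thesis using b Inr by simp
  qed
qed

lemma nth_letters: "w \<in> words n \<Longrightarrow> j \<in> {1..n} \<Longrightarrow> w ! (j - 1) \<in> letters"
  using nth_mem[of "j - 1" w] by (auto simp: words_def)

lemma occupied_open_cell:
  assumes w: "w \<in> words n" and x: "x \<in> open_cell n w" shows "occupied n x = D"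
proof
  have xl: "x j \<in> letter_cell (w ! (j - 1))" if "j \<in> {1..n}" for j using x that by (simp add: open_cell_def)
  show "occupied n x \<subseteq> D"
  proof
    fix e assume "e \<in> occupied n x"
    then obtain j where e: "e \<in> E" and j: "j \<in> {1..n}" "x j \<in> e" unfolding occupied_def by blast
    show "e \<in> D"
      using w j(1)
    proof (cases rule: letter_cases)
      case (1 v)
      then show ?thesis using xl[OF j(1)] not_V[OF e j(2)] by (simp add: letter_cell_def)
    next
      case (2 e')
      then have "x j \<in> e'" "e' \<in> E" using xl[OF j(1)] D_sub by (auto simp: letter_cell_def)
      then show ?thesis using E_unique[OF e _ j(2)] 2(1) by blast
    qed
  qed
  show "D \<subseteq> occupied n x"
  proof
    fix e assume e: "e \<in> D"
    then have "x (position n w e) \<in> e"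
      using xl[OF position(1)[OF w e]] position(2)[OF w e] by (simp add: letter_cell_def)
    then show "e \<in> occupied n x"
      unfolding occupied_def using position(1)[OF w e] e D_sub by blast
  qed
qed

lemma open_cell_subset:
  assumes "w \<in> words n" shows "open_cell n w \<subseteq> new n - old n"
proof
  fix x assume x: "x \<in> open_cell n w"
  then have "x \<in> discrete_confs n" by (simp add: open_cell_def strata_def)
  then show "x \<in> new n - old n" unfolding new_minus_old using occupied_open_cell[OF assms x] by simp
qed

lemma open_cells_disjoint:
  assumes w: "w \<in> words n" "w' \<in> words n" "w \<noteq> w'"
  shows "disjnt (open_cell n w) (open_cell n w')"
proof (rule ccontr)
  assume "\<not> ?thesis"
  then obtain x where x: "x \<in> open_cell n w" "x \<in> open_cell n w'" by (auto simp: disjnt_def)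
  have len: "length w = n" "length w' = n" using w by (simp_all add: words_def)
  have "w = w'"
  proof (rule nth_equalityI)
    fix i assume "i < length w"
    then have j: "Suc i \<in> {1..n}" using len by simp
    have "x (Suc i) \<in> letter_cell (w ! i)" "x (Suc i) \<in> letter_cell (w' ! i)"
      using x j unfolding open_cell_def by fastforce+
    then show "w ! i = w' ! i"
      using letter_cell_unique nth_letters[OF w(1) j] nth_letters[OF w(2) j] by simp
  qed (use len in simp)
  with w(3) show False by blast
qed

lemma open_cells_cover: "(\<Union>w\<in>words n. open_cell n w) = new n - old n"
proof
  show "(\<Union>w\<in>words n. open_cell n w) \<subseteq> new n - old n" using open_cell_subset by blast
  show "new n - old n \<subseteq> (\<Union>w\<in>words n. open_cell n w)"
  proof
    fix x assume xn: "x \<in> new n - old n"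
    then have x: "x \<in> discrete_confs n" and occ: "occupied n x = D" unfolding new_minus_old by blast+
    have xP: "x \<in> {1..n} \<rightarrow>\<^sub>E topspace G" using x by (simp add: discrete_confs_def)
    have "\<exists>a. a \<in> letters \<and> x j \<in> letter_cell a" if j: "j \<in> {1..n}" for j
      using PiE_mem[OF xP j]
    proof (cases rule: point_cases)
      case 1
      then show ?thesis by (intro exI[of _ "Inl (x j)"]) (simp add: letters_def letter_cell_def)
    next
      case (2 e)
      then have "e \<in> D" using occ j unfolding occupied_def by blast
      then show ?thesis using 2 by (intro exI[of _ "Inr e"]) (simp add: letters_def letter_cell_def)
    qed
    then obtain a where a: "\<And>j. j \<in> {1..n} \<Longrightarrow> a j \<in> letters \<and> x j \<in> letter_cell (a j)" by metis
    define w where "w = map a [1..<Suc n]"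
    have len: "length w = n" by (simp add: w_def)
    have nth: "w ! i = a (Suc i)" if "i < n" for i using that by (simp add: w_def del: upt_Suc)
    have "set w \<subseteq> letters" using a by (auto simp: w_def)
    moreover have "count_list w (Inr e) = 1" if e: "e \<in> D" for e
      unfolding count_list_one_iff len
    proof -
      have eE: "e \<in> E" using e D_sub by blast
      have ae: "x j \<in> e \<longleftrightarrow> a j = Inr e" if j: "j \<in> {1..n}" for j
      proof
        assume "x j \<in> e"
        then have "x j \<in> letter_cell (Inr e)" "Inr e \<in> letters" using e by (simp_all add: letter_cell_def letters_def)
        then show "a j = Inr e" using letter_cell_unique a[OF j] by blast
      qed (use a[OF j] in \<open>simp add: letter_cell_def\<close>)
      obtain j where j: "j \<in> {1..n}" "x j \<in> e" using e occ unfolding occupied_def by blast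
      show "\<exists>!i. i < n \<and> w ! i = Inr e"
      proof (rule ex1I[of _ "j - 1"])
        show "j - 1 < n \<and> w ! (j - 1) = Inr e" using j ae[OF j(1)] nth[of "j - 1"] by auto
        fix i assume i: "i < n \<and> w ! i = Inr e"
        then have i1: "Suc i \<in> {1..n}" by simp
        then have "x (Suc i) \<in> e" using ae[OF i1] nth[of i] i by simp
        then have "Suc i = j" using x eE i1 j unfolding discrete_confs_def by blast
        then show "i = j - 1" by simp
      qed
    qed
    ultimately have w: "w \<in> words n" using len by (simp add: words_def)
    have "x j \<in> letter_cell (w ! (j - 1))" if j: "j \<in> {1..n}" for j
    proof -
      have "w ! (j - 1) = a j" using nth[of "j - 1"] j by auto
      then show ?thesis using a[OF j] by simp
    qed
    then have "x \<in> open_cell n w" using xn by (simp add: open_cell_def)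
    then show "x \<in> (\<Union>w\<in>words n. open_cell n w)" using w by blast
  qed
qed

text \<open>
  The complement of the other vertices is an open neighbourhood of \<open>v\<close>. In
  configurations where exactly the edges in \<open>D\<close> are occupied, each once, it can
  replace \<open>{v}\<close> in the description of a cell, because the moving points are accounted
  for by the letters that are edges. So the cells are open in the difference of the two
  subcomplexes.
\<close>

definition letter_nhd :: "'a + 'a set \<Rightarrow> 'a set" where
  "letter_nhd a = (case a of Inl v \<Rightarrow> topspace G - (V - {v}) | Inr e \<Rightarrow> e)"

lemma openin_letter_nhd: "a \<in> letters \<Longrightarrow> openin G (letter_nhd a)"
proof -
  assume a: "a \<in> letters"
  have "openin G (topspace G - (V - {v}))" for v
  proof -
    have "closedin G (V - {v})"
      using Hausdorff finite_V V_sub by (intro closedin_Hausdorff_finite) auto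
    then show ?thesis by blast
  qed
  then show ?thesis using a openin_E D_sub by (auto simp: letters_def letter_nhd_def)
qed

lemma open_cell_eq:
  assumes w: "w \<in> words n"
  shows "open_cell n w = new n \<inter> (\<Pi>\<^sub>E j\<in>{1..n}. letter_nhd (w ! (j - 1)))" (is "_ = ?r")
proof
  show "open_cell n w \<subseteq> ?r"
  proof
    fix x assume x: "x \<in> open_cell n w"
    then have xn: "x \<in> new n" by (simp add: open_cell_def)
    then have xP: "x \<in> {1..n} \<rightarrow>\<^sub>E topspace G" by (simp add: strata_def discrete_confs_def)
    have "x j \<in> letter_nhd (w ! (j - 1))" if j: "j \<in> {1..n}" for j
    proof -
      have "x j \<in> letter_cell (w ! (j - 1))" using x j by (simp add: open_cell_def)
      then show ?thesis using PiE_mem[OF xP j]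
        by (cases "w ! (j - 1)") (auto simp: letter_cell_def letter_nhd_def)
    qed
    then have "x \<in> (\<Pi>\<^sub>E j\<in>{1..n}. letter_nhd (w ! (j - 1)))"
      using xP by (simp add: PiE_iff)
    then show "x \<in> ?r" using xn by blast
  qed
  show "?r \<subseteq> open_cell n w"
  proof
    fix x assume "x \<in> ?r"
    then have xn: "x \<in> new n" and xO: "\<And>j. j \<in> {1..n} \<Longrightarrow> x j \<in> letter_nhd (w ! (j - 1))" by auto
    have x: "x \<in> discrete_confs n" using xn by (simp add: strata_def)
    have xP: "x \<in> {1..n} \<rightarrow>\<^sub>E topspace G" using x by (simp add: discrete_confs_def)
    have xpos: "x (position n w e) \<in> e" if "e \<in> D" for e
      using xO[OF position(1)[OF w that]] position(2)[OF w that] by (simp add: letter_nhd_def)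
    have "D \<subseteq> occupied n x"
    proof
      fix e assume "e \<in> D"
      then show "e \<in> occupied n x"
        unfolding occupied_def using xpos position(1)[OF w] D_sub by blast
    qed
    then have "x \<notin> old n" using old_iff[OF xn] by blast
    then have occ: "occupied n x = D" using xn new_minus_old by blast
    have "x j \<in> letter_cell (w ! (j - 1))" if j: "j \<in> {1..n}" for j
      using w j
    proof (cases rule: letter_cases)
      case (1 v)
      have nV: "x j \<notin> V - {v}" using xO[OF j] 1(2) by (simp add: letter_nhd_def)
      show ?thesis
        using PiE_mem[OF xP j]
      proof (cases rule: point_cases)
        case 1
        then show ?thesis using nV \<open>w ! (j - 1) = Inl v\<close> by (simp add: letter_cell_def)
      next
        case (2 e)
        then have e: "e \<in> D" using occ j unfolding occupied_def by blast
        have "position n w e = j"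
          using x 2 xpos[OF e] position(1)[OF w e] j unfolding discrete_confs_def by blast
        then have "w ! (j - 1) = Inr e" using position(2)[OF w e] by simp
        then show ?thesis using \<open>w ! (j - 1) = Inl v\<close> by simp
      qed
    next
      case (2 e)
      then show ?thesis using xO[OF j] by (simp add: letter_nhd_def letter_cell_def)
    qed
    then show "x \<in> open_cell n w" using xn by (simp add: open_cell_def)
  qed
qed

lemma openin_open_cell:
  assumes w: "w \<in> words n" shows "openin (conf_space n (new n)) (open_cell n w)"
proof -
  have "openin (ambient n) (\<Pi>\<^sub>E j\<in>{1..n}. letter_nhd (w ! (j - 1)))"
    using openin_letter_nhd nth_letters[OF w] by (subst openin_PiE) auto
  then show ?thesis unfolding open_cell_eq[OF w] by (rule openin_subtopology_Int2)
qed

text \<open>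
  The coordinates after the push by 1/4, which lie in the closed cube. The value 1/4 could be any
  number strictly between 0 and 1/2: it is the width of the collar of the boundary that is pushed
  onto the boundary.
\<close>

definition cell_coords :: "nat \<Rightarrow> ('a + 'a set) list \<Rightarrow> (nat \<Rightarrow> 'a) \<Rightarrow> 'a set \<Rightarrow> real" where
  "cell_coords n w x = (\<lambda>e\<in>D. expand (1/4) (coord e (x (position n w e))))"

lemma open_cell_position:
  assumes w: "w \<in> words n" and x: "x \<in> open_cell n w" and e: "e \<in> D"
  shows "x (position n w e) \<in> e"
proof -
  have "x (position n w e) \<in> letter_cell (w ! (position n w e - 1))"
    using x position(1)[OF w e] unfolding open_cell_def by blast
  then show ?thesis unfolding position(2)[OF w e] by (simp add: letter_cell_def)
qed

lemma cell_coords_cube: "cell_coords n w x \<in> topspace (cube D)"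
  using expand_range by (auto simp: cell_coords_def topspace_cube)

lemma cell_coords_cont:
  assumes w: "w \<in> words n"
  shows "continuous_map (conf_space n (open_cell n w)) (cube D) (cell_coords n w)"
proof (rule continuous_map_into_cube)
  fix e assume e: "e \<in> D"
  then have eE: "e \<in> E" using D_sub by blast
  have "continuous_map (conf_space n (open_cell n w)) G (\<lambda>x. x (position n w e))"
    by (rule continuous_map_from_subtopology[OF continuous_map_product_projection[OF position(1)[OF w e]]])
  then have "continuous_map (conf_space n (open_cell n w)) (subtopology G e) (\<lambda>x. x (position n w e))"
    unfolding continuous_map_in_subtopology using open_cell_position[OF w _ e] by auto
  from continuous_map_compose[OF this coord_cont[OF eE]]
  have c: "continuous_map (conf_space n (open_cell n w)) euclideanreal (\<lambda>x. coord e (x (position n w e)))"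
    unfolding o_def by (rule continuous_map_into_fulltopology)
  have "continuous_map euclideanreal euclideanreal (expand (1/4))"
    unfolding expand_def[abs_def] by (auto intro!: continuous_intros)
  from continuous_map_compose[OF c this]
  show "continuous_map (conf_space n (open_cell n w)) euclideanreal (\<lambda>x. cell_coords n w x e)"
    using e by (simp add: cell_coords_def o_def)
qed (rule cell_coords_cube)

lemma cell_map_coords:
  assumes w: "w \<in> words n" and x: "x \<in> open_cell n w"
  shows "cell_map w (cell_coords n w x) = push_conf n (\<lambda>_. 1/4) x"
proof
  fix j
  have len: "length w = n" using w by (simp add: words_def)
  show "cell_map w (cell_coords n w x) j = push_conf n (\<lambda>_. 1/4) x j"
  proof (cases "j \<in> {1..n}")
    case True
    have xl: "x j \<in> letter_cell (w ! (j - 1))" using x True by (simp add: open_cell_def)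
    show ?thesis
      using w True
    proof (cases rule: letter_cases)
      case (1 v)
      then show ?thesis using xl True push_V[of v] by (simp add: cell_map_nth[OF w True] letter_cell_def push_conf_def)
    next
      case (2 e)
      then have "x j \<in> e" "e \<in> E" using xl D_sub by (auto simp: letter_cell_def)
      moreover have "position n w e = j" by (rule position_unique[OF w 2(1) True 2(2)])
      ultimately show ?thesis
        using True 2 push_edge[of e "x j" "\<lambda>_. 1/4"]
        by (simp add: cell_map_nth[OF w True] cell_coords_def push_conf_def)
    qed
  next
    case False
    then show ?thesis using len by (simp add: cell_map_def push_conf_def del: atLeastAtMost_iff)
  qed
qed

definition collar :: "nat \<Rightarrow> (nat \<Rightarrow> 'a) set" where
  "collar n = {x \<in> new n. \<exists>e\<in>D. edge_depth n e x < 1/4}"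

lemma cell_coords_boundary:
  assumes w: "w \<in> words n" and x: "x \<in> open_cell n w" "x \<in> collar n"
  shows "cell_coords n w x \<in> cube_boundary D"
proof -
  obtain e where e: "e \<in> D" "edge_depth n e x < 1/4" using x(2) by (auto simp: collar_def)
  have "depth e (x (position n w e)) < 1/4"
    using edge_depth_less_iff[THEN iffD1, OF _ e(2)] position(1)[OF w e(1)] by simp
  then have "ends_depth (coord e (x (position n w e))) < 1/4"
    using open_cell_position[OF w x(1) e(1)] by (simp add: depth_def)
  then have "\<not> (0 < cell_coords n w x e \<and> cell_coords n w x e < 1)"
    using expand_inner_iff[of "1/4" "coord e (x (position n w e))"] e(1) by (simp add: cell_coords_def)
  moreover have "0 \<le> cell_coords n w x e" "cell_coords n w x e \<le> 1"
    using e(1) expand_range by (simp_all add: cell_coords_def)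
  ultimately have "cell_coords n w x e = 0 \<or> cell_coords n w x e = 1" by linarith
  then show ?thesis using cell_coords_cube e(1) by (auto simp: cube_boundary_def)
qed

lemma old_subset_collar: "old n \<subseteq> collar n"
proof
  fix x assume x: "x \<in> old n"
  then have xn: "x \<in> new n" using old_subset_new by blast
  then obtain e where e: "e \<in> D" "e \<notin> occupied n x" using old_iff x by blast
  then have "edge_depth n e x \<le> 0" using edge_depth_le_0_iff[of e n x] D_sub by blast
  then show "x \<in> collar n" using e(1) xn by (auto simp: collar_def intro!: bexI[of _ e])
qed

lemma edge_depth_cont_new: "e \<in> D \<Longrightarrow> continuous_map (conf_space n (new n)) euclideanreal (edge_depth n e)"
  using D_sub by (intro continuous_map_from_subtopology edge_depth_cont) auto

lemma topspace_new: "topspace (conf_space n (new n)) = new n"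
  using new_top by auto

lemma openin_collar: "openin (conf_space n (new n)) (collar n)"
proof -
  have "collar n = (\<Union>e\<in>D. {x \<in> topspace (conf_space n (new n)). edge_depth n e x \<in> {..<1/4}})"
    unfolding topspace_new by (auto simp: collar_def)
  moreover have "openin (conf_space n (new n)) {x \<in> topspace (conf_space n (new n)). edge_depth n e x \<in> {..<1/4}}"
    if "e \<in> D" for e
    by (rule openin_continuous_map_preimage[OF edge_depth_cont_new[OF that]]) simp
  ultimately show ?thesis by auto
qed

lemma closedin_old: "closedin (conf_space n (new n)) (old n)"
proof -
  have e0: "edge_depth n e x \<le> 0 \<longleftrightarrow> e \<notin> occupied n x" if "e \<in> D" for e x
    using edge_depth_le_0_iff that D_sub by blast
  have "old n = (\<Union>e\<in>D. {x \<in> topspace (conf_space n (new n)). edge_depth n e x \<in> {..0}})"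
    (is "_ = ?r")
  proof
    show "old n \<subseteq> ?r"
    proof
      fix x assume x: "x \<in> old n"
      then have xn: "x \<in> new n" using old_subset_new by blast
      then obtain e where "e \<in> D" "e \<notin> occupied n x" using old_iff x by blast
      then show "x \<in> ?r" unfolding topspace_new using xn e0 by blast
    qed
    show "?r \<subseteq> old n"
    proof
      fix x assume "x \<in> ?r"
      then obtain e where "e \<in> D" "x \<in> new n" "edge_depth n e x \<le> 0" unfolding topspace_new by auto
      then show "x \<in> old n" using old_iff e0 by blast
    qed
  qed
  moreover have "closedin (conf_space n (new n)) {x \<in> topspace (conf_space n (new n)). edge_depth n e x \<in> {..0}}"
    if "e \<in> D" for e
    by (rule closedin_continuous_map_preimage[OF edge_depth_cont_new[OF that]]) simp
  ultimately show ?thesis using finite_D by (auto intro!: closedin_Union)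
qed

lemma push_collar:
  assumes x: "x \<in> collar n" shows "push_conf n (\<lambda>_. 1/4) x \<in> old n"
proof -
  have xn: "x \<in> new n" using x by (simp add: collar_def)
  have xP: "x \<in> {1..n} \<rightarrow>\<^sub>E topspace G" using xn by (simp add: strata_def discrete_confs_def)
  obtain e where e: "e \<in> D" "edge_depth n e x < 1/4" using x by (auto simp: collar_def)
  have eE: "e \<in> E" using e(1) D_sub by blast
  have "push_conf n (\<lambda>_. 1/4) x j \<notin> e" if j: "j \<in> {1..n}" for j
  proof -
    have "depth e (x j) < 1/4" using edge_depth_less_iff[THEN iffD1, OF _ e(2)] j by simp
    then show ?thesis using push_mem_edge_iff[OF eE PiE_mem[OF xP j], of "\<lambda>_. 1/4"] j
      by (simp add: push_conf_def)
  qed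
  then have "e \<notin> occupied n (push_conf n (\<lambda>_. 1/4) x)" unfolding occupied_def by blast
  moreover have "push_conf n (\<lambda>_. 1/4) x \<in> new n" by (rule push_conf_strata[OF down_insert xn])
  ultimately show ?thesis using old_iff e(1) by blast
qed

definition cell_class :: "int \<Rightarrow> nat \<Rightarrow> ('a + 'a set) list \<Rightarrow> ('a set \<Rightarrow> real) chain set \<Rightarrow> (nat \<Rightarrow> 'a) chain set" where
  "cell_class p n w = hom_induced p (cube D) (cube_boundary D) (conf_space n (new n)) (old n) (cell_map w)"

abbreviation cube_group :: "int \<Rightarrow> ('a set \<Rightarrow> real) chain set monoid" where
  "cube_group p \<equiv> relative_homology_group p (cube D) (cube_boundary D)"

text \<open>
  The push by 1/4 deforms the larger subcomplex, preserves the smaller one, and maps the collar of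
  the smaller one into it. So every relative class is the image under this push of a class
  relative to the collar; excising the smaller subcomplex leaves a disjoint union of open cells;
  and on each of these the push factors through the closed cube.
\<close>

lemma homology_generated_by_cells:
  "carrier (homology_system p new old n) \<subseteq> generate (homology_system p new old n) (\<Union>w\<in>words n. cell_class p n w ` carrier (cube_group p))"
proof
  let ?T = "conf_space n (new n)" and ?A = "old n" and ?U = "collar n"
  let ?H = "\<lambda>X W. relative_homology_group p X W"
  let ?R = "push_conf n (\<lambda>_. 1/4)"
  let ?Y = "subtopology ?T (topspace ?T - ?A)" and ?W = "?U - ?A"
  let ?C = "open_cell n"
  fix z assume "z \<in> carrier (homology_system p new old n)"
  then have z: "z \<in> carrier (?H ?T ?A)" by (simp add: homology_system_def)
  have hom: "homotopic_with (\<lambda>h. h \<in> ?A \<rightarrow> ?A) ?T ?T ?R id"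
    by (rule push_conf_homotopic[OF new_top old_subset_new])
       (use push_conf_strata[OF down_insert] push_conf_strata[OF down] in auto)
  have RT: "continuous_map ?T ?T ?R" by (rule homotopic_with_imp_continuous_maps[OF hom, THEN conjunct1])
  have RU: "?R \<in> ?U \<rightarrow> ?A" using push_collar by blast
  have "z = hom_induced p ?T ?A ?T ?A id z" using z by (simp add: hom_induced_id)
  also have "\<dots> = hom_induced p ?T ?A ?T ?A (?R \<circ> id) z" by (simp only: homology_homotopy_axiom[OF hom] comp_id)
  also have "\<dots> = hom_induced p ?T ?U ?T ?A ?R (hom_induced p ?T ?A ?T ?U id z)"
    by (rule hom_induced_compose'[symmetric]) (use RT RU old_subset_collar[of n] in auto)
  finally have z1: "z = hom_induced p ?T ?U ?T ?A ?R (hom_induced p ?T ?A ?T ?U id z)" .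
  have ex: "hom_induced p ?Y ?W (subtopology ?T (topspace ?T)) ?U id \<in> iso (?H ?Y ?W) (?H (subtopology ?T (topspace ?T)) ?U)"
  proof (rule homology_excision_axiom)
    show "?T closure_of ?A \<subseteq> ?T interior_of ?U"
      using closedin_old openin_collar old_subset_collar
      by (simp add: closure_of_closedin interior_of_openin)
    show "?U \<subseteq> topspace ?T" unfolding topspace_new by (auto simp: collar_def)
  qed
  then have ei: "hom_induced p ?Y ?W ?T ?U id ` carrier (?H ?Y ?W) = carrier (?H ?T ?U)"
    unfolding subtopology_topspace iso_iff by blast
  have "hom_induced p ?T ?A ?T ?U id z \<in> carrier (?H ?T ?U)" by (rule hom_induced_carrier)
  then obtain y where y: "hom_induced p ?T ?A ?T ?U id z = hom_induced p ?Y ?W ?T ?U id y"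
    "y \<in> carrier (?H ?Y ?W)"
    unfolding ei[symmetric] by (rule imageE)
  have idY: "continuous_map ?Y ?T id" by (simp add: continuous_map_from_subtopology)
  have "hom_induced p ?T ?U ?T ?A ?R (hom_induced p ?Y ?W ?T ?U id y) = hom_induced p ?Y ?W ?T ?A (?R \<circ> id) y"
    by (rule hom_induced_compose'[OF idY _ RT RU]) auto
  with z1 have z2: "z = hom_induced p ?Y ?W ?T ?A ?R y" unfolding y(1) comp_id by (rule trans)
  have Yc: "topspace ?T - ?A = (\<Union>w\<in>words n. ?C w)" unfolding topspace_new open_cells_cover ..
  have CY: "?C w \<subseteq> topspace ?T - ?A" if "w \<in> words n" for w unfolding topspace_new using open_cell_subset[OF that] .
  have sub: "subtopology ?Y (?C w) = conf_space n (?C w)" if w: "w \<in> words n" for w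
  proof -
    have "subtopology ?Y (?C w) = conf_space n (new n \<inter> ((topspace ?T - ?A) \<inter> ?C w))"
      by (simp only: subtopology_subtopology Int_assoc)
    moreover have "new n \<inter> ((topspace ?T - ?A) \<inter> ?C w) = ?C w"
      using CY[OF w] open_cell_subset[OF w] by blast
    ultimately show ?thesis by simp
  qed
  let ?g = "\<lambda>w. hom_induced p (subtopology ?Y (?C w)) (?C w \<inter> ?W) ?Y ?W id ` carrier (?H (subtopology ?Y (?C w)) (?C w \<inter> ?W))"
  have "carrier (?H ?Y ?W) \<subseteq> generate (?H ?Y ?W) (\<Union>w\<in>words n. ?g w)"
  proof (rule relative_homology_generated_by_open_pieces[OF finite_words])
    show "openin ?Y (?C w)" if w: "w \<in> words n" for w
      using openin_subtopology_Int2[OF openin_open_cell[OF w], of "topspace ?T - ?A"] CY[OF w]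
      by (simp add: Int_absorb1)
    show "disjnt (?C w) (?C w')" if "w \<in> words n" "w' \<in> words n" "w \<noteq> w'" for w w'
      by (rule open_cells_disjoint[OF that])
    have "topspace ?Y = topspace ?T - ?A" by auto
    then show "(\<Union>w\<in>words n. ?C w) = topspace ?Y" using Yc by simp
    have "?U \<subseteq> topspace ?T" unfolding topspace_new by (auto simp: collar_def)
    then show "?W \<subseteq> topspace ?Y" unfolding \<open>topspace ?Y = topspace ?T - ?A\<close> by blast
  qed
  then have yg: "y \<in> generate (?H ?Y ?W) (\<Union>w\<in>words n. ?g w)" using y(2) by blast
  have z3: "z \<in> generate (?H ?T ?A) (hom_induced p ?Y ?W ?T ?A ?R ` (\<Union>w\<in>words n. ?g w))"
    unfolding z2
    by (rule generate_hom_image[OF _ _ _ _ yg]) (auto simp: hom_induced_hom hom_induced_carrier)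
  have "hom_induced p ?Y ?W ?T ?A ?R ` ?g w \<subseteq> cell_class p n w ` carrier (cube_group p)"
    if w: "w \<in> words n" for w
  proof
    fix a assume "a \<in> hom_induced p ?Y ?W ?T ?A ?R ` ?g w"
    then obtain u where a: "a = hom_induced p ?Y ?W ?T ?A ?R
        (hom_induced p (conf_space n (?C w)) (?C w \<inter> ?W) ?Y ?W id u)"
      unfolding sub[OF w] by blast
    have RY: "continuous_map ?Y ?T ?R" using continuous_map_from_subtopology[OF RT] .
    have idC: "continuous_map (conf_space n (?C w)) ?Y id"
      unfolding sub[OF w, symmetric] by (simp add: continuous_map_from_subtopology)
    have "a = hom_induced p (conf_space n (?C w)) (?C w \<inter> ?W) ?T ?A (?R \<circ> id) u"
      unfolding a by (rule hom_induced_compose'[OF idC _ RY]) (use RU in auto)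
    also have "\<dots> = hom_induced p (conf_space n (?C w)) (?C w \<inter> ?W) ?T ?A (cell_map w \<circ> cell_coords n w) u"
    proof -
      have "hom_induced p (conf_space n (?C w)) (?C w \<inter> ?W) ?T ?A (?R \<circ> id)
          = hom_induced p (conf_space n (?C w)) (?C w \<inter> ?W) ?T ?A (cell_map w \<circ> cell_coords n w)"
        by (rule hom_induced_eq) (use cell_map_coords[OF w] in simp)
      then show ?thesis by simp
    qed
    also have "\<dots> = cell_class p n w
        (hom_induced p (conf_space n (?C w)) (?C w \<inter> ?W) (cube D) (cube_boundary D) (cell_coords n w) u)"
      unfolding cell_class_def
    proof (rule hom_induced_compose'[symmetric, OF cell_coords_cont[OF w] _ cell_map_cont_new[OF w]])
      show "cell_coords n w \<in> ?C w \<inter> ?W \<rightarrow> cube_boundary D" using cell_coords_boundary[OF w] by blast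
      show "cell_map w \<in> cube_boundary D \<rightarrow> ?A" using cell_map_boundary[OF w] by blast
    qed
    finally show "a \<in> cell_class p n w ` carrier (cube_group p)"
      using hom_induced_carrier by blast
  qed
  note img = this
  have "hom_induced p ?Y ?W ?T ?A ?R ` (\<Union>w\<in>words n. ?g w) \<subseteq> (\<Union>w\<in>words n. cell_class p n w ` carrier (cube_group p))"
    unfolding image_UN by (rule UN_mono[OF order_refl img])
  from subsetD[OF group.mono_generate[OF group_relative_homology_group this] z3]
  show "z \<in> generate (homology_system p new old n) (\<Union>w\<in>words n. cell_class p n w ` carrier (cube_group p))"
    unfolding homology_system_def .
qed

definition word_key :: "('a + 'a set) list \<Rightarrow> nat list" where
  "word_key w = map (to_nat_on letters) w"

lemma word_key_inj: "inj_on word_key (words n)"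
proof (rule inj_onI)
  fix u w assume u: "u \<in> words n" and w: "w \<in> words n" and eq: "word_key u = word_key w"
  have "set u \<union> set w \<subseteq> letters" using u w by (simp add: words_def)
  then have "inj_on (to_nat_on letters) (set u \<union> set w)"
    using inj_on_to_nat_on[OF countable_finite[OF finite_letters]] inj_on_subset by blast
  then show "u = w" using eq unfolding word_key_def by (rule map_inj_on[rotated])
qed

text \<open>
  Higman's lemma: the number of occurrences of each edge is the same for all words, so a word that
  contains another one as a subsequence arises from it by inserting vertices.
\<close>

lemma words_wqo:
  fixes f :: "nat \<Rightarrow> nat \<times> ('a + 'a set) list"
  assumes f: "range f \<subseteq> Sigma UNIV words"
  shows "\<exists>m n. m < n \<and> (f m, f n) \<in> {((i, b), (j, (\<lambda>(k, v). insert_letter k (Inl v)) l b)) | i j l b.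
    (i, j, l) \<in> insertions \<and> b \<in> words i}\<^sup>*" (is "\<exists>m n. _ \<and> _ \<in> ?R\<^sup>*")
proof -
  have fw: "snd (f n) \<in> words (fst (f n))" for n using subsetD[OF f rangeI[of f n]] by (cases "f n") auto
  have "set (snd (f n)) \<subseteq> letters" for n using fw[of n] by (simp add: words_def)
  from Higman[of letters "\<lambda>n. snd (f n)", OF finite_letters this]
  obtain m n where mn: "m < n" "subseq (snd (f m)) (snd (f n))" by blast
  have wm: "snd (f m) \<in> words (fst (f m))" and wn: "snd (f n) \<in> words (fst (f n))" using fw by blast+
  have "(snd (f m), snd (f n)) \<in> {(x, insert_letter k a x) | k a x. k \<le> length x \<and> a \<in> Inl ` V}\<^sup>*"
  proof (rule insertions_of_subseq[OF mn(2)])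
    fix a :: "'a + 'a set" assume a: "a \<notin> Inl ` V"
    show "count_list (snd (f m)) a = count_list (snd (f n)) a"
    proof (cases "a \<in> Inr ` D")
      case True
      then show ?thesis using wm wn by (auto simp: words_def)
    next
      case False
      then have "a \<notin> set (snd (f m))" "a \<notin> set (snd (f n))" using a wm wn by (auto simp: words_def letters_def)
      then show ?thesis by (simp add: count_list_0_iff)
    qed
  qed
  then have "\<exists>i. ((fst (f m), snd (f m)), (i, snd (f n))) \<in> ?R\<^sup>* \<and> snd (f n) \<in> words i"
  proof (induction rule: rtrancl_induct)
    case base
    then show ?case using wm by blast
  next
    case (step y z)
    then obtain i where i: "((fst (f m), snd (f m)), (i, y)) \<in> ?R\<^sup>*" "y \<in> words i" by blast
    from step(2) obtain k v where z: "z = insert_letter k (Inl v) y" "k \<le> length y" "v \<in> V" by blast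
    have k: "k \<le> i" using z(2) i(2) by (simp add: words_def)
    have "(i, Suc i, (k, v)) \<in> insertions" using k z(3) by (simp add: insertions_def)
    then have "((i, y), (Suc i, z)) \<in> ?R" using i(2) z(1) by fastforce
    with i(1) have r: "((fst (f m), snd (f m)), (Suc i, z)) \<in> ?R\<^sup>*" by (rule rtrancl_into_rtrancl)
    have "z \<in> words (Suc i)" unfolding z(1) by (rule insert_letter_words[OF i(2) k z(3)])
    with r show ?case by (intro exI conjI)
  qed
  then obtain i where i: "((fst (f m), snd (f m)), (i, snd (f n))) \<in> ?R\<^sup>*" "snd (f n) \<in> words i" by blast
  have "i = fst (f n)" using i(2) wn by (simp add: words_def)
  with i(1) have "(f m, f n) \<in> ?R\<^sup>*" by simp
  with mn(1) show ?thesis by (intro exI conjI)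
qed

lemma noetherian_relative: "noetherian (homology_system p new old) insertions (insertion_action p new old)"
proof -
  interpret monomial_system "homology_system p new old" insertions "insertion_action p new old" "cube_group p" words word_key
    "\<lambda>(k, v). insert_letter k (Inl v)" "cell_class p"
  proof (unfold_locales, goal_cases)
    case 1 show ?case by (rule system_homology_system)
  next
    case 2 show ?case by (rule noetherian_homology_cube_mod_boundary[OF finite_D])
  next
    case (3 i) show ?case by (rule finite_words)
  next
    case (4 i) show ?case by (rule word_key_inj)
  next
    case (5 b i) show ?case by (simp add: cell_class_def homology_system_def hom_induced_hom)
  next
    case (6 i)
    have "(\<Union>b\<in>words i. cell_class p i b ` carrier (cube_group p)) \<subseteq> carrier (homology_system p new old i)"
      by (auto simp: cell_class_def homology_system_def hom_induced_carrier)
    then have "generate (homology_system p new old i) (\<Union>b\<in>words i. cell_class p i b ` carrier (cube_group p)) \<subseteq> carrier (homology_system p new old i)"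
      by (rule group.generate_incl[OF systemD(2)[OF system_homology_system]])
    then show ?case using homology_generated_by_cells by (rule antisym[rotated])
  next
    case (7 i j l b)
    then obtain k v where "j = Suc i" "l = (k, v)" "k \<le> i" "v \<in> V" by (elim insertionsE)
    then show ?case using insert_letter_words[OF 7(2)] by simp
  next
    case (8 i j l b b')
    then obtain k v where l: "l = (k, v)" by (elim insertionsE)
    have "length (word_key b) = length (word_key b')" using 8(2,3) by (simp add: words_def word_key_def)
    from insert_letter_less[OF this 8(4)] show ?case by (simp add: l word_key_def map_insert_letter)
  next
    case (9 i j l b q)
    then obtain k v where l: "j = Suc i" "l = (k, v)" "k \<le> i" "v \<in> V" by (elim insertionsE)
    have st: "continuous_map (conf_space i (new i)) (conf_space (Suc i) (new (Suc i))) (insert_point i k v)"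
      "insert_point i k v \<in> old i \<rightarrow> old (Suc i)"
      using stable_cont[OF stable_strata l(3,4)] stable_funcset[OF stable_strata l(3,4)] by blast+
    have "insertion_action p new old i j l (cell_class p i b q)
        = hom_induced p (cube D) (cube_boundary D) (conf_space (Suc i) (new (Suc i))) (old (Suc i)) (insert_point i k v \<circ> cell_map b) q"
      unfolding insertion_action_def cell_class_def l(1,2) fst_conv snd_conv
      by (rule hom_induced_compose'[OF cell_map_cont_new[OF 9(2)] _ st]) (use cell_map_boundary[OF 9(2)] in blast)
    moreover have "insert_point i k v \<circ> cell_map b = cell_map (insert_letter k (Inl v) b)"
      using insert_point_cell_map[OF 9(2) l(3,4)] by (simp add: fun_eq_iff)
    ultimately show ?case by (simp add: cell_class_def l(1,2))
  next
    case (10 f) then show ?case by (rule words_wqo)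
  qed
  show ?thesis by (rule noetherian)
qed

end

section \<open>Finite generation\<close>

context finite_graph begin

text \<open>
  Remove a maximal set of edges from the family and apply the long exact sequence of the pair.
\<close>

lemma noetherian_strata:
  assumes "finite \<F>" "\<F> \<subseteq> Pow E" "\<And>A B. A \<in> \<F> \<Longrightarrow> B \<subseteq> A \<Longrightarrow> B \<in> \<F>"
  shows "noetherian (homology_system p (strata \<F>) (\<lambda>_. {})) insertions (insertion_action p (strata \<F>) (\<lambda>_. {}))"
  using assms
proof (induction \<F> rule: finite_remove_induct)
  case empty
  have "trivial_group (homology_system p (strata {}) (\<lambda>_. {}) n)" for n
    unfolding homology_system_def by (rule trivial_homology_group_empty) (simp add: strata_def)
  then show ?case by (rule noetherian_trivial)
next
  case (remove \<F>)
  obtain D where D: "D \<in> \<F>" and maxD: "\<And>A. A \<in> \<F> \<Longrightarrow> D \<subseteq> A \<Longrightarrow> A = D"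
    using finite_has_maximal[OF remove.hyps(1,2)] by blast
  let ?\<F> = "\<F> - {D}"
  have down: "B \<in> ?\<F>" if "A \<in> ?\<F>" "B \<subseteq> A" for A B
    using that remove.prems(2)[of A B] maxD[of A] by auto
  \<comment> \<open>As \<open>D\<close> is maximal in \<open>\<F>\<close>, the remaining family is
  closed downwards.\<close>
  interpret cell_step G V E \<phi> ?\<F> D
  proof unfold_locales
    show "D \<subseteq> E" using D remove.prems(1) by blast
    show "B \<in> ?\<F>" if "B \<subset> D" for B using that remove.prems(2)[OF D, of B] by blast
    show "B \<in> ?\<F>" if "A \<in> ?\<F>" "B \<subseteq> A" for A B by (rule down[OF that])
  qed simp
  have eq: "insert D ?\<F> = \<F>" using D by blast
  have IH: "noetherian (homology_system p (strata ?\<F>) (\<lambda>_. {})) insertions (insertion_action p (strata ?\<F>) (\<lambda>_. {}))"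
  proof (rule remove.IH[OF D])
    show "?\<F> \<subseteq> Pow E" using remove.prems(1) by blast
    show "B \<in> ?\<F>" if "A \<in> ?\<F>" "B \<subseteq> A" for A B by (rule down[OF that])
  qed
  from noetherian_homology_extension[OF stable_strata stable_strata old_subset_new IH noetherian_relative]
  show ?case unfolding eq .
qed

lemma noetherian_conf_sink:
  "noetherian (homology_system p (\<lambda>n. topspace (conf_sink G V n)) (\<lambda>_. {})) insertions
     (insertion_action p (\<lambda>n. topspace (conf_sink G V n)) (\<lambda>_. {}))"
proof (rule noetherian_surj[OF system_homology_system system_homology_system
      system_hom_inclusion[OF stable_strata stable_empty stable_conf_sink stable_empty]])
  have all: "strata (Pow E) n = discrete_confs n" for n
    by (auto simp: strata_def occupied_def)
  show "strata (Pow E) n \<subseteq> topspace (conf_sink G V n)" for n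
    unfolding all by (rule discrete_confs_conf_sink)
  show "noetherian (homology_system p (strata (Pow E)) (\<lambda>_. {})) insertions (insertion_action p (strata (Pow E)) (\<lambda>_. {}))"
    using finite_E by (intro noetherian_strata) auto
  show "carrier (homology_system p (\<lambda>n. topspace (conf_sink G V n)) (\<lambda>_. {}) n)
      \<subseteq> hom_induced p (conf_space n (strata (Pow E) n)) {} (conf_space n (topspace (conf_sink G V n))) {} id
        ` carrier (homology_system p (strata (Pow E)) (\<lambda>_. {}) n)" for n
    unfolding homology_system_def all conf_sink_eq[symmetric] by (rule conf_sink_homology_from_discrete)
qed simp

text \<open>
  A submodule is in particular closed under the order-preserving insertions of single points, and
  finite generation with respect to fewer morphisms is the stronger property.
\<close>

lemma fin_gen_H_conf: "fin_gen_FIV_module \<Z> V (H_conf G V i) (H_conf_act G V i)"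
  unfolding fin_gen_FIV_module_def
proof (intro conjI)
  show "FIV_module \<Z> V (H_conf G V i) (H_conf_act G V i)" by (rule FIV_module_H_conf[OF V_sub])
  let ?X = "\<lambda>n. topspace (conf_sink G V n)"
  let ?H = "homology_system (int i) ?X (\<lambda>_. {})" and ?act = "insertion_action (int i) ?X (\<lambda>_. {})"
  have H: "?H n = homology_group (int i) (conf_sink G V n)" for n
    unfolding homology_system_def conf_sink_eq[symmetric] ..
  have act: "?act n (Suc n) (k, v) = H_conf_act G V i n (Suc n) (insert_hom n k v)" if "k \<le> n" for n k v
    unfolding insertion_action_def H_conf_act_def conf_sink_eq[symmetric] fst_conv snd_conv
    by (rule hom_induced_eq) (simp add: conf_map_insert_hom[OF that])
  have carrier: "carrier (H_conf G V i n) = carrier (?H n)" for n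
    unfolding H by (simp add: H_conf_def int_module_def)
  obtain S where S: "finite S" "S \<subseteq> Sigma UNIV (\<lambda>n. carrier (?H n))"
    and gen: "\<forall>N' n. subsystem ?H insertions ?act N' \<longrightarrow> S \<subseteq> Sigma UNIV N' \<longrightarrow> carrier (?H n) \<subseteq> N' n"
    by (rule noetherianE[OF noetherian_conf_sink subsystem_carrier[OF system_homology_system]])
  show "\<exists>S. finite S \<and> S \<subseteq> (SIGMA n:UNIV. carrier (H_conf G V i n)) \<and>
      (\<forall>N. FIV_submodule \<Z> V (H_conf G V i) (H_conf_act G V i) N \<and> (\<forall>(n, x)\<in>S. x \<in> N n)
         \<longrightarrow> (\<forall>n. N n = carrier (H_conf G V i n)))"
  proof (intro exI[of _ S] conjI allI impI)
    show "finite S" by (rule S(1))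
    show "S \<subseteq> (SIGMA n:UNIV. carrier (H_conf G V i n))" unfolding carrier by (rule S(2))
    fix N n assume N: "FIV_submodule \<Z> V (H_conf G V i) (H_conf_act G V i) N \<and> (\<forall>(n, x)\<in>S. x \<in> N n)"
    have sub: "subgroup (N n) (?H n)" for n
    proof -
      have "submodule (N n) \<Z> (H_conf G V i n)" using N by (simp add: FIV_submodule_def)
      then have "subgroup (N n) (add_monoid (H_conf G V i n))" by (simp add: submodule_def)
      then show ?thesis
        unfolding H subgroup_def by (auto simp: H_conf_def int_module_def m_inv_def)
    qed
    have "subsystem ?H insertions ?act N"
    proof (rule subsystemI[OF sub])
      fix m j l x assume "(m, j, l) \<in> insertions" and x: "x \<in> N m"
      then obtain k v where l: "j = Suc m" "l = (k, v)" "k \<le> m" "v \<in> V" by (elim insertionsE)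
      show "?act m j l x \<in> N j"
        unfolding l(1,2) act[OF l(3)] using N x insert_hom_FIV[OF l(3,4)] by (simp add: FIV_submodule_def)
    qed
    moreover have "S \<subseteq> Sigma UNIV N" using N by auto
    ultimately have "carrier (?H n) \<subseteq> N n" using gen by simp
    then show "N n = carrier (H_conf G V i n)" unfolding carrier using subgroup.subset[OF sub] by (intro antisym)
  qed
qed

end

theorem theorem4p1:
  fixes G :: "'a topology" and V :: "'a set" and E :: "'a set set" and i :: nat
  assumes "graph G V E"
  shows "fin_gen_FIV_module \<Z> V (H_conf G V i) (H_conf_act G V i)"
proof -
  from assms obtain \<phi> where "finite_graph G V E \<phi>" by (rule finite_graph_exists)
  then show ?thesis by (rule finite_graph.fin_gen_H_conf)
qed

end
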